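(* Assume that $\mathsf{IST}$ is consistent. Then there is no sentence $\Phi$ of the $\in$-language (the language of $\mathsf{ZFC}$) such that the equivalence $\Phi \leftrightarrow (\ast)$ is a theorem of $\mathsf{IST}$, where $(\ast)$ is the $\mathsf{IST}$-sentence $$\forall F\,\Big[\,\forall^{\mathrm{st}} n\,\big(F(n)\text{ is standard}\big)\;\longrightarrow\;\exists^{\mathrm{st}} G\;\forall^{\mathrm{st}} n\,\big(F(n)=G(n)\big)\Big],$$ in which $n$ ranges over natural numbers and $F,G$ range over functions defined on the natural numbers (taking arbitrary values).
   Context: $\mathsf{IST}$ (Nelson's internal set theory) is formulated in the language with $=$, $\in$ and a unary predicate $\mathrm{st}$ ("standard"). Formulas not mentioning $\mathrm{st}$ are called internal ($\in$-formulas). Abbreviations: $\exists^{\mathrm{st}}x\,\varphi$ means $\exists x(\mathrm{st}(x)\wedge\varphi)$, $\forall^{\mathrm{st}}x\,\varphi$ means $\forall x(\mathrm{st}(x)\to\varphi)$, and $\forall^{\mathrm{st\,fin}}A$ means "for all standard finite $A$". $\mathsf{IST}$ consists of all axioms of $\mathsf{ZFC}$ (with Separation and Replacement only for internal formulas) together with the schemes: Idealization: $\forall^{\mathrm{st\,fin}}A\,\exists x\,\forall a\in A\,\Phi(x,a)\leftrightarrow\exists x\,\forall^{\mathrm{st}}a\,\Phi(x,a)$ for every internal $\Phi$ (arbitrary parameters); Standardization: $\forall^{\mathrm{st}}X\,\exists^{\mathrm{st}}Y\,\forall^{\mathrm{st}}x\,[x\in Y\leftrightarrow x\in X\wedge\Phi(x)]$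 for every formula $\Phi$ of the $\mathsf{IST}$ language (arbitrary parameters); Transfer: $\exists x\,\Phi(x)\to\exists^{\mathrm{st}}x\,\Phi(x)$ for every internal $\Phi$ all of whose parameters are standard. *)

theory Defs
  imports Main
begin

datatype fm =
    Eq nat nat
  | Mem nat nat
  | St nat
  | Bot
  | Imp fm fm
  | All nat fm

definition Neg :: "fm \<Rightarrow> fm" where "Neg p = Imp p Bot"
definition Top :: fm where "Top = Neg Bot"
definition Or :: "fm \<Rightarrow> fm \<Rightarrow> fm" where "Or p q = Imp (Neg p) q"
definition And :: "fm \<Rightarrow> fm \<Rightarrow> fm" where "And p q = Neg (Imp p (Neg q))"
definition Iff :: "fm \<Rightarrow> fm \<Rightarrow> fm" where "Iff p q = And (Imp p q) (Imp q p)"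
definition Ex :: "nat \<Rightarrow> fm \<Rightarrow> fm" where "Ex x p = Neg (All x (Neg p))"

fun fv :: "fm \<Rightarrow> nat set" where
  "fv (Eq a b) = {a, b}"
| "fv (Mem a b) = {a, b}"
| "fv (St a) = {a}"
| "fv Bot = {}"
| "fv (Imp p q) = fv p \<union> fv q"
| "fv (All x p) = fv p - {x}"

fun vars :: "fm \<Rightarrow> nat set" where
  "vars (Eq a b) = {a, b}"
| "vars (Mem a b) = {a, b}"
| "vars (St a) = {a}"
| "vars Bot = {}"
| "vars (Imp p q) = vars p \<union> vars q"
| "vars (All x p) = insert x (vars p)"

fun internal :: "fm \<Rightarrow> bool" where
  "internal (St a) = False"
| "internal (Imp p q) = (internal p \<and> internal q)"
| "internal (All x p) = internal p"
| "internal _ = True"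

definition sentence :: "fm \<Rightarrow> bool" where "sentence p \<longleftrightarrow> fv p = {}"

fun subst :: "fm \<Rightarrow> nat \<Rightarrow> nat \<Rightarrow> fm" where
  "subst (Eq a b) x y = Eq (if a = x then y else a) (if b = x then y else b)"
| "subst (Mem a b) x y = Mem (if a = x then y else a) (if b = x then y else b)"
| "subst (St a) x y = St (if a = x then y else a)"
| "subst Bot x y = Bot"
| "subst (Imp p q) x y = Imp (subst p x y) (subst q x y)"
| "subst (All z p) x y = (if z = x then All z p else All z (subst p x y))"

fun substable :: "nat \<Rightarrow> nat \<Rightarrow> fm \<Rightarrow> bool" where
  "substable y x (Imp p q) = (substable y x p \<and> substable y x q)"
| "substable y x (All z p) = (x \<notin> fv (All z p) \<or> (z \<noteq> y \<and> substable y x p))"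
| "substable y x _ = True"

section \<open>Hilbert-style provability (Enderton's calculus, with generalization rule)\<close>

inductive prov :: "fm set \<Rightarrow> fm \<Rightarrow> bool" for T :: "fm set" where
  nonlog: "p \<in> T \<Longrightarrow> prov T p"
| ax1: "prov T (Imp p (Imp q p))"
| ax2: "prov T (Imp (Imp p (Imp q r)) (Imp (Imp p q) (Imp p r)))"
| ax3: "prov T (Imp (Neg (Neg p)) p)"
| ax_inst: "substable y x p \<Longrightarrow> prov T (Imp (All x p) (subst p x y))"
| ax_distr: "prov T (Imp (All x (Imp p q)) (Imp (All x p) (All x q)))"
| ax_vac: "x \<notin> fv p \<Longrightarrow> prov T (Imp p (All x p))"
| eq_refl: "prov T (Eq x x)"
| eq_eq1: "prov T (Imp (Eq x y) (Imp (Eq x z) (Eq y z)))"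
| eq_eq2: "prov T (Imp (Eq x y) (Imp (Eq z x) (Eq z y)))"
| eq_mem1: "prov T (Imp (Eq x y) (Imp (Mem x z) (Mem y z)))"
| eq_mem2: "prov T (Imp (Eq x y) (Imp (Mem z x) (Mem z y)))"
| eq_st: "prov T (Imp (Eq x y) (Imp (St x) (St y)))"
| mp: "prov T (Imp p q) \<Longrightarrow> prov T p \<Longrightarrow> prov T q"
| gen: "prov T p \<Longrightarrow> prov T (All x p)"

definition ax_extensionality :: fm where
  "ax_extensionality = All 0 (All 1 (Imp (All 2 (Iff (Mem 2 0) (Mem 2 1))) (Eq 0 1)))"

definition ax_foundation :: fm where
  "ax_foundation = All 0 (Imp (Ex 1 (Mem 1 0))
      (Ex 1 (And (Mem 1 0) (Neg (Ex 2 (And (Mem 2 1) (Mem 2 0)))))))"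

definition ax_pairing :: fm where
  "ax_pairing = All 0 (All 1 (Ex 2 (And (Mem 0 2) (Mem 1 2))))"

definition ax_union :: fm where
  "ax_union = All 0 (Ex 1 (All 2 (All 3 (Imp (And (Mem 3 2) (Mem 2 0)) (Mem 3 1)))))"

definition ax_power :: fm where
  "ax_power = All 0 (Ex 1 (All 2 (Imp (All 3 (Imp (Mem 3 2) (Mem 3 0))) (Mem 2 1))))"

definition ax_infinity :: fm where
  "ax_infinity = Ex 0 (And (Ex 1 (And (Mem 1 0) (All 2 (Neg (Mem 2 1)))))
      (All 1 (Imp (Mem 1 0) (Ex 2 (And (Mem 2 0) (All 3 (Iff (Mem 3 2) (Or (Mem 3 1) (Eq 3 1)))))))))"

definition ax_choice :: fm where
  "ax_choice = All 0 (Imp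
      (And (All 1 (Imp (Mem 1 0) (Ex 2 (Mem 2 1))))
           (All 1 (All 2 (Imp (And (Mem 1 0) (And (Mem 2 0) (Neg (Eq 1 2))))
                              (Neg (Ex 3 (And (Mem 3 1) (Mem 3 2))))))))
      (Ex 4 (All 1 (Imp (Mem 1 0) (Ex 2 (And (And (Mem 2 1) (Mem 2 4))
                (All 3 (Imp (And (Mem 3 1) (Mem 3 4)) (Eq 3 2)))))))))"

(* Separation: \<forall>A \<exists>S \<forall>x (x \<in> S \<leftrightarrow> x \<in> A \<and> \<phi>), \<phi> internal, S not free in \<phi>; other free vars are parameters *)
definition separation_ax :: "fm set" where
  "separation_ax = {All A (Ex S (All x (Iff (Mem x S) (And (Mem x A) \<phi>)))) | \<phi> x A S.
      internal \<phi> \<and> S \<notin> fv \<phi> \<and> distinct [x, A, S]}"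

(* Replacement: \<forall>A (\<forall>x\<in>A \<exists>!y \<phi> \<longrightarrow> \<exists>B \<forall>x\<in>A \<exists>y\<in>B \<phi>), \<phi> internal, B not free in \<phi>;
   \<exists>!y \<phi> is written \<exists>y (\<phi> \<and> \<forall>z (\<phi>[z/y] \<longrightarrow> z = y)) with z a variable not occurring in \<phi> *)
definition replacement_ax :: "fm set" where
  "replacement_ax = {All A (Imp
        (All x (Imp (Mem x A) (Ex y (And \<phi> (All z (Imp (subst \<phi> y z) (Eq z y)))))))
        (Ex B (All x (Imp (Mem x A) (Ex y (And (Mem y B) \<phi>)))))) | \<phi> x y z A B.
      internal \<phi> \<and> B \<notin> fv \<phi> \<and> z \<notin> vars \<phi> \<and> distinct [x, y, z, A, B]}"

definition ZFC_ax :: "fm set" where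
  "ZFC_ax = {ax_extensionality, ax_foundation, ax_pairing, ax_union, ax_power,
             ax_infinity, ax_choice} \<union> separation_ax \<union> replacement_ax"

(* "A is finite", in Tarski's form: every nonempty family of subsets of A has a \<subseteq>-minimal member.
   Auxiliary bound variables A+1..A+4 are distinct from A; the only free variable is A. *)
definition fin_fm :: "nat \<Rightarrow> fm" where
  "fin_fm A = (let X = A + 1; u = A + 2; w = A + 3; m = A + 4 in
     All X (Imp (And (Ex u (Mem u X)) (All u (Imp (Mem u X) (All w (Imp (Mem w u) (Mem w A))))))
       (Ex m (And (Mem m X) (All u (Imp (And (Mem u X) (All w (Imp (Mem w u) (Mem w m))))
                                      (All w (Imp (Mem w m) (Mem w u)))))))))"

definition idealization_ax :: "fm set" where
  "idealization_ax = {Iff (All A (Imp (And (St A) (fin_fm A)) (Ex x (All a (Imp (Mem a A) \<Phi>)))))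
                          (Ex x (All a (Imp (St a) \<Phi>))) | \<Phi> x a A.
      internal \<Phi> \<and> A \<notin> fv \<Phi> \<and> distinct [x, a, A]}"

definition standardization_ax :: "fm set" where
  "standardization_ax = {All X (Imp (St X) (Ex Y (And (St Y)
        (All x (Imp (St x) (Iff (Mem x Y) (And (Mem x X) \<Phi>))))))) | \<Phi> X Y x.
      Y \<notin> fv \<Phi> \<and> distinct [X, Y, x]}"

definition st_all :: "nat list \<Rightarrow> fm" where
  "st_all ts = foldr (\<lambda>t q. And (St t) q) ts Top"

definition transfer_ax :: "fm set" where
  "transfer_ax = {Imp (st_all ts) (Imp (Ex x \<Phi>) (Ex x (And (St x) \<Phi>))) | \<Phi> x ts.
      internal \<Phi> \<and> fv \<Phi> \<subseteq> insert x (set ts)}"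

definition IST_ax :: "fm set" where
  "IST_ax = ZFC_ax \<union> idealization_ax \<union> standardization_ax \<union> transfer_ax"

definition consistent :: "fm set \<Rightarrow> bool" where
  "consistent T \<longleftrightarrow> \<not> prov T Bot"

definition empty_fm :: "nat \<Rightarrow> nat \<Rightarrow> fm" where
  "empty_fm e u = All u (Neg (Mem u e))"

definition succ_fm :: "nat \<Rightarrow> nat \<Rightarrow> nat \<Rightarrow> fm" where
  "succ_fm s y u = All u (Iff (Mem u s) (Or (Mem u y) (Eq u y)))"

definition inductive_fm :: "nat \<Rightarrow> nat \<Rightarrow> nat \<Rightarrow> nat \<Rightarrow> nat \<Rightarrow> fm" where
  "inductive_fm I e y s u = And (Ex e (And (Mem e I) (empty_fm e u)))
      (All y (Imp (Mem y I) (Ex s (And (Mem s I) (succ_fm s y u)))))"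

definition omega_fm :: "nat \<Rightarrow> nat \<Rightarrow> nat \<Rightarrow> nat \<Rightarrow> nat \<Rightarrow> nat \<Rightarrow> nat \<Rightarrow> fm" where
  "omega_fm w I n e y s u = And (inductive_fm w e y s u)
      (All I (Imp (inductive_fm I e y s u) (All n (Imp (Mem n w) (Mem n I)))))"

(* p = (a, b) (Kuratowski pair {{a},{a,b}}) *)
definition pair_fm :: "nat \<Rightarrow> nat \<Rightarrow> nat \<Rightarrow> nat \<Rightarrow> nat \<Rightarrow> fm" where
  "pair_fm p a b z v = All z (Iff (Mem z p)
      (Or (All v (Iff (Mem v z) (Eq v a))) (All v (Iff (Mem v z) (Or (Eq v a) (Eq v b))))))"

definition app_fm :: "nat \<Rightarrow> nat \<Rightarrow> nat \<Rightarrow> nat \<Rightarrow> nat \<Rightarrow> nat \<Rightarrow> fm" where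
  "app_fm F n y p z v = Ex p (And (Mem p F) (pair_fm p n y z v))"

definition funon_fm :: "nat \<Rightarrow> nat \<Rightarrow> nat \<Rightarrow> nat \<Rightarrow> nat \<Rightarrow> nat \<Rightarrow> nat \<Rightarrow> nat \<Rightarrow> fm" where
  "funon_fm F w p n y y' z v = And
      (All p (Imp (Mem p F) (Ex n (And (Mem n w) (Ex y (pair_fm p n y z v))))))
      (All n (Imp (Mem n w) (Ex y (And (app_fm F n y p z v)
                                  (All y' (Imp (app_fm F n y' p z v) (Eq y' y)))))))"

(* ( * ):  for w = \<omega>:  \<forall>F [F function on \<omega> \<longrightarrow>
      (\<forall>^{st} n\<in>\<omega> \<exists>^{st} v ((n,v) \<in> F)  \<longrightarrow>  \<exists>^{st} G (G function on \<omega> \<and> \<forall>^{st} n\<in>\<omega> F(n) = G(n)))]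
   Variables: 0 = \<omega>, 1 = F, 2 = G, 3 = n, 4 = value; 5..13 auxiliary. *)
definition star :: fm where
  "star = All 0 (Imp (omega_fm 0 5 3 6 7 8 9)
     (All 1 (Imp (funon_fm 1 0 10 3 7 13 11 12)
       (Imp (All 3 (Imp (And (St 3) (Mem 3 0)) (Ex 4 (And (St 4) (app_fm 1 3 4 10 11 12)))))
            (Ex 2 (And (St 2) (And (funon_fm 2 0 10 3 7 13 11 12)
               (All 3 (Imp (And (St 3) (Mem 3 0))
                  (Ex 4 (And (app_fm 1 3 4 10 11 12) (app_fm 2 3 4 10 11 12))))))))))))"

end

theory Submission
  imports Defs "HOL-Library.Countable_Set"
begin

text \<open>
  Let \<open>M\<close> be a model of \<open>IST\<close>. If \<open>W\<close> is a standard set of \<open>M\<close> that is transitive, contains every subset of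
  each of its members and reflects finitely many given \<open>\<in>\<close>-formulas, then the members of \<open>W\<close>, with the membership
  and standardness of \<open>M\<close>, again satisfy Idealization, Standardization and Transfer, and those axioms of \<open>ZFC\<close> that
  are among the reflected formulas. In this structure \<open>(*)\<close> holds if every function from \<open>\<omega>\<close> to \<open>W\<close> is a
  member of \<open>W\<close>: standardize \<open>F\<close> as a subset of \<open>\<omega> \<times> W\<close>. It fails if some standard function \<open>g\<close> from \<open>\<omega>\<close> to
  \<open>W\<close> is not a member of \<open>W\<close>: cut \<open>g\<close> down to a finite set that contains all standard sets. By the reflection
  principle, \<open>M\<close> has sets \<open>W\<close> of both kinds, as unions of chains of levels of the cumulative hierarchy of countable and
  of uncountable cofinality; by Transfer they may be taken standard. Both reflect a given \<open>\<in>\<close>-sentence, so this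
  sentence cannot be equivalent to \<open>(*)\<close> by a proof from the finitely many axioms that were taken into account.
\<close>

section \<open>Satisfaction and soundness\<close>

text \<open>Consistency speaks of derivations, so a model has to be constructed before anything can
  be said about sets. Reflection handles finitely many formulas only, whence the restriction to the
  axioms of one derivation. Transfer, Standardization and Idealization need not be reflected:
  relativizing to a standard \<open>W\<close> costs one standard parameter, subsets of members of
  \<open>W\<close> are in \<open>W\<close>, and so are finite subsets of \<open>W\<close>. From
  Idealization only the formula for finiteness has to be reflected. In the failing case let
  \<open>x\<close> be a set that is finite in the model and contains all standard sets, and let
  \<open>F\<close> be \<open>g\<close> on \<open>x\<close> and empty elsewhere. Finitely many values
  are bounded in \<open>W\<close>, so \<open>F\<close> is a member of \<open>W\<close>; a standard
  \<open>G\<close> that agrees with \<open>F\<close> at standard arguments agrees there with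
  \<open>g\<close>, hence equals \<open>g\<close> by Transfer, although \<open>g\<close> is not in
  \<open>W\<close>. The usual chains of length omega and omega_1 would require ordinals. Levels are
  therefore described without ordinals, and the long chain is indexed by points of well-founded
  relations.\<close>

fun sat :: "'a set \<Rightarrow> ('a \<Rightarrow> 'a \<Rightarrow> bool) \<Rightarrow> ('a \<Rightarrow> bool) \<Rightarrow> (nat \<Rightarrow> 'a) \<Rightarrow> fm \<Rightarrow> bool" where
  "sat U E S e (Eq a b) \<longleftrightarrow> e a = e b"
| "sat U E S e (Mem a b) \<longleftrightarrow> E (e a) (e b)"
| "sat U E S e (St a) \<longleftrightarrow> S (e a)"
| "sat U E S e Bot \<longleftrightarrow> False"
| "sat U E S e (Imp p q) \<longleftrightarrow> (sat U E S e p \<longrightarrow> sat U E S e q)"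
| "sat U E S e (All x p) \<longleftrightarrow> (\<forall>a\<in>U. sat U E S (e(x := a)) p)"

lemma sat_connectives [simp]:
  "sat U E S e (Neg p) \<longleftrightarrow> \<not> sat U E S e p"
  "sat U E S e Top"
  "sat U E S e (Or p q) \<longleftrightarrow> sat U E S e p \<or> sat U E S e q"
  "sat U E S e (And p q) \<longleftrightarrow> sat U E S e p \<and> sat U E S e q"
  "sat U E S e (Iff p q) \<longleftrightarrow> (sat U E S e p \<longleftrightarrow> sat U E S e q)"
  "sat U E S e (Ex x p) \<longleftrightarrow> (\<exists>a\<in>U. sat U E S (e(x := a)) p)"
  by (auto simp: Neg_def Top_def Or_def And_def Iff_def Ex_def)

lemma sat_cong:
  "(\<And>k. k \<in> fv p \<Longrightarrow> e k = e' k) \<Longrightarrow> sat U E S e p \<longleftrightarrow> sat U E S e' p"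
proof (induction p arbitrary: e e')
  case (Imp p q)
  have "sat U E S e p = sat U E S e' p"
    by (rule Imp.IH(1)) (simp add: Imp.prems)
  moreover have "sat U E S e q = sat U E S e' q"
    by (rule Imp.IH(2)) (simp add: Imp.prems)
  ultimately show ?case by simp
next
  case (All x p)
  have "sat U E S (e(x := a)) p = sat U E S (e'(x := a)) p" for a
    by (rule All.IH) (simp add: All.prems)
  then show ?case by simp
qed simp_all

lemma fv_subset_vars: "fv p \<subseteq> vars p"
  by (induction p) auto

lemma finite_vars: "finite (vars p)"
  by (induction p) auto

lemma subst_idle: "x \<notin> fv p \<Longrightarrow> subst p x y = p"
  by (induction p) auto

lemma substable_fresh: "y \<notin> vars p \<Longrightarrow> substable y x p"
  by (induction p) auto

lemma substable_idle: "x \<notin> fv p \<Longrightarrow> substable y x p"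
  by (induction p) auto

lemma size_subst [simp]: "size (subst p x y) = size p"
  by (induction p) auto

lemma subst_back: "y \<notin> vars p \<Longrightarrow> subst (subst p x y) y x = p"
  by (induction p) (use fv_subset_vars in \<open>auto intro: subst_idle\<close>)

lemma substable_back: "y \<notin> vars p \<Longrightarrow> substable x y (subst p x y)"
proof (induction p)
  case (All z p)
  then show ?case
    using fv_subset_vars[of p] by auto
qed auto

lemma fv_subst: "x \<notin> fv (subst p x y) \<or> x = y"
  by (induction p) auto

lemma sat_subst:
  "substable y x p \<Longrightarrow> sat U E S e (subst p x y) \<longleftrightarrow> sat U E S (e(x := e y)) p"
proof (induction p arbitrary: e)
  case (All z p)
  show ?case
  \<comment> \<open>\<open>substable\<close> constrains \<open>p\<close> only when \<open>x\<close>
    is free in \<open>All z p\<close>; otherwise the substitution changes nothing.\<close>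
  proof (cases "z = x \<or> x \<notin> fv p")
    case True
    then have "x \<notin> fv (All z p)" by auto
    then show ?thesis
      by (metis subst_idle sat_cong fun_upd_other)
  next
    case False
    then have "z \<noteq> y" "substable y x p" "z \<noteq> x" using All.prems by auto
    moreover have "(e(z := a))(x := (e(z := a)) y) = (e(x := e y))(z := a)" for a
      using \<open>z \<noteq> x\<close> \<open>z \<noteq> y\<close> by auto
    ultimately show ?thesis
      by (simp add: All.IH del: fun_upd_apply)
  qed
qed auto

lemma internal_subst [simp]: "internal (subst p x y) = internal p"
  by (induction p) auto

lemma internal_connectives [simp]:
  "internal (Neg p) = internal p" "internal (Or p q) = (internal p \<and> internal q)"
  "internal (And p q) = (internal p \<and> internal q)" "internal (Iff p q) = (internal p \<and> internal q)"
  "internal (Ex x p) = internal p"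
  by (auto simp: Neg_def Or_def And_def Iff_def Ex_def)

lemma internal_ZFC: "p \<in> ZFC_ax \<Longrightarrow> internal p"
  by (auto simp: ZFC_ax_def ax_extensionality_def ax_foundation_def ax_pairing_def ax_union_def ax_power_def
      ax_infinity_def ax_choice_def separation_ax_def replacement_ax_def)

lemma internal_fin_fm: "internal (fin_fm A)"
  by (simp add: fin_fm_def Let_def)

text \<open>The hypothesis covers every assignment into \<open>U\<close> because generalization may
  be applied to axioms with free variables, which are thus read as universally closed.\<close>

lemma soundness:
  assumes "prov T p" and "\<And>q e. q \<in> T \<Longrightarrow> range e \<subseteq> U \<Longrightarrow> sat U E S e q" and "range e \<subseteq> U"
  shows "sat U E S e p"
  using assms(1,3)
proof (induction p arbitrary: e rule: prov.induct)
  case (ax_inst y x p)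
  then show ?case by (auto simp: sat_subst)
next
  case (ax_vac x p)
  have "sat U E S (e(x := a)) p = sat U E S e p" for a
    by (rule sat_cong) (use ax_vac in auto)
  then show ?case by simp
next
  case (gen p x)
  then show ?case by (auto intro!: gen.IH)
qed (use assms(2) in auto)

lemma prov_mono: "prov T p \<Longrightarrow> T \<subseteq> T' \<Longrightarrow> prov T' p"
  by (induction rule: prov.induct) (auto intro: prov.intros)

lemma prov_finite_support: "prov T p \<Longrightarrow> \<exists>F. finite F \<and> F \<subseteq> T \<and> prov F p"
proof (induction rule: prov.induct)
  case (nonlog p)
  then show ?case by (intro exI[of _ "{p}"]) (auto intro: prov.nonlog)
next
  case (mp p q)
  then obtain F G where "finite F" "F \<subseteq> T" "prov F (Imp p q)" "finite G" "G \<subseteq> T" "prov G p"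
    by auto
  then show ?case
    by (intro exI[of _ "F \<union> G"]) (auto intro: prov.mp prov_mono)
next
  case (gen p x)
  then show ?case by (auto intro: prov.gen)
qed (blast intro: prov.intros)+

section \<open>Completeness\<close>

instance fm :: countable
  by countable_datatype

text \<open>Local consequence: the hypotheses \<^term>\<open>G\<close> are not generalized over, so that their free
  variables act as constants in the Henkin construction.\<close>

inductive lprov :: "fm set \<Rightarrow> fm set \<Rightarrow> fm \<Rightarrow> bool" for T G :: "fm set" where
  lprov_prov: "prov T p \<Longrightarrow> lprov T G p"
| lprov_hyp: "p \<in> G \<Longrightarrow> lprov T G p"
| lprov_mp: "lprov T G (Imp p q) \<Longrightarrow> lprov T G p \<Longrightarrow> lprov T G q"

lemma prov_Imp_refl: "prov T (Imp p p)"
  by (rule prov.mp[OF prov.mp[OF prov.ax2 prov.ax1] prov.ax1[of T p p]])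

lemma prov_Imp_trans: "prov T (Imp p q) \<Longrightarrow> prov T (Imp q r) \<Longrightarrow> prov T (Imp p r)"
  by (rule prov.mp[OF prov.mp[OF prov.ax2 prov.mp[OF prov.ax1]]])

lemma lprov_mono: "lprov T G p \<Longrightarrow> G \<subseteq> G' \<Longrightarrow> lprov T G' p"
  by (induction rule: lprov.induct) (auto intro: lprov.intros)

text \<open>No side condition on free variables arises: modus ponens is the only rule that acts on
  hypotheses, generalization being confined to derivations from \<open>T\<close>.\<close>

lemma lprov_deduction: "lprov T (insert a G) p \<Longrightarrow> lprov T G (Imp a p)"
proof (induction rule: lprov.induct)
  case (lprov_prov p)
  then show ?case by (intro lprov.lprov_prov prov.mp[OF prov.ax1])
next
  case (lprov_hyp p)
  show ?case
  proof (cases "p = a")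
    case True
    then show ?thesis by (simp add: lprov.lprov_prov prov_Imp_refl)
  next
    case False
    then show ?thesis
      using lprov_hyp by (intro lprov.lprov_mp[OF lprov.lprov_prov[OF prov.ax1]] lprov.lprov_hyp) auto
  qed
next
  case (lprov_mp p q)
  show ?case
    by (rule lprov.lprov_mp[OF lprov.lprov_mp[OF lprov.lprov_prov[OF prov.ax2] lprov_mp.IH(1)] lprov_mp.IH(2)])
qed

text \<open>Generalization is recovered for variables not free in the hypotheses:
  \<open>ax_vac\<close> treats the hypotheses and \<open>ax_distr\<close> commutes with modus
  ponens.\<close>

lemma lprov_gen: "lprov T G p \<Longrightarrow> (\<And>q. q \<in> G \<Longrightarrow> y \<notin> fv q) \<Longrightarrow> lprov T G (All y p)"
proof (induction rule: lprov.induct)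
  case (lprov_prov p)
  then show ?case by (intro lprov.lprov_prov prov.gen)
next
  case (lprov_hyp p)
  then show ?case
    by (intro lprov.lprov_mp[OF lprov.lprov_prov[OF prov.ax_vac] lprov.lprov_hyp])
next
  case (lprov_mp p q)
  show ?case
    by (rule lprov.lprov_mp[OF lprov.lprov_mp[OF lprov.lprov_prov[OF prov.ax_distr] lprov_mp.IH(1)] lprov_mp.IH(2)])
      (use lprov_mp.prems in auto)
qed

lemma lprov_finite_support: "lprov T G p \<Longrightarrow> \<exists>F. finite F \<and> F \<subseteq> G \<and> lprov T F p"
proof (induction rule: lprov.induct)
  case (lprov_prov p)
  then show ?case by (intro exI[of _ "{}"]) (auto intro: lprov.lprov_prov)
next
  case (lprov_hyp p)
  then show ?case by (intro exI[of _ "{p}"]) (auto intro: lprov.intros)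
next
  case (lprov_mp p q)
  then obtain F F' where "finite F" "F \<subseteq> G" "lprov T F (Imp p q)" "finite F'" "F' \<subseteq> G" "lprov T F' p"
    by auto
  then show ?case
    by (intro exI[of _ "F \<union> F'"]) (auto intro: lprov.lprov_mp lprov_mono)
qed

definition lcon :: "fm set \<Rightarrow> fm set \<Rightarrow> bool" where
  "lcon T G \<longleftrightarrow> \<not> lprov T G Bot"

lemma lcon_insert_Neg: "lcon T G \<Longrightarrow> \<not> lcon T (insert p G) \<Longrightarrow> lcon T (insert (Neg p) G)"
  unfolding lcon_def Neg_def using lprov_deduction[of T _ G Bot] lprov_mp by blast

text \<open>Substituting \<open>x\<close> back for the fresh \<open>y\<close> restores
  \<open>p\<close>. The result may be generalized over \<open>x\<close>, which is not free in the
  renamed formula unless \<open>x = y\<close>.\<close>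

lemma prov_rename_All:
  assumes "y \<notin> vars p"
  shows "prov T (Imp (All y (subst p x y)) (All x p))"
proof (cases "x = y")
  case True
  then have "subst p x y = p" by (metis assms fv_subset_vars subst_idle subsetD)
  then show ?thesis using True prov_Imp_refl by simp
next
  case False
  have "prov T (Imp (All y (subst p x y)) p)"
    using prov.ax_inst[OF substable_back[OF assms], of T] by (simp add: subst_back[OF assms])
  then have "prov T (Imp (All x (All y (subst p x y))) (All x p))"
    by (rule prov.mp[OF prov.ax_distr prov.gen])
  moreover have "prov T (Imp (All y (subst p x y)) (All x (All y (subst p x y))))"
    using fv_subst[of x p y] False by (intro prov.ax_vac) auto
  ultimately show ?thesis
    using prov_Imp_trans by blast
qed

text \<open>If the negated instance were contradictory, the instance would follow from
  \<open>G\<close>; \<open>y\<close> being fresh, it could be generalized and renamed to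
  \<open>All x p\<close>, whose negation is in \<open>G\<close>.\<close>

lemma lcon_witness:
  assumes "lcon T G" "Neg (All x p) \<in> G" "y \<notin> vars p" "\<And>q. q \<in> G \<Longrightarrow> y \<notin> vars q"
  shows "lcon T (insert (Neg (subst p x y)) G)"
proof (rule ccontr)
  assume "\<not> ?thesis"
  then have "lprov T G (Neg (Neg (subst p x y)))"
    unfolding lcon_def by (metis Neg_def lprov_deduction)
  then have "lprov T G (subst p x y)"
    by (rule lprov_mp[OF lprov_prov[OF prov.ax3]])
  then have "lprov T G (All y (subst p x y))"
    by (rule lprov_gen) (use assms(4) fv_subset_vars in blast)
  then have "lprov T G (All x p)"
    by (rule lprov_mp[OF lprov_prov[OF prov_rename_All[OF assms(3)]]])
  then have "lprov T G Bot"
    using lprov_mp[OF lprov_hyp[OF assms(2)[unfolded Neg_def]]] by blast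
  then show False using assms(1) by (simp add: lcon_def)
qed

definition fresh_var :: "fm set \<Rightarrow> nat" where
  "fresh_var G = (SOME y. y \<notin> (\<Union>q\<in>G. vars q))"

lemma fresh_var: "finite G \<Longrightarrow> q \<in> G \<Longrightarrow> fresh_var G \<notin> vars q"
  unfolding fresh_var_def
  by (rule someI2_ex, rule ex_new_if_finite) (auto intro: finite_vars)

text \<open>Ordinary variables play the role of Henkin constants. Every stage is finite, so a fresh
  one always exists. Only universal formulas require a witness, since \<open>Ex\<close> abbreviates
  a negated \<open>All\<close>.\<close>

definition henkin_step :: "fm set \<Rightarrow> fm set \<Rightarrow> fm \<Rightarrow> fm set" where
  "henkin_step T G p = (if lcon T (insert p G) then insert p G
     else case p of All x q \<Rightarrow> insert (Neg (subst q x (fresh_var (insert p G)))) (insert (Neg p) G)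
                  | _ \<Rightarrow> insert (Neg p) G)"

fun henkin_chain :: "fm set \<Rightarrow> nat \<Rightarrow> fm set" where
  "henkin_chain T 0 = {}"
| "henkin_chain T (Suc n) = henkin_step T (henkin_chain T n) (from_nat n)"

definition henkin_set :: "fm set \<Rightarrow> fm set" where
  "henkin_set T = (\<Union>n. henkin_chain T n)"

lemma henkin_step_extends: "G \<subseteq> henkin_step T G p"
  by (auto simp: henkin_step_def split: fm.split)

lemma finite_henkin_chain: "finite (henkin_chain T n)"
  by (induction n) (auto simp: henkin_step_def split: fm.split)

lemma lcon_henkin_step:
  assumes "lcon T G" "finite G"
  shows "lcon T (henkin_step T G p)"
proof (cases "lcon T (insert p G)")
  case False
  have N: "lcon T (insert (Neg p) G)" using lcon_insert_Neg[OF assms(1) False] .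
  show ?thesis
  proof (cases "\<exists>x q. p = All x q")
    case True
    then obtain x q where p: "p = All x q" by blast
    let ?y = "fresh_var (insert p G)"
    have "?y \<notin> vars p" "\<And>r. r \<in> G \<Longrightarrow> ?y \<notin> vars r"
      using fresh_var[of "insert p G"] assms(2) by auto
    then have "lcon T (insert (Neg (subst q x ?y)) (insert (Neg p) G))"
      by (intro lcon_witness[OF N]) (auto simp: p Neg_def)
    then show ?thesis using False by (simp add: henkin_step_def p)
  next
    case no_All: False
    then have "henkin_step T G p = insert (Neg p) G"
      using False by (auto simp: henkin_step_def split: fm.split)
    then show ?thesis using N by simp
  qed
qed (simp add: henkin_step_def)

context
  fixes T :: "fm set"
  assumes T_con: "consistent T"
begin

lemma lcon_henkin_chain: "lcon T (henkin_chain T n)"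
proof (induction n)
  case 0
  have "lprov T {} p \<Longrightarrow> prov T p" for p
    by (induction rule: lprov.induct) (auto intro: prov.mp)
  then show ?case using T_con by (auto simp: lcon_def consistent_def)
qed (simp add: lcon_henkin_step finite_henkin_chain)

lemma henkin_chain_mono: "m \<le> n \<Longrightarrow> henkin_chain T m \<subseteq> henkin_chain T n"
  by (rule lift_Suc_mono_le[of "henkin_chain T"]) (simp_all add: henkin_step_extends)

lemma lcon_henkin_set: "lcon T (henkin_set T)"
  unfolding lcon_def
proof
  assume bot: "lprov T (henkin_set T) Bot"
  obtain F where F: "finite F" "F \<subseteq> henkin_set T" "lprov T F Bot"
    using lprov_finite_support[OF bot] by blast
  have "\<exists>n. F \<subseteq> henkin_chain T n"
    using F(1,2)
  proof (induction F rule: finite_induct)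
    case (insert p F)
    then obtain m n where "F \<subseteq> henkin_chain T m" "p \<in> henkin_chain T n"
      by (auto simp: henkin_set_def)
    then show ?case
      using henkin_chain_mono[of m "max m n"] henkin_chain_mono[of n "max m n"]
      by (intro exI[of _ "max m n"]) auto
  qed simp
  then obtain n where "F \<subseteq> henkin_chain T n" ..
  with F(3) have "lprov T (henkin_chain T n) Bot" by (rule lprov_mono)
  then show False using lcon_henkin_chain unfolding lcon_def by simp
qed

lemma henkin_set_complete: "p \<in> henkin_set T \<or> Neg p \<in> henkin_set T"
proof -
  have "p \<in> henkin_chain T (Suc (to_nat p)) \<or> Neg p \<in> henkin_chain T (Suc (to_nat p))"
    by (auto simp: henkin_step_def split: fm.split)
  then show ?thesis unfolding henkin_set_def by blast
qed

lemma henkin_set_closed: "lprov T (henkin_set T) p \<Longrightarrow> p \<in> henkin_set T"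
  using henkin_set_complete[of p] lcon_henkin_set lprov_mp[OF lprov_hyp[of "Neg p", unfolded Neg_def]]
  unfolding lcon_def Neg_def by blast

lemma henkin_set_prov: "prov T p \<Longrightarrow> p \<in> henkin_set T"
  by (simp add: henkin_set_closed lprov_prov)

lemma henkin_set_mp: "Imp p q \<in> henkin_set T \<Longrightarrow> p \<in> henkin_set T \<Longrightarrow> q \<in> henkin_set T"
  by (rule henkin_set_closed[OF lprov_mp[OF lprov_hyp lprov_hyp]])

lemma henkin_set_Bot: "Bot \<notin> henkin_set T"
  using lcon_henkin_set lcon_def lprov_hyp by blast

lemma henkin_set_Neg: "Neg p \<in> henkin_set T \<longleftrightarrow> p \<notin> henkin_set T"
  using henkin_set_Bot henkin_set_complete[of p] henkin_set_mp[of p Bot] unfolding Neg_def by blast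

lemma henkin_set_Imp: "Imp p q \<in> henkin_set T \<longleftrightarrow> (p \<in> henkin_set T \<longrightarrow> q \<in> henkin_set T)"
proof
  assume *: "p \<in> henkin_set T \<longrightarrow> q \<in> henkin_set T"
  show "Imp p q \<in> henkin_set T"
  proof (cases "q \<in> henkin_set T")
    case True
    then show ?thesis by (rule henkin_set_mp[OF henkin_set_prov[OF prov.ax1]])
  next
    case False
    then have "Neg p \<in> henkin_set T" using * henkin_set_Neg by blast
    then have "lprov T (insert p (henkin_set T)) Bot"
      unfolding Neg_def by (intro lprov_mp[OF lprov_hyp lprov_hyp, of p]) auto
    then have "lprov T (insert p (henkin_set T)) (Neg (Neg q))"
      unfolding Neg_def[of "Neg q"] by (rule lprov_mp[OF lprov_prov[OF prov.ax1]])
    then have "lprov T (insert p (henkin_set T)) q"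
      by (rule lprov_mp[OF lprov_prov[OF prov.ax3]])
    then show ?thesis using henkin_set_closed lprov_deduction by blast
  qed
qed (blast intro: henkin_set_mp)

lemma henkin_set_witness:
  assumes "All x q \<notin> henkin_set T"
  obtains y where "y \<notin> vars q" "subst q x y \<notin> henkin_set T"
proof -
  let ?p = "All x q"
  let ?G = "henkin_chain T (to_nat ?p)"
  have "?p \<notin> henkin_chain T (Suc (to_nat ?p))"
    using assms unfolding henkin_set_def by blast
  then have "Neg (subst q x (fresh_var (insert ?p ?G))) \<in> henkin_chain T (Suc (to_nat ?p))"
    by (auto simp: henkin_step_def split: if_splits)
  then have "Neg (subst q x (fresh_var (insert ?p ?G))) \<in> henkin_set T"
    unfolding henkin_set_def by blast
  moreover have "fresh_var (insert ?p ?G) \<notin> vars q"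
    using fresh_var[of "insert ?p ?G" ?p] finite_henkin_chain by auto
  ultimately show ?thesis using that henkin_set_Neg by blast
qed

text \<open>The dummy premise \<^term>\<open>Imp p p\<close> makes the Henkin witness for \<open>\<exists>x. x = k\<close> avoid the
  variables of \<^term>\<open>p\<close>; this replaces renaming of bound variables in the truth lemma.\<close>

lemma henkin_set_fresh_equal:
  obtains y where "y \<notin> vars p" "Eq k y \<in> henkin_set T"
proof -
  obtain x where x: "x \<notin> insert k (vars p)"
    using ex_new_if_finite[OF infinite_UNIV_nat, of "insert k (vars p)"] finite_vars by auto
  then have xfv: "x \<notin> fv p" using fv_subset_vars by blast
  let ?q = "Imp (Imp p p) (Neg (Eq k x))"
  have sub: "subst ?q x y = Imp (Imp p p) (Neg (Eq k y))" for y
    using x xfv by (auto simp: Neg_def subst_idle)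
  have "All x ?q \<notin> henkin_set T"
  proof
    assume *: "All x ?q \<in> henkin_set T"
    have "substable k x ?q"
      using xfv by (simp add: Neg_def substable_idle)
    then have "Imp (Imp p p) (Neg (Eq k k)) \<in> henkin_set T"
      using henkin_set_mp[OF henkin_set_prov[OF prov.ax_inst] *] sub by simp
    then show False
      using henkin_set_prov[OF prov.eq_refl[of T k]] by (simp add: henkin_set_Imp henkin_set_Neg)
  qed
  then obtain y where "y \<notin> vars ?q" "subst ?q x y \<notin> henkin_set T"
    by (rule henkin_set_witness)
  then have "y \<notin> vars p" "Imp (Imp p p) (Neg (Eq k y)) \<notin> henkin_set T"
    unfolding sub by simp_all
  then show ?thesis
    using that by (simp add: henkin_set_Imp henkin_set_Neg)
qed

text \<open>Least representatives replace the quotient by provable equality. The carrier is thus a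
  set of natural numbers on which \<open>Eq\<close> is true equality.\<close>

definition henkin_rep :: "nat \<Rightarrow> nat" where
  "henkin_rep k = (LEAST l. Eq k l \<in> henkin_set T)"

lemma henkin_Eq_refl: "Eq k k \<in> henkin_set T"
  by (rule henkin_set_prov[OF prov.eq_refl])

lemma henkin_Eq_euclid: "Eq k l \<in> henkin_set T \<Longrightarrow> Eq k m \<in> henkin_set T \<Longrightarrow> Eq l m \<in> henkin_set T"
  using henkin_set_prov[OF prov.eq_eq1[of T k l m]] by (simp add: henkin_set_Imp)

lemma henkin_Eq_sym: "Eq k l \<in> henkin_set T \<Longrightarrow> Eq l k \<in> henkin_set T"
  using henkin_Eq_euclid henkin_Eq_refl by blast

lemma henkin_rep_Eq: "Eq k (henkin_rep k) \<in> henkin_set T"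
  unfolding henkin_rep_def by (rule LeastI, rule henkin_Eq_refl)

lemma henkin_rep_eq_iff: "henkin_rep k = henkin_rep l \<longleftrightarrow> Eq k l \<in> henkin_set T"
proof
  assume "henkin_rep k = henkin_rep l"
  then show "Eq k l \<in> henkin_set T"
    using henkin_rep_Eq[of k] henkin_rep_Eq[of l] henkin_Eq_sym henkin_Eq_euclid by metis
next
  assume *: "Eq k l \<in> henkin_set T"
  then have "Eq k m \<in> henkin_set T \<longleftrightarrow> Eq l m \<in> henkin_set T" for m
    using henkin_Eq_sym henkin_Eq_euclid by blast
  then show "henkin_rep k = henkin_rep l" by (simp add: henkin_rep_def)
qed

lemma henkin_Mem_rep: "Mem (henkin_rep k) (henkin_rep l) \<in> henkin_set T \<longleftrightarrow> Mem k l \<in> henkin_set T"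
proof -
  have 1: "Mem j m \<in> henkin_set T \<Longrightarrow> Mem j' m \<in> henkin_set T" if "Eq j j' \<in> henkin_set T" for j j' m
    using henkin_set_prov[OF prov.eq_mem1[of T j j' m]] that by (simp add: henkin_set_Imp)
  have 2: "Mem m j \<in> henkin_set T \<Longrightarrow> Mem m j' \<in> henkin_set T" if "Eq j j' \<in> henkin_set T" for j j' m
    using henkin_set_prov[OF prov.eq_mem2[of T j j' m]] that by (simp add: henkin_set_Imp)
  show ?thesis
    using 1 2 henkin_rep_Eq henkin_Eq_sym by blast
qed

lemma henkin_St_rep: "St (henkin_rep k) \<in> henkin_set T \<longleftrightarrow> St k \<in> henkin_set T"
proof -
  have "St j \<in> henkin_set T \<Longrightarrow> St j' \<in> henkin_set T" if "Eq j j' \<in> henkin_set T" for j j'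
    using henkin_set_prov[OF prov.eq_st[of T j j']] that by (simp add: henkin_set_Imp)
  then show ?thesis using henkin_rep_Eq henkin_Eq_sym by blast
qed

definition henkin_sat :: "(nat \<Rightarrow> nat) \<Rightarrow> fm \<Rightarrow> bool" where
  "henkin_sat = sat (range henkin_rep) (\<lambda>k l. Mem k l \<in> henkin_set T) (\<lambda>k. St k \<in> henkin_set T)"

text \<open>The induction is on size because the quantifier case appeals to substitution instances
  of the body, which are not subformulas but have the same size.\<close>

lemma henkin_truth: "henkin_sat henkin_rep p \<longleftrightarrow> p \<in> henkin_set T"
proof (induction p rule: measure_induct_rule[of size])
  case (less p)
  show ?case
  proof (cases p)
    case (All x q)
    have inst: "henkin_sat (henkin_rep(x := henkin_rep y)) q \<longleftrightarrow> subst q x y \<in> henkin_set T"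
      if "y \<notin> vars q" for y
    proof -
      have "henkin_sat henkin_rep (subst q x y) = henkin_sat (henkin_rep(x := henkin_rep y)) q"
        unfolding henkin_sat_def by (rule sat_subst[OF substable_fresh[OF that]])
      then show ?thesis using less[of "subst q x y"] All by simp
    qed
    show ?thesis
    proof
      assume *: "henkin_sat henkin_rep p"
      show "p \<in> henkin_set T"
      proof (rule ccontr)
        assume "p \<notin> henkin_set T"
        then obtain y where "y \<notin> vars q" "subst q x y \<notin> henkin_set T"
          using henkin_set_witness All by blast
        then show False using * inst All by (simp add: henkin_sat_def)
      qed
    next
      assume *: "p \<in> henkin_set T"
      have "henkin_sat (henkin_rep(x := henkin_rep k)) q" for k
      proof -
        obtain y where y: "y \<notin> vars q" "Eq k y \<in> henkin_set T"
          by (rule henkin_set_fresh_equal)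
        have "subst q x y \<in> henkin_set T"
          using henkin_set_mp[OF henkin_set_prov[OF prov.ax_inst[OF substable_fresh[OF y(1)]]]] * All
          by blast
        then show ?thesis using inst[OF y(1)] y(2) henkin_rep_eq_iff by metis
      qed
      then show "henkin_sat henkin_rep p" using All by (simp add: henkin_sat_def)
    qed
  next
    case (Imp q r)
    then have "henkin_sat henkin_rep q = (q \<in> henkin_set T)" "henkin_sat henkin_rep r = (r \<in> henkin_set T)"
      using less by simp_all
    then show ?thesis using Imp by (simp add: henkin_set_Imp henkin_sat_def)
  qed (simp_all add: henkin_sat_def henkin_rep_eq_iff henkin_Mem_rep henkin_St_rep henkin_set_Bot)
qed

text \<open>The truth lemma concerns the single assignment \<open>henkin_rep\<close>. A theorem
  contains finitely many variables, and changing the value of one of them is covered by generalizing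
  over it.\<close>

lemma henkin_model:
  assumes "prov T p" and "range e \<subseteq> range henkin_rep"
  shows "henkin_sat e p"
proof -
  have gen: "henkin_sat (\<lambda>k. if k \<in> B then e k else henkin_rep k) q"
    if "finite B" "prov T q" for B q
    using that
  proof (induction B arbitrary: q rule: finite_induct)
    case empty
    then show ?case using henkin_truth henkin_set_prov by simp
  next
    case (insert x B)
    let ?e = "\<lambda>k. if k \<in> B then e k else henkin_rep k"
    have "henkin_sat ?e (All x q)" using insert prov.gen by blast
    moreover obtain a where "e x = henkin_rep a" using assms(2) by blast
    ultimately have "henkin_sat (?e(x := e x)) q" by (simp add: henkin_sat_def)
    moreover have "?e(x := e x) = (\<lambda>k. if k \<in> insert x B then e k else henkin_rep k)"
      by auto
    ultimately show ?case by simp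
  qed
  have "henkin_sat e p = henkin_sat (\<lambda>k. if k \<in> vars p then e k else henkin_rep k) p"
    unfolding henkin_sat_def by (rule sat_cong) (use fv_subset_vars[of p] in auto)
  then show ?thesis using gen[OF finite_vars assms(1)] by simp
qed

end

theorem completeness:
  assumes "consistent T"
  obtains U :: "nat set" and E S where "U \<noteq> {}"
    "\<And>p e. p \<in> T \<Longrightarrow> range e \<subseteq> U \<Longrightarrow> sat U E S e p"
  using that[of "range (henkin_rep T)"] henkin_model[OF assms prov.nonlog]
  unfolding henkin_sat_def[OF assms] by blast

section \<open>Definable predicates and functions\<close>

text \<open>De Bruijn indices keep the closure rules for definability free of variable capture.
  Names return only where an axiom scheme is instantiated.\<close>

datatype db = DEq nat nat | DMem nat nat | DSt nat | DBot | DImp db db | DAll db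

definition scons :: "'a \<Rightarrow> (nat \<Rightarrow> 'a) \<Rightarrow> nat \<Rightarrow> 'a" (infixr "##" 65) where
  "(a ## e) k = (case k of 0 \<Rightarrow> a | Suc j \<Rightarrow> e j)"

lemma scons_simps [simp]: "(a ## e) 0 = a" "(a ## e) (Suc k) = e k" "(\<lambda>k. (a ## e) (Suc k)) = e"
  by (simp_all add: scons_def)

fun dint :: "db \<Rightarrow> bool" where
  "dint (DSt a) = False"
| "dint (DImp p q) = (dint p \<and> dint q)"
| "dint (DAll p) = dint p"
| "dint _ = True"

fun dsat :: "('a \<Rightarrow> 'a \<Rightarrow> bool) \<Rightarrow> ('a \<Rightarrow> bool) \<Rightarrow> (nat \<Rightarrow> 'a) \<Rightarrow> db \<Rightarrow> bool" where
  "dsat E S e (DEq a b) \<longleftrightarrow> e a = e b"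
| "dsat E S e (DMem a b) \<longleftrightarrow> E (e a) (e b)"
| "dsat E S e (DSt a) \<longleftrightarrow> S (e a)"
| "dsat E S e DBot \<longleftrightarrow> False"
| "dsat E S e (DImp p q) \<longleftrightarrow> (dsat E S e p \<longrightarrow> dsat E S e q)"
| "dsat E S e (DAll p) \<longleftrightarrow> (\<forall>a. dsat E S (a ## e) p)"

fun dren :: "(nat \<Rightarrow> nat) \<Rightarrow> db \<Rightarrow> db" where
  "dren f (DEq a b) = DEq (f a) (f b)"
| "dren f (DMem a b) = DMem (f a) (f b)"
| "dren f (DSt a) = DSt (f a)"
| "dren f DBot = DBot"
| "dren f (DImp p q) = DImp (dren f p) (dren f q)"
| "dren f (DAll p) = DAll (dren (0 ## (\<lambda>k. Suc (f k))) p)"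

lemma dint_dren [simp]: "dint (dren f p) = dint p"
  by (induction p arbitrary: f) auto

lemma dsat_dren: "dsat E S e (dren f p) \<longleftrightarrow> dsat E S (\<lambda>k. e (f k)) p"
proof (induction p arbitrary: e f)
  case (DAll p)
  have "(\<lambda>k. (a ## e) ((0 ## (\<lambda>k. Suc (f k))) k)) = a ## (\<lambda>k. e (f k))" for a
    by (auto simp: scons_def split: nat.split)
  then show ?case by (simp add: DAll.IH)
qed simp_all

text \<open>Named variables for de Bruijn formulas: even numbers name bound variables, odd numbers free ones.\<close>

fun named :: "(nat \<Rightarrow> nat) \<Rightarrow> nat \<Rightarrow> db \<Rightarrow> fm" where
  "named v m (DEq a b) = Eq (v a) (v b)"
| "named v m (DMem a b) = Mem (v a) (v b)"
| "named v m (DSt a) = St (v a)"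
| "named v m DBot = Bot"
| "named v m (DImp p q) = Imp (named v m p) (named v m q)"
| "named v m (DAll p) = All (2 * m) (named ((2 * m) ## v) (Suc m) p)"

lemma internal_named [simp]: "internal (named v m p) = dint p"
  by (induction p arbitrary: v m) auto

lemma fv_named: "fv (named v m p) \<subseteq> range v"
proof (induction p arbitrary: v m)
  case (DAll p)
  have "range ((2 * m) ## v) \<subseteq> insert (2 * m) (range v)"
    by (auto simp: scons_def split: nat.split)
  then show ?case
    using DAll[of "(2 * m) ## v" "Suc m"] unfolding named.simps fv.simps by blast
qed auto

lemma sat_named:
  assumes "\<And>k. odd (v k) \<or> v k < 2 * m"
  shows "sat UNIV E S e (named v m p) \<longleftrightarrow> dsat E S (\<lambda>k. e (v k)) p"
  using assms
proof (induction p arbitrary: v m e)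
  case (DAll p)
  have "v k \<noteq> 2 * m" for k
    using DAll.prems[of k] by auto
  then have "(\<lambda>k. (e(2 * m := a)) (((2 * m) ## v) k)) = a ## (\<lambda>k. e (v k))" for a
    by (auto simp: scons_def fun_eq_iff split: nat.split)
  moreover have "odd (((2 * m) ## v) k) \<or> ((2 * m) ## v) k < 2 * Suc m" for k
    using DAll.prems[of "k - 1"] by (cases k) auto
  ultimately show ?case by (simp add: DAll.IH del: fun_upd_apply)
qed simp_all

locale membership_structure =
  fixes E :: "'a \<Rightarrow> 'a \<Rightarrow> bool" (infix "\<epsilon>" 50) and st :: "'a \<Rightarrow> bool"
begin

text \<open>A slot of a formula holds a variable or a parameter. Parameters are kept as model
  elements so that Transfer can require them to be standard by a choice of \<open>A\<close>; the
  other schemes take \<open>UNIV\<close>.\<close>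

definition atomic :: "'a set \<Rightarrow> ((nat \<Rightarrow> 'a) \<Rightarrow> 'a) \<Rightarrow> bool" where
  "atomic A s \<longleftrightarrow> (\<exists>i. s = (\<lambda>e. e i)) \<or> (\<exists>c\<in>A. s = (\<lambda>_. c))"

text \<open>\<open>dfb x A P\<close>: the predicate \<open>P\<close> on environments is definable from parameters in \<open>A\<close>, by an
  internal formula unless \<open>x\<close> holds; \<open>dft x A t\<close>: the graph of the function \<open>t\<close> on environments is.\<close>

definition dfb :: "bool \<Rightarrow> 'a set \<Rightarrow> ((nat \<Rightarrow> 'a) \<Rightarrow> bool) \<Rightarrow> bool" where
  "dfb x A P \<longleftrightarrow> (\<exists>p s. (x \<or> dint p) \<and> (\<forall>k. atomic A (s k)) \<and> (\<forall>e. P e \<longleftrightarrow> dsat E st (\<lambda>k. s k e) p))"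

definition dft :: "bool \<Rightarrow> 'a set \<Rightarrow> ((nat \<Rightarrow> 'a) \<Rightarrow> 'a) \<Rightarrow> bool" where
  "dft x A t \<longleftrightarrow> dfb x A (\<lambda>e. e 0 = t (\<lambda>k. e (Suc k)))"

lemma dfbI:
  "x \<or> dint p \<Longrightarrow> (\<And>k. atomic A (s k)) \<Longrightarrow> (\<And>e. P e \<longleftrightarrow> dsat E st (\<lambda>k. s k e) p) \<Longrightarrow> dfb x A P"
  unfolding dfb_def by blast

named_theorems dfb_rules

lemma dfb_Bot: "dfb x A (\<lambda>e. False)"
  unfolding dfb_def by (intro exI[of _ DBot] exI[of _ "\<lambda>k e. e k"]) (auto simp: atomic_def)

lemma dfb_imp [dfb_rules]:
  assumes "dfb x A P" "dfb x A Q"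
  shows "dfb x A (\<lambda>e. P e \<longrightarrow> Q e)"
proof -
  obtain p s q t where *: "x \<or> dint p" "\<forall>k. atomic A (s k)" "\<forall>e. P e = dsat E st (\<lambda>k. s k e) p"
    "x \<or> dint q" "\<forall>k. atomic A (t k)" "\<forall>e. Q e = dsat E st (\<lambda>k. t k e) q"
    using assms unfolding dfb_def by blast
  \<comment> \<open>The two formulas come with unrelated slot assignments: even slots serve
    \<open>p\<close>, odd slots serve \<open>q\<close>.\<close>
  let ?u = "\<lambda>k. if even k then s (k div 2) else t (k div 2)"
  show ?thesis
    by (rule dfbI[of _ "DImp (dren (\<lambda>k. 2 * k) p) (dren (\<lambda>k. 2 * k + 1) q)" _ ?u])
      (use * in \<open>auto simp: dsat_dren\<close>)
qed

lemma dfb_all [dfb_rules]: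
  assumes "dfb x A (\<lambda>e. P (e 0) (\<lambda>k. e (Suc k)))"
  shows "dfb x A (\<lambda>e. \<forall>a. P a e)"
proof -
  obtain p s where p: "x \<or> dint p" and s: "\<And>k. atomic A (s k)"
    and P: "\<And>e. P (e 0) (\<lambda>k. e (Suc k)) = dsat E st (\<lambda>k. s k e) p"
    using assms unfolding dfb_def by blast
  let ?z = "\<lambda>k. s k = (\<lambda>e. e 0)"
  \<comment> \<open>Slots that read the newly bound variable become index 0, all others are shifted
    by one. A shifted slot does not look at position 0, so it may be evaluated with
    \<open>undefined\<close> there.\<close>
  define t where "t = (\<lambda>k. if ?z k then (\<lambda>e. e 0) else (\<lambda>e. s k (undefined ## e)))"
  have at: "atomic A (t k)" for k
  proof -
    consider i where "s k = (\<lambda>e. e i)" | c where "c \<in> A" "s k = (\<lambda>_. c)"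
      using s[of k] unfolding atomic_def by blast
    then show ?thesis
    proof cases
      case 1
      then show ?thesis by (cases i) (auto simp: t_def atomic_def)
    next
      case 2
      then show ?thesis by (auto simp: t_def atomic_def)
    qed
  qed
  have eq: "(a ## (\<lambda>k. t k e)) (if ?z k then 0 else Suc k) = s k (a ## e)" for a e k
  proof -
    consider i where "s k = (\<lambda>e. e i)" | c where "c \<in> A" "s k = (\<lambda>_. c)"
      using s[of k] unfolding atomic_def by blast
    then show ?thesis
    proof cases
      case 1
      show ?thesis
      proof (cases "?z k")
        case False
        then obtain j where "i = Suc j" using 1 by (cases i) auto
        then show ?thesis using 1 False by (simp add: t_def)
      qed simp
    next
      case 2
      then show ?thesis by (auto simp: t_def dest: fun_cong[of _ _ "\<lambda>_. a"])
    qed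
  qed
  have "(\<forall>a. P a e) = dsat E st (\<lambda>k. t k e) (DAll (dren (\<lambda>k. if ?z k then 0 else Suc k) p))" for e
    using P[of "_ ## e"] by (simp add: dsat_dren eq)
  then show ?thesis
    using p at by (intro dfbI[of _ "DAll (dren (\<lambda>k. if ?z k then 0 else Suc k) p)" _ t]) auto
qed

lemma dfb_subst:
  assumes "dfb x A P" "\<And>k. atomic A (t k)"
  shows "dfb x A (\<lambda>e. P (\<lambda>k. t k e))"
proof -
  obtain p s where p: "x \<or> dint p" and s: "\<And>k. atomic A (s k)"
    and P: "\<And>e. P e = dsat E st (\<lambda>k. s k e) p"
    using assms(1) unfolding dfb_def by blast
  have "atomic A (\<lambda>e. s k (\<lambda>j. t j e))" for k
  proof -
    consider i where "s k = (\<lambda>e. e i)" | c where "c \<in> A" "s k = (\<lambda>_. c)"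
      using s[of k] unfolding atomic_def by blast
    then show ?thesis
    proof cases
      case 1
      then show ?thesis using assms(2)[of i] by simp
    next
      case 2
      then show ?thesis by (auto simp: atomic_def)
    qed
  qed
  then show ?thesis
    using p P by (intro dfbI[of _ p _ "\<lambda>k e. s k (\<lambda>j. t j e)"]) auto
qed

lemma dfb_ren: "dfb x A P \<Longrightarrow> dfb x A (\<lambda>e. P (\<lambda>k. e (f k)))"
  by (rule dfb_subst) (auto simp: atomic_def)

lemma dfb_not [dfb_rules]: "dfb x A P \<Longrightarrow> dfb x A (\<lambda>e. \<not> P e)"
  using dfb_imp[OF _ dfb_Bot] by simp

lemma dfb_const [dfb_rules]: "dfb x A (\<lambda>e. b)"
  using dfb_Bot[of x A] dfb_not[OF dfb_Bot[of x A]] by (cases b) simp_all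

lemma dfb_or [dfb_rules]: "dfb x A P \<Longrightarrow> dfb x A Q \<Longrightarrow> dfb x A (\<lambda>e. P e \<or> Q e)"
  using dfb_imp[OF dfb_not, of x A P Q] by (simp add: disj_imp)

lemma dfb_and [dfb_rules]: "dfb x A P \<Longrightarrow> dfb x A Q \<Longrightarrow> dfb x A (\<lambda>e. P e \<and> Q e)"
  using dfb_not[OF dfb_imp[OF _ dfb_not, of x A P Q]] by simp

lemma dfb_iff [dfb_rules]: "dfb x A P \<Longrightarrow> dfb x A Q \<Longrightarrow> dfb x A (\<lambda>e. P e \<longleftrightarrow> Q e)"
  using dfb_and[OF dfb_imp dfb_imp, of x A P Q Q P] by (simp add: iff_conv_conj_imp)

lemma dfb_ex [dfb_rules]:
  assumes "dfb x A (\<lambda>e. P (e 0) (\<lambda>k. e (Suc k)))"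
  shows "dfb x A (\<lambda>e. \<exists>a. P a e)"
proof -
  have "dfb x A (\<lambda>e. \<not> (\<forall>a. \<not> P a e))"
    by (intro dfb_rules assms)
  then show ?thesis by simp
qed

lemma dft_proj [dfb_rules]: "dft x A (\<lambda>e. e i)"
  unfolding dft_def dfb_def
  by (intro exI[of _ "DEq 0 (Suc i)"] exI[of _ "\<lambda>k e. e k"]) (auto simp: atomic_def)

lemma dft_const [dfb_rules]: "c \<in> A \<Longrightarrow> dft x A (\<lambda>e. c)"
  unfolding dft_def dfb_def
  by (intro exI[of _ "DEq 0 1"] exI[of _ "(\<lambda>e. e 0) ## (\<lambda>k e. c)"])
    (auto simp: atomic_def scons_def split: nat.split)

text \<open>A definable term is eliminated by quantifying over its value; a definable graph suffices
  for that.\<close>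

lemma dfb_sub1:
  assumes "dfb x A (\<lambda>e. Q (e 0))" "dft x A t"
  shows "dfb x A (\<lambda>e. Q (t e))"
proof -
  have "dfb x A (\<lambda>e. \<exists>a. a = t e \<and> Q a)"
    by (intro dfb_rules assms assms(2)[unfolded dft_def])
  then show ?thesis by simp
qed

lemma dfb_sub2:
  assumes "dfb x A (\<lambda>e. Q (e 0) (e 1))" "dft x A t" "dft x A u"
  shows "dfb x A (\<lambda>e. Q (t e) (u e))"
proof -
  have "dfb x A (\<lambda>e. \<exists>a b. a = t e \<and> b = u e \<and> Q a b)"
    \<comment> \<open>Under both quantifiers \<open>b\<close> has index 0 and \<open>a\<close> index
      1, and the old environment starts at index 2.\<close>
    using dfb_ren[OF assms(2)[unfolded dft_def], of "1 ## (\<lambda>k. k + 2)"]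
      dfb_ren[OF assms(3)[unfolded dft_def], of "0 ## (\<lambda>k. k + 2)"]
      dfb_ren[OF assms(1), of "1 ## 0 ## id"]
    by (intro dfb_rules) (auto simp: scons_def numeral_2_eq_2)
  then show ?thesis by simp
qed

lemma dfb_sub3:
  assumes "dfb x A (\<lambda>e. Q (e 0) (e 1) (e 2))" "dft x A t" "dft x A u" "dft x A v"
  shows "dfb x A (\<lambda>e. Q (t e) (u e) (v e))"
proof -
  have "dfb x A (\<lambda>e. \<exists>a b c. a = t e \<and> b = u e \<and> c = v e \<and> Q a b c)"
    using dfb_ren[OF assms(2)[unfolded dft_def], of "2 ## (\<lambda>k. k + 3)"]
      dfb_ren[OF assms(3)[unfolded dft_def], of "1 ## (\<lambda>k. k + 3)"]
      dfb_ren[OF assms(4)[unfolded dft_def], of "0 ## (\<lambda>k. k + 3)"]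
      dfb_ren[OF assms(1), of "2 ## 1 ## 0 ## id"]
    by (intro dfb_rules) (auto simp: scons_def numeral_2_eq_2 numeral_3_eq_3)
  then show ?thesis by simp
qed

lemma dfb_eq [dfb_rules]: "dft x A t \<Longrightarrow> dft x A u \<Longrightarrow> dfb x A (\<lambda>e. t e = u e)"
proof (rule dfb_sub2)
  show "dfb x A (\<lambda>e. e 0 = e 1)"
    unfolding dfb_def by (intro exI[of _ "DEq 0 1"] exI[of _ "\<lambda>k e. e k"]) (auto simp: atomic_def)
qed

lemma dfb_mem [dfb_rules]: "dft x A t \<Longrightarrow> dft x A u \<Longrightarrow> dfb x A (\<lambda>e. t e \<epsilon> u e)"
proof (rule dfb_sub2)
  show "dfb x A (\<lambda>e. e 0 \<epsilon> e 1)"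
    unfolding dfb_def by (intro exI[of _ "DMem 0 1"] exI[of _ "\<lambda>k e. e k"]) (auto simp: atomic_def)
qed

lemma dfb_st [dfb_rules]: "dft True A t \<Longrightarrow> dfb True A (\<lambda>e. st (t e))"
proof (rule dfb_sub1)
  show "dfb True A (\<lambda>e. st (e 0))"
    unfolding dfb_def by (intro exI[of _ "DSt 0"] exI[of _ "\<lambda>k e. e k"]) (auto simp: atomic_def)
qed

lemma dft_fun1:
  assumes "dfb x A (\<lambda>e. e 0 = F (e 1))" "dft x A t"
  shows "dft x A (\<lambda>e. F (t e))"
  unfolding dft_def
  by (rule dfb_sub2[OF assms(1) dft_proj])
    (use dfb_ren[OF assms(2)[unfolded dft_def], of "0 ## (\<lambda>k. k + 2)"] in
      \<open>simp add: dft_def scons_def numeral_2_eq_2\<close>)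

lemma dft_fun2:
  assumes "dfb x A (\<lambda>e. e 0 = F (e 1) (e 2))" "dft x A t" "dft x A u"
  shows "dft x A (\<lambda>e. F (t e) (u e))"
  unfolding dft_def
  by (rule dfb_sub3[OF assms(1) dft_proj])
    (use dfb_ren[OF assms(2)[unfolded dft_def], of "0 ## (\<lambda>k. k + 2)"]
      dfb_ren[OF assms(3)[unfolded dft_def], of "0 ## (\<lambda>k. k + 2)"] in
      \<open>simp_all add: dft_def scons_def numeral_2_eq_2\<close>)

text \<open>The bridge to the axiom schemes. Position \<open>i\<close> of the environment is named
  \<open>4 * i + 1\<close> and the parameter in slot \<open>k\<close> is named
  \<open>4 * k + 3\<close>. Even names stay available for bound variables and for the set variables
  of an axiom.\<close>

lemma dfb_fm:
  assumes "dfb x A P"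
  obtains \<phi> \<rho> where "x \<or> internal \<phi>" "\<forall>k\<in>fv \<phi>. odd k" "\<forall>i. 4 * i + 3 \<in> fv \<phi> \<longrightarrow> \<rho> i \<in> A"
    "\<forall>f. (\<forall>i. 4 * i + 3 \<in> fv \<phi> \<longrightarrow> f (4 * i + 3) = \<rho> i) \<longrightarrow> (sat UNIV E st f \<phi> \<longleftrightarrow> P (\<lambda>i. f (4 * i + 1)))"
proof -
  obtain p s where p: "x \<or> dint p" and s: "\<And>k. atomic A (s k)"
    and P: "\<And>e. P e = dsat E st (\<lambda>k. s k e) p"
    using assms unfolding dfb_def by blast
  let ?R = "\<lambda>k w. (\<exists>i. fst w = 4 * i + 1 \<and> s k = (\<lambda>e. e i)) \<or> (fst w = 4 * k + 3 \<and> s k = (\<lambda>_. snd w) \<and> snd w \<in> A)"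
  have "\<exists>w. ?R k w" for k
    using s[of k] unfolding atomic_def by auto
  then obtain g where g: "\<And>k. ?R k (g k)"
    using choice[of ?R] by blast
  define v \<rho> where "v = (\<lambda>k. fst (g k))" and "\<rho> = (\<lambda>k. snd (g k))"
  have v: "(\<exists>i. v k = 4 * i + 1 \<and> s k = (\<lambda>e. e i)) \<or>
      (v k = 4 * k + 3 \<and> s k = (\<lambda>_. \<rho> k) \<and> \<rho> k \<in> A)" for k
    using g[of k] by (simp add: v_def \<rho>_def)
  have odd: "odd (v k)" for k
    using v[of k] by auto
  let ?\<phi> = "named v 0 p"
  show ?thesis
  proof
    show "x \<or> internal ?\<phi>" using p by simp
    show "\<forall>k\<in>fv ?\<phi>. odd k"
      using fv_named[of v 0 p] odd by auto
    show "\<forall>i. 4 * i + 3 \<in> fv ?\<phi> \<longrightarrow> \<rho> i \<in> A"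
    proof (intro allI impI)
      fix i assume "4 * i + 3 \<in> fv ?\<phi>"
      then have "4 * i + 3 \<in> range v" using fv_named[of v 0 p] by blast
      then obtain k where k: "v k = 4 * i + 3" by auto
      then have "v k \<noteq> 4 * j + 1" for j by presburger
      then show "\<rho> i \<in> A" using v[of k] k by auto
    qed
    show "\<forall>f. (\<forall>i. 4 * i + 3 \<in> fv ?\<phi> \<longrightarrow> f (4 * i + 3) = \<rho> i) \<longrightarrow>
        (sat UNIV E st f ?\<phi> \<longleftrightarrow> P (\<lambda>i. f (4 * i + 1)))"
    proof (intro allI impI)
      fix f assume f: "\<forall>i. 4 * i + 3 \<in> fv ?\<phi> \<longrightarrow> f (4 * i + 3) = \<rho> i"
      let ?g = "\<lambda>k. if k mod 4 = 3 then \<rho> (k div 4) else f k"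
      have "sat UNIV E st f ?\<phi> = sat UNIV E st ?g ?\<phi>"
      proof (rule sat_cong)
        fix k assume k: "k \<in> fv ?\<phi>"
        show "f k = ?g k"
        proof (cases "k mod 4 = 3")
          case True
          then have "4 * (k div 4) + 3 = k" by presburger
          then show ?thesis using f k True by (metis (full_types))
        qed simp
      qed
      moreover have "?g (v k) = s k (\<lambda>i. f (4 * i + 1))" for k
      proof -
        have "(4 * i + 1) mod 4 = (1::nat)" "(4 * i + 3) mod 4 = (3::nat)" "(4 * i + 3) div 4 = i" for i :: nat
          by presburger+
        then show ?thesis using v[of k] by auto
      qed
      ultimately show "sat UNIV E st f ?\<phi> \<longleftrightarrow> P (\<lambda>i. f (4 * i + 1))"
        using odd by (simp add: sat_named P)
    qed
  qed
qed

end

section \<open>Models of IST\<close>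

locale ist_model = membership_structure E st
  for E :: "'a \<Rightarrow> 'a \<Rightarrow> bool" (infix "\<epsilon>" 50) and st :: "'a \<Rightarrow> bool" +
  assumes ist: "p \<in> IST_ax \<Longrightarrow> sat UNIV E st e p"
begin

section \<open>The axioms of IST as statements about definable predicates\<close>

lemma extensionality: "(\<And>z. z \<epsilon> x \<longleftrightarrow> z \<epsilon> y) \<Longrightarrow> x = y"
  using ist[of ax_extensionality "\<lambda>_. x"] by (simp add: IST_ax_def ZFC_ax_def ax_extensionality_def)

lemma foundation: "x \<epsilon> a \<Longrightarrow> \<exists>m. m \<epsilon> a \<and> (\<forall>z. z \<epsilon> m \<longrightarrow> \<not> z \<epsilon> a)"
  using ist[of ax_foundation "\<lambda>_. x"] by (simp add: IST_ax_def ZFC_ax_def ax_foundation_def) blast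

lemma pairing: "\<exists>c. a \<epsilon> c \<and> b \<epsilon> c"
  using ist[of ax_pairing "\<lambda>_. a"] by (simp add: IST_ax_def ZFC_ax_def ax_pairing_def)

lemma union: "\<exists>u. \<forall>x z. z \<epsilon> x \<and> x \<epsilon> a \<longrightarrow> z \<epsilon> u"
  using ist[of ax_union "\<lambda>_. a"] by (simp add: IST_ax_def ZFC_ax_def ax_union_def)

lemma power: "\<exists>u. \<forall>x. (\<forall>z. z \<epsilon> x \<longrightarrow> z \<epsilon> a) \<longrightarrow> x \<epsilon> u"
  using ist[of ax_power "\<lambda>_. a"] by (simp add: IST_ax_def ZFC_ax_def ax_power_def)

lemma infinity:
  "\<exists>I. (\<exists>x. x \<epsilon> I \<and> (\<forall>u. \<not> u \<epsilon> x)) \<and> (\<forall>y. y \<epsilon> I \<longrightarrow> (\<exists>s. s \<epsilon> I \<and> (\<forall>u. u \<epsilon> s \<longleftrightarrow> u \<epsilon> y \<or> u = y)))"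
  using ist[of ax_infinity "\<lambda>_. undefined"]
  by (simp add: IST_ax_def ZFC_ax_def ax_infinity_def)

lemma choice:
  assumes "\<And>x. x \<epsilon> a \<Longrightarrow> \<exists>z. z \<epsilon> x"
    and "\<And>x y z. x \<epsilon> a \<Longrightarrow> y \<epsilon> a \<Longrightarrow> z \<epsilon> x \<Longrightarrow> z \<epsilon> y \<Longrightarrow> x = y"
  shows "\<exists>c. \<forall>x. x \<epsilon> a \<longrightarrow> (\<exists>y. y \<epsilon> x \<and> y \<epsilon> c \<and> (\<forall>z. z \<epsilon> x \<and> z \<epsilon> c \<longrightarrow> z = y))"
proof -
  have "(\<forall>x. x \<epsilon> a \<longrightarrow> (\<exists>z. z \<epsilon> x)) \<and>
      (\<forall>x y. x \<epsilon> a \<and> y \<epsilon> a \<and> x \<noteq> y \<longrightarrow> \<not> (\<exists>z. z \<epsilon> x \<and> z \<epsilon> y)) \<longrightarrow>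
      (\<exists>c. \<forall>x. x \<epsilon> a \<longrightarrow> (\<exists>y. (y \<epsilon> x \<and> y \<epsilon> c) \<and> (\<forall>z. z \<epsilon> x \<and> z \<epsilon> c \<longrightarrow> z = y)))"
    using ist[of ax_choice "\<lambda>_. a"] unfolding ax_choice_def
    by (simp only: sat.simps sat_connectives IST_ax_def ZFC_ax_def ax_choice_def)
      (simp del: not_ex)
  moreover have "\<forall>x. x \<epsilon> a \<longrightarrow> (\<exists>z. z \<epsilon> x)" using assms(1) by blast
  moreover have "\<forall>x y. x \<epsilon> a \<and> y \<epsilon> a \<and> x \<noteq> y \<longrightarrow> \<not> (\<exists>z. z \<epsilon> x \<and> z \<epsilon> y)"
    using assms(2) by blast
  ultimately show ?thesis unfolding conj_assoc by (elim impE) (intro conjI; assumption)+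
qed

lemma residue_3_mod_4: "4 * i + 3 \<noteq> (0::nat)" "4 * i + 3 \<noteq> (1::nat)" "4 * i + 3 \<noteq> (2::nat)" "4 * i + 3 \<noteq> (5::nat)"
    "(4 * i + 3) div 4 = (i::nat)" "(4 * i + 3) mod 4 = (3::nat)"
  by presburger+

lemma separation:
  assumes "dfb False UNIV (\<lambda>e. Q (e 0))"
  shows "\<exists>S. \<forall>x. x \<epsilon> S \<longleftrightarrow> x \<epsilon> A \<and> Q x"
proof -
  obtain \<phi> \<rho> where \<phi>: "False \<or> internal \<phi>" "\<forall>k\<in>fv \<phi>. odd k" "\<forall>i. 4 * i + 3 \<in> fv \<phi> \<longrightarrow> \<rho> i \<in> UNIV"
    "\<forall>f. (\<forall>i. 4 * i + 3 \<in> fv \<phi> \<longrightarrow> f (4 * i + 3) = \<rho> i) \<longrightarrow> (sat UNIV E st f \<phi> \<longleftrightarrow> Q (f (4 * 0 + 1)))"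
    by (rule dfb_fm[OF assms])
  have even_not_fv: "0 \<notin> fv \<phi>" "2 \<notin> fv \<phi>"
    using \<phi>(2) by force+
  \<comment> \<open>\<open>k div 4\<close> recovers \<open>i\<close> from the parameter name
    \<open>4 * i + 3\<close>. Variable 1 is position 0 of the environment; in the schemes with two
    arguments, variable 5 is position 1.\<close>
  let ?f = "\<lambda>k. \<rho> (k div 4)"
  have *: "sat UNIV E st (?f(2 := A, 0 := S, 1 := x)) \<phi> \<longleftrightarrow> Q x" for A S x
    by (subst \<phi>(4)[rule_format]) (use residue_3_mod_4 in auto)
  have "All 2 (Ex 0 (All 1 (Iff (Mem 1 0) (And (Mem 1 2) \<phi>)))) \<in> IST_ax"
    unfolding IST_ax_def ZFC_ax_def separation_ax_def using \<phi>(1) even_not_fv by fastforce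
  from ist[OF this, of ?f] show ?thesis
    unfolding sat.simps sat_connectives * by simp
qed

lemma replacement:
  assumes "dfb False UNIV (\<lambda>e. Q (e 0) (e 1))" and "\<And>x. x \<epsilon> A \<Longrightarrow> \<exists>!y. Q x y"
  shows "\<exists>B. \<forall>x. x \<epsilon> A \<longrightarrow> (\<exists>y. y \<epsilon> B \<and> Q x y)"
proof -
  obtain \<phi> \<rho> where \<phi>: "False \<or> internal \<phi>" "\<forall>k\<in>fv \<phi>. odd k" "\<forall>i. 4 * i + 3 \<in> fv \<phi> \<longrightarrow> \<rho> i \<in> UNIV"
    "\<forall>f. (\<forall>i. 4 * i + 3 \<in> fv \<phi> \<longrightarrow> f (4 * i + 3) = \<rho> i) \<longrightarrow> (sat UNIV E st f \<phi> \<longleftrightarrow> Q (f (4 * 0 + 1)) (f (4 * 1 + 1)))"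
    by (rule dfb_fm[OF assms(1)])
  obtain z where z: "z \<notin> vars \<phi> \<union> {0, 1, 2, 5}"
    using ex_new_if_finite[OF infinite_UNIV_nat, of "vars \<phi> \<union> {0, 1, 2, 5}"] finite_vars by auto
  have even_not_fv: "0 \<notin> fv \<phi>" "2 \<notin> fv \<phi>"
    using \<phi>(2) by force+
  let ?f = "\<lambda>k. \<rho> (k div 4)"
  have 1: "sat UNIV E st (?f(0 := A, 1 := x, 5 := y)) \<phi> \<longleftrightarrow> Q x y" for A x y
    by (subst \<phi>(4)[rule_format]) (use residue_3_mod_4 in auto)
  have 2: "sat UNIV E st (?f(0 := A, 1 := x, 5 := y, z := v)) (subst \<phi> 5 z) \<longleftrightarrow> Q x v" for A x y v
    using z fv_subset_vars[of \<phi>] by (subst sat_subst[OF substable_fresh], simp, subst \<phi>(4)[rule_format]) (use residue_3_mod_4 in auto)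
  have 3: "sat UNIV E st (?f(0 := A, 2 := B, 1 := x, 5 := y)) \<phi> \<longleftrightarrow> Q x y" for A B x y
    by (subst \<phi>(4)[rule_format]) (use residue_3_mod_4 in auto)
  have "All 0 (Imp
        (All 1 (Imp (Mem 1 0) (Ex 5 (And \<phi> (All z (Imp (subst \<phi> 5 z) (Eq z 5)))))))
        (Ex 2 (All 1 (Imp (Mem 1 0) (Ex 5 (And (Mem 5 2) \<phi>)))))) \<in> replacement_ax"
    unfolding replacement_ax_def
    by (rule CollectI, rule exI[of _ \<phi>], rule exI[of _ 1], rule exI[of _ 5], rule exI[of _ z],
        rule exI[of _ 0], rule exI[of _ 2]) (use \<phi>(1) even_not_fv z in simp)
  then have "All 0 (Imp
        (All 1 (Imp (Mem 1 0) (Ex 5 (And \<phi> (All z (Imp (subst \<phi> 5 z) (Eq z 5)))))))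
        (Ex 2 (All 1 (Imp (Mem 1 0) (Ex 5 (And (Mem 5 2) \<phi>)))))) \<in> IST_ax"
    by (simp add: IST_ax_def ZFC_ax_def)
  from ist[OF this, of ?f]
  have "\<forall>A. (\<forall>x. x \<epsilon> A \<longrightarrow> (\<exists>y. Q x y \<and> (\<forall>v. Q x v \<longrightarrow> v = y))) \<longrightarrow>
      (\<exists>B. \<forall>x. x \<epsilon> A \<longrightarrow> (\<exists>y. y \<epsilon> B \<and> Q x y))"
    using z unfolding sat.simps sat_connectives 1 2 3 by simp
  moreover have "\<forall>x. x \<epsilon> A \<longrightarrow> (\<exists>y. Q x y \<and> (\<forall>v. Q x v \<longrightarrow> v = y))"
    using assms(2) by blast
  ultimately show ?thesis by blast
qed

definition fin :: "'a \<Rightarrow> bool" where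
  "fin A \<longleftrightarrow> (\<forall>X. (\<exists>u. u \<epsilon> X) \<and> (\<forall>u. u \<epsilon> X \<longrightarrow> (\<forall>w. w \<epsilon> u \<longrightarrow> w \<epsilon> A)) \<longrightarrow>
     (\<exists>m. m \<epsilon> X \<and> (\<forall>u. u \<epsilon> X \<and> (\<forall>w. w \<epsilon> u \<longrightarrow> w \<epsilon> m) \<longrightarrow> (\<forall>w. w \<epsilon> m \<longrightarrow> w \<epsilon> u))))"

lemma sat_fin_fm: "sat UNIV E st e (fin_fm A) \<longleftrightarrow> fin (e A)"
  by (simp add: fin_fm_def Let_def fin_def)

lemma idealization:
  assumes "dfb False UNIV (\<lambda>e. Q (e 0) (e 1))"
  shows "(\<forall>A. st A \<and> fin A \<longrightarrow> (\<exists>x. \<forall>a. a \<epsilon> A \<longrightarrow> Q x a)) \<longleftrightarrow> (\<exists>x. \<forall>a. st a \<longrightarrow> Q x a)"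
proof -
  obtain \<phi> \<rho> where \<phi>: "False \<or> internal \<phi>" "\<forall>k\<in>fv \<phi>. odd k" "\<forall>i. 4 * i + 3 \<in> fv \<phi> \<longrightarrow> \<rho> i \<in> UNIV"
    "\<forall>f. (\<forall>i. 4 * i + 3 \<in> fv \<phi> \<longrightarrow> f (4 * i + 3) = \<rho> i) \<longrightarrow> (sat UNIV E st f \<phi> \<longleftrightarrow> Q (f (4 * 0 + 1)) (f (4 * 1 + 1)))"
    by (rule dfb_fm[OF assms])
  have even_not_fv: "0 \<notin> fv \<phi>" "2 \<notin> fv \<phi>"
    using \<phi>(2) by force+
  let ?f = "\<lambda>k. \<rho> (k div 4)"
  have 1: "sat UNIV E st (?f(0 := A, 1 := x, 5 := a)) \<phi> \<longleftrightarrow> Q x a" for A x a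
    by (subst \<phi>(4)[rule_format]) (use residue_3_mod_4 in auto)
  have 2: "sat UNIV E st (?f(1 := x, 5 := a)) \<phi> \<longleftrightarrow> Q x a" for x a
    by (subst \<phi>(4)[rule_format]) (use residue_3_mod_4 in auto)
  have "Iff (All 0 (Imp (And (St 0) (fin_fm 0)) (Ex 1 (All 5 (Imp (Mem 5 0) \<phi>)))))
        (Ex 1 (All 5 (Imp (St 5) \<phi>))) \<in> idealization_ax"
    unfolding idealization_ax_def
    by (rule CollectI, rule exI[of _ \<phi>], rule exI[of _ 1], rule exI[of _ 5], rule exI[of _ 0]) (use \<phi>(1) even_not_fv in simp)
  then have "Iff (All 0 (Imp (And (St 0) (fin_fm 0)) (Ex 1 (All 5 (Imp (Mem 5 0) \<phi>)))))
        (Ex 1 (All 5 (Imp (St 5) \<phi>))) \<in> IST_ax"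
    by (simp add: IST_ax_def)
  from ist[OF this, of ?f] show ?thesis
    unfolding sat.simps sat_connectives 1 2 sat_fin_fm by simp
qed

lemma standardization:
  assumes "dfb True UNIV (\<lambda>e. Q (e 0))" and "st X"
  shows "\<exists>Y. st Y \<and> (\<forall>x. st x \<longrightarrow> (x \<epsilon> Y \<longleftrightarrow> x \<epsilon> X \<and> Q x))"
proof -
  obtain \<phi> \<rho> where \<phi>: "True \<or> internal \<phi>" "\<forall>k\<in>fv \<phi>. odd k" "\<forall>i. 4 * i + 3 \<in> fv \<phi> \<longrightarrow> \<rho> i \<in> UNIV"
    "\<forall>f. (\<forall>i. 4 * i + 3 \<in> fv \<phi> \<longrightarrow> f (4 * i + 3) = \<rho> i) \<longrightarrow> (sat UNIV E st f \<phi> \<longleftrightarrow> Q (f (4 * 0 + 1)))"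
    by (rule dfb_fm[OF assms(1)])
  have even_not_fv: "0 \<notin> fv \<phi>" "2 \<notin> fv \<phi>"
    using \<phi>(2) by force+
  let ?f = "\<lambda>k. \<rho> (k div 4)"
  have 1: "sat UNIV E st (?f(0 := X, 2 := Y, 1 := x)) \<phi> \<longleftrightarrow> Q x" for X Y x
    by (subst \<phi>(4)[rule_format]) (use residue_3_mod_4 in auto)
  have "All 0 (Imp (St 0) (Ex 2 (And (St 2)
        (All 1 (Imp (St 1) (Iff (Mem 1 2) (And (Mem 1 0) \<phi>))))))) \<in> standardization_ax"
    unfolding standardization_ax_def
    by (rule CollectI, rule exI[of _ \<phi>], rule exI[of _ 0], rule exI[of _ 2], rule exI[of _ 1]) (use even_not_fv in simp)
  then have "All 0 (Imp (St 0) (Ex 2 (And (St 2)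
        (All 1 (Imp (St 1) (Iff (Mem 1 2) (And (Mem 1 0) \<phi>))))))) \<in> IST_ax"
    by (simp add: IST_ax_def)
  from ist[OF this, of ?f] show ?thesis
    using assms(2) unfolding sat.simps sat_connectives 1 by simp
qed

lemma sat_st_all: "sat U E st e (st_all ts) \<longleftrightarrow> (\<forall>t\<in>set ts. st (e t))"
  by (induction ts) (auto simp: st_all_def)

lemma ex_standard: "\<exists>c. st c"
proof -
  have "Imp (st_all []) (Imp (Ex 0 (Eq 0 0)) (Ex 0 (And (St 0) (Eq 0 0)))) \<in> transfer_ax"
    unfolding transfer_ax_def
    by (intro CollectI exI[of _ "Eq 0 0"] exI[of _ 0] exI[of _ "[]"]) auto
  then have "Imp (st_all []) (Imp (Ex 0 (Eq 0 0)) (Ex 0 (And (St 0) (Eq 0 0)))) \<in> IST_ax"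
    by (simp add: IST_ax_def)
  from ist[OF this, of undefined] show ?thesis by (simp add: sat_st_all)
qed

lemma transfer:
  assumes "dfb False {c. st c} (\<lambda>e. Q (e 0))" and "Q a"
  shows "\<exists>x. st x \<and> Q x"
proof -
  obtain \<phi> \<rho> where \<phi>: "False \<or> internal \<phi>" "\<forall>k\<in>fv \<phi>. odd k" "\<forall>i. 4 * i + 3 \<in> fv \<phi> \<longrightarrow> \<rho> i \<in> {c. st c}"
    "\<forall>f. (\<forall>i. 4 * i + 3 \<in> fv \<phi> \<longrightarrow> f (4 * i + 3) = \<rho> i) \<longrightarrow> (sat UNIV E st f \<phi> \<longleftrightarrow> Q (f (4 * 0 + 1)))"
    by (rule dfb_fm[OF assms(1)])
  obtain c where c: "st c" using ex_standard by blast
  \<comment> \<open>Transfer asks every variable of \<open>ts\<close> to be standard, and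
    \<open>ts\<close> lists all free variables of the formula, including those that are not
    parameters. These receive the standard value \<open>c\<close>.\<close>
  let ?f = "\<lambda>k. if k mod 4 = 3 then \<rho> (k div 4) else c"
  have 1: "sat UNIV E st (?f(1 := x)) \<phi> \<longleftrightarrow> Q x" for x
    by (subst \<phi>(4)[rule_format]) (use residue_3_mod_4 in auto)
  obtain ts where ts: "set ts = fv \<phi>"
    using finite_list[OF finite_subset[OF fv_subset_vars finite_vars]] by auto
  have "Imp (st_all ts) (Imp (Ex 1 \<phi>) (Ex 1 (And (St 1) \<phi>))) \<in> transfer_ax"
    unfolding transfer_ax_def
    by (rule CollectI, rule exI[of _ \<phi>], rule exI[of _ 1], rule exI[of _ ts]) (use \<phi>(1) ts in auto)
  then have "Imp (st_all ts) (Imp (Ex 1 \<phi>) (Ex 1 (And (St 1) \<phi>))) \<in> IST_ax"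
    by (simp add: IST_ax_def)
  note ax = ist[OF this, of ?f]
  have "st (?f k)" if "k \<in> fv \<phi>" for k
  proof (cases "k mod 4 = 3")
    case True
    then have "4 * (k div 4) + 3 = k" by presburger
    then show ?thesis using True that \<phi>(3)[rule_format, of "k div 4"] by simp
  qed (simp add: c)
  then show ?thesis
    using ax assms(2) ts unfolding sat.simps sat_connectives 1 sat_st_all by auto
qed

subsection \<open>Sets and well-founded recursion\<close>

abbreviation dprd :: "('a \<Rightarrow> bool) \<Rightarrow> bool" where
  "dprd Q \<equiv> dfb False UNIV (\<lambda>e. Q (e 0))"

abbreviation drel :: "('a \<Rightarrow> 'a \<Rightarrow> bool) \<Rightarrow> bool" where
  "drel Q \<equiv> dfb False UNIV (\<lambda>e. Q (e 0) (e 1))"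

abbreviation dfun :: "('a \<Rightarrow> 'a) \<Rightarrow> bool" where
  "dfun F \<equiv> dfb False UNIV (\<lambda>e. e 0 = F (e 1))"

definition small :: "('a \<Rightarrow> bool) \<Rightarrow> bool" where
  "small P \<longleftrightarrow> (\<exists>y. \<forall>z. z \<epsilon> y \<longleftrightarrow> P z)"

definition setof :: "('a \<Rightarrow> bool) \<Rightarrow> 'a" where
  "setof P = (SOME y. \<forall>z. z \<epsilon> y \<longleftrightarrow> P z)"

lemma mem_setof: "small P \<Longrightarrow> z \<epsilon> setof P \<longleftrightarrow> P z"
  unfolding small_def setof_def by (rule someI2_ex[where Q = "\<lambda>y. z \<epsilon> y \<longleftrightarrow> P z"]) auto

lemma eq_setof_iff: "small P \<Longrightarrow> y = setof P \<longleftrightarrow> (\<forall>z. z \<epsilon> y \<longleftrightarrow> P z)"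
  using extensionality[of y "setof P"] by (auto simp: mem_setof)

lemma small_mem: "small (\<lambda>z. z \<epsilon> a)"
  unfolding small_def by blast

lemma small_bounded:
  assumes "dprd Q" "\<And>z. Q z \<Longrightarrow> z \<epsilon> a"
  shows "small Q"
  using separation[OF assms(1), of a] assms(2) unfolding small_def by metis

lemma small_upair: "small (\<lambda>z. z = a \<or> z = b)"
proof -
  obtain c where "a \<epsilon> c" "b \<epsilon> c" using pairing by blast
  then show ?thesis by (intro small_bounded[of _ c] dfb_rules UNIV_I) auto
qed

lemma small_Union: "small (\<lambda>z. \<exists>x. z \<epsilon> x \<and> x \<epsilon> a)"
proof -
  obtain c where "\<forall>x z. z \<epsilon> x \<and> x \<epsilon> a \<longrightarrow> z \<epsilon> c" using union by blast
  then show ?thesis by (intro small_bounded[of _ c] dfb_rules UNIV_I) auto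
qed

definition sub :: "'a \<Rightarrow> 'a \<Rightarrow> bool" where
  "sub x y \<longleftrightarrow> (\<forall>z. z \<epsilon> x \<longrightarrow> z \<epsilon> y)"

lemma dfb_sub [dfb_rules]: "dft x A t \<Longrightarrow> dft x A u \<Longrightarrow> dfb x A (\<lambda>e. sub (t e) (u e))"
  by (rule dfb_sub2) (unfold sub_def, intro dfb_rules)

lemma sub_refl: "sub x x"
  by (simp add: sub_def)

lemma small_pow: "small (\<lambda>z. sub z a)"
proof -
  obtain c where "\<forall>x. (\<forall>z. z \<epsilon> x \<longrightarrow> z \<epsilon> a) \<longrightarrow> x \<epsilon> c" using power by blast
  then show ?thesis by (intro small_bounded[of _ c] dfb_rules UNIV_I) (auto simp: sub_def)
qed

definition emp :: 'a where "emp = setof (\<lambda>z. False)"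
definition upair :: "'a \<Rightarrow> 'a \<Rightarrow> 'a" where "upair a b = setof (\<lambda>z. z = a \<or> z = b)"
definition un :: "'a \<Rightarrow> 'a" where "un a = setof (\<lambda>z. \<exists>x. z \<epsilon> x \<and> x \<epsilon> a)"
definition pow :: "'a \<Rightarrow> 'a" where "pow a = setof (\<lambda>z. sub z a)"
definition opair :: "'a \<Rightarrow> 'a \<Rightarrow> 'a" where "opair a b = upair (upair a a) (upair a b)"
definition cup :: "'a \<Rightarrow> 'a \<Rightarrow> 'a" where "cup a b = un (upair a b)"

lemma small_False: "small (\<lambda>z. False)"
  by (rule small_bounded[of _ undefined]) (intro dfb_rules, simp)

lemma mem_emp [simp]: "\<not> z \<epsilon> emp"
  unfolding emp_def by (simp add: mem_setof small_False)

lemma mem_upair [simp]: "z \<epsilon> upair a b \<longleftrightarrow> z = a \<or> z = b"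
  unfolding upair_def by (simp add: mem_setof small_upair)

lemma mem_un [simp]: "z \<epsilon> un a \<longleftrightarrow> (\<exists>x. z \<epsilon> x \<and> x \<epsilon> a)"
  unfolding un_def by (simp add: mem_setof small_Union)

lemma mem_pow [simp]: "z \<epsilon> pow a \<longleftrightarrow> sub z a"
  unfolding pow_def by (simp add: mem_setof small_pow)

lemma mem_cup [simp]: "z \<epsilon> cup a b \<longleftrightarrow> z \<epsilon> a \<or> z \<epsilon> b"
  unfolding cup_def by auto

lemma eq_iff_mem: "x = y \<longleftrightarrow> (\<forall>z. z \<epsilon> x \<longleftrightarrow> z \<epsilon> y)"
  using extensionality[of x y] by auto

lemma dft_emp [dfb_rules]: "dft x A (\<lambda>e. emp)"
proof -
  have "e 0 = emp \<longleftrightarrow> (\<forall>z. \<not> z \<epsilon> e 0)" for e :: "nat \<Rightarrow> 'a"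
    using eq_iff_mem[of "e 0" emp] by simp
  then show ?thesis unfolding dft_def by (simp only:) (intro dfb_rules)
qed

lemma dft_upair [dfb_rules]: "dft x A t \<Longrightarrow> dft x A u \<Longrightarrow> dft x A (\<lambda>e. upair (t e) (u e))"
  by (rule dft_fun2) (unfold eq_iff_mem[where y = "upair a b" for a b] mem_upair, intro dfb_rules)

lemma dft_un [dfb_rules]: "dft x A t \<Longrightarrow> dft x A (\<lambda>e. un (t e))"
  by (rule dft_fun1) (unfold eq_iff_mem[where y = "un a" for a] mem_un, intro dfb_rules)

lemma dft_opair [dfb_rules]: "dft x A t \<Longrightarrow> dft x A u \<Longrightarrow> dft x A (\<lambda>e. opair (t e) (u e))"
  unfolding opair_def by (intro dfb_rules)

lemma dft_cup [dfb_rules]: "dft x A t \<Longrightarrow> dft x A u \<Longrightarrow> dft x A (\<lambda>e. cup (t e) (u e))"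
  unfolding cup_def by (intro dfb_rules)

lemma upair_eq_iff: "upair a b = upair c d \<longleftrightarrow> a = c \<and> b = d \<or> a = d \<and> b = c"
proof
  assume eq: "upair a b = upair c d"
  have "z \<epsilon> upair a b \<longleftrightarrow> z \<epsilon> upair c d" for z using eq by simp
  from this[of a] this[of b] this[of c] this[of d]
  show "a = c \<and> b = d \<or> a = d \<and> b = c" by auto
qed (auto intro: extensionality)

lemma opair_inject [simp]: "opair a b = opair c d \<longleftrightarrow> a = c \<and> b = d"
  unfolding opair_def upair_eq_iff by auto

lemma opair_neq_emp [simp]: "opair a b \<noteq> emp"
  unfolding opair_def by (metis mem_emp mem_upair)

lemma small_image:
  assumes F: "dfun F" and P: "small P"
  shows "small (\<lambda>z. \<exists>x. P x \<and> z = F x)"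
proof -
  obtain A where A: "\<And>z. z \<epsilon> A \<longleftrightarrow> P z" using P unfolding small_def by blast
  have "drel (\<lambda>x y. y = F x)"
    by (rule dfb_sub2[OF F]) (rule dft_proj)+
  from replacement[OF this, of A] obtain B where "\<And>x. x \<epsilon> A \<Longrightarrow> F x \<epsilon> B" by auto
  moreover have "dprd (\<lambda>z. \<exists>x. x \<epsilon> A \<and> z = F x)"
    by (intro dfb_rules UNIV_I dfb_sub2[OF F])
  ultimately show ?thesis
    using small_bounded[of "\<lambda>z. \<exists>x. x \<epsilon> A \<and> z = F x" B] by (auto simp: A)
qed

lemma small_Times: "small (\<lambda>z. \<exists>a b. a \<epsilon> A \<and> b \<epsilon> B \<and> z = opair a b)"
proof (rule small_bounded[of _ "pow (pow (cup A B))"])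
  show "dprd (\<lambda>z. \<exists>a b. a \<epsilon> A \<and> b \<epsilon> B \<and> z = opair a b)"
    by (intro dfb_rules UNIV_I)
qed (auto simp: opair_def sub_def)

lemma not_mem_self: "\<not> x \<epsilon> x"
  using foundation[of x "upair x x"] by auto

lemma not_mem_cycle: "x \<epsilon> y \<Longrightarrow> \<not> y \<epsilon> x"
  using foundation[of x "upair x y"] by auto

definition ind :: "'a \<Rightarrow> bool" where
  "ind I \<longleftrightarrow> (\<exists>x. x \<epsilon> I \<and> (\<forall>u. \<not> u \<epsilon> x)) \<and>
     (\<forall>y. y \<epsilon> I \<longrightarrow> (\<exists>s. s \<epsilon> I \<and> (\<forall>u. u \<epsilon> s \<longleftrightarrow> u \<epsilon> y \<or> u = y)))"

definition is_omega :: "'a \<Rightarrow> bool" where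
  "is_omega w \<longleftrightarrow> ind w \<and> (\<forall>I. ind I \<longrightarrow> (\<forall>n. n \<epsilon> w \<longrightarrow> n \<epsilon> I))"

lemma dfb_ind [dfb_rules]: "dft x A t \<Longrightarrow> dfb x A (\<lambda>e. ind (t e))"
  by (rule dfb_sub1) (unfold ind_def, intro dfb_rules)

lemma dfb_is_omega [dfb_rules]: "dft x A t \<Longrightarrow> dfb x A (\<lambda>e. is_omega (t e))"
  by (rule dfb_sub1) (unfold is_omega_def, intro dfb_rules)

definition suc :: "'a \<Rightarrow> 'a" where "suc n = cup n (upair n n)"

lemma mem_suc [simp]: "z \<epsilon> suc n \<longleftrightarrow> z \<epsilon> n \<or> z = n"
  by (auto simp: suc_def)

lemma ind_iff: "ind I \<longleftrightarrow> emp \<epsilon> I \<and> (\<forall>y. y \<epsilon> I \<longrightarrow> suc y \<epsilon> I)"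
proof -
  have "(\<forall>u. \<not> u \<epsilon> x) \<longleftrightarrow> x = emp" for x
    using eq_iff_mem[of x emp] by simp
  moreover have "(\<forall>u. u \<epsilon> s \<longleftrightarrow> u \<epsilon> y \<or> u = y) \<longleftrightarrow> s = suc y" for s y
    using eq_iff_mem[of s "suc y"] by simp
  ultimately show ?thesis unfolding ind_def by auto
qed

lemma ex_omega: "\<exists>w. is_omega w"
proof -
  obtain I where I: "ind I" using infinity unfolding ind_def by blast
  have "dprd (\<lambda>n. \<forall>J. ind J \<longrightarrow> n \<epsilon> J)" by (intro dfb_rules)
  from separation[OF this, of I] obtain w where w: "\<And>n. n \<epsilon> w \<longleftrightarrow> n \<epsilon> I \<and> (\<forall>J. ind J \<longrightarrow> n \<epsilon> J)"
    by blast
  then have "is_omega w"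
    using I unfolding is_omega_def ind_iff by auto
  then show ?thesis ..
qed

definition om :: 'a where "om = (SOME w. is_omega w)"

lemma is_omega_om: "is_omega om"
  unfolding om_def using ex_omega by (rule someI_ex)

lemma is_omega_iff: "is_omega w \<longleftrightarrow> w = om"
proof
  assume "is_omega w"
  then show "w = om"
    using is_omega_om unfolding is_omega_def by (intro extensionality) blast
qed (simp add: is_omega_om)

lemma dft_om [dfb_rules]: "dft x A (\<lambda>e. om)"
  unfolding dft_def by (fold is_omega_iff) (intro dfb_rules)

lemma ind_om: "ind om"
  using is_omega_om unfolding is_omega_def by (rule conjunct1)

lemma emp_om: "emp \<epsilon> om" and suc_om: "n \<epsilon> om \<Longrightarrow> suc n \<epsilon> om"
  using ind_om unfolding ind_iff by simp_all

text \<open>Partial solutions of the recursion, as sets of pairs closed downwards along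
  \<open>R\<close>. \<open>H\<close> receives the set of values at the predecessors, not the
  restricted function. This set is introduced by a quantifier, which keeps the predicate
  definable.\<close>

definition attempt :: "('a \<Rightarrow> 'a) \<Rightarrow> 'a \<Rightarrow> ('a \<Rightarrow> 'a \<Rightarrow> bool) \<Rightarrow> 'a \<Rightarrow> bool" where
  "attempt H d R g \<longleftrightarrow> (\<forall>c y y'. opair c y \<epsilon> g \<and> opair c y' \<epsilon> g \<longrightarrow> y = y') \<and>
     (\<forall>c y. opair c y \<epsilon> g \<longrightarrow> c \<epsilon> d \<and> (\<forall>b. b \<epsilon> d \<and> R b c \<longrightarrow> (\<exists>v. opair b v \<epsilon> g)) \<and>
        (\<exists>s. (\<forall>z. z \<epsilon> s \<longleftrightarrow> (\<exists>b. b \<epsilon> d \<and> R b c \<and> opair b z \<epsilon> g)) \<and> y = H s))"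

lemma attempt_fun: "attempt H d R g \<Longrightarrow> opair c y \<epsilon> g \<Longrightarrow> opair c y' \<epsilon> g \<Longrightarrow> y = y'"
  and attempt_dom: "attempt H d R g \<Longrightarrow> opair c y \<epsilon> g \<Longrightarrow> c \<epsilon> d"
  and attempt_down: "attempt H d R g \<Longrightarrow> opair c y \<epsilon> g \<Longrightarrow> b \<epsilon> d \<Longrightarrow> R b c \<Longrightarrow> \<exists>v. opair b v \<epsilon> g"
  and attempt_step: "attempt H d R g \<Longrightarrow> opair c y \<epsilon> g \<Longrightarrow>
    \<exists>s. (\<forall>z. z \<epsilon> s \<longleftrightarrow> (\<exists>b. b \<epsilon> d \<and> R b c \<and> opair b z \<epsilon> g)) \<and> y = H s"
  unfolding attempt_def by blast+

text \<open>Two attempts agree, by a minimal point of disagreement; the values of all attempts form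
  \<open>f\<close>; and a minimal point outside its domain could be added. As \<open>f\<close> is
  obtained as a definable function, it may be used in Separation and Replacement later.\<close>

lemma wf_recursion:
  assumes H: "dfun H" and R: "drel R"
    and wf: "\<forall>B. (\<exists>x. x \<epsilon> B) \<and> sub B d \<longrightarrow> (\<exists>m. m \<epsilon> B \<and> (\<forall>x. x \<epsilon> B \<longrightarrow> \<not> R x m))"
  obtains f where "dfun f" "\<forall>c. c \<epsilon> d \<longrightarrow> f c = H (setof (\<lambda>z. \<exists>b. b \<epsilon> d \<and> R b c \<and> z = f b))"
    "\<forall>c. small (\<lambda>z. \<exists>b. b \<epsilon> d \<and> R b c \<and> z = f b)"
proof -
  note Rd = dfb_sub2[OF R] and Hd = dfb_sub2[OF H]
  let ?att = "attempt H d R"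
  have wfD: "\<exists>m. m \<epsilon> d \<and> P m \<and> (\<forall>x. x \<epsilon> d \<and> P x \<longrightarrow> \<not> R x m)" if "dprd P" "c \<epsilon> d" "P c" for P c
  proof -
    obtain B where "\<And>x. x \<epsilon> B \<longleftrightarrow> x \<epsilon> d \<and> P x" using separation[OF \<open>dprd P\<close>] by blast
    then show ?thesis using wf[rule_format, of B] that by (auto simp: sub_def)
  qed
  have datt: "dfb False UNIV (\<lambda>e. ?att (t e))" if "dft False UNIV t" for t
    by (rule dfb_sub1[OF _ that]) (unfold attempt_def, intro dfb_rules UNIV_I Rd Hd)
  have agree: "y = y'" if g: "?att g" "?att g'" and c: "opair c y \<epsilon> g" "opair c y' \<epsilon> g'" for g g' c y y'
  proof (rule ccontr)
    assume neq: "y \<noteq> y'"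
    have "dprd (\<lambda>c. \<exists>y y'. opair c y \<epsilon> g \<and> opair c y' \<epsilon> g' \<and> y \<noteq> y')"
      by (intro dfb_rules UNIV_I)
    moreover have "c \<epsilon> d" by (rule attempt_dom[OF g(1) c(1)])
    ultimately obtain m where m: "m \<epsilon> d" "\<exists>y y'. opair m y \<epsilon> g \<and> opair m y' \<epsilon> g' \<and> y \<noteq> y'"
      and min: "\<And>x. x \<epsilon> d \<Longrightarrow> R x m \<Longrightarrow> \<not> (\<exists>y y'. opair x y \<epsilon> g \<and> opair x y' \<epsilon> g' \<and> y \<noteq> y')"
      using wfD[of "\<lambda>c. \<exists>y y'. opair c y \<epsilon> g \<and> opair c y' \<epsilon> g' \<and> y \<noteq> y'" c] c neq by blast
    obtain u u' where u: "opair m u \<epsilon> g" "opair m u' \<epsilon> g'" "u \<noteq> u'" using m by blast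
    obtain s s' where s: "\<And>z. z \<epsilon> s \<longleftrightarrow> (\<exists>b. b \<epsilon> d \<and> R b m \<and> opair b z \<epsilon> g)" "u = H s"
      and s': "\<And>z. z \<epsilon> s' \<longleftrightarrow> (\<exists>b. b \<epsilon> d \<and> R b m \<and> opair b z \<epsilon> g')" "u' = H s'"
      using attempt_step[OF g(1) u(1)] attempt_step[OF g(2) u(2)] by blast
    have "\<exists>v. opair b v \<epsilon> g" "\<exists>v. opair b v \<epsilon> g'" if "b \<epsilon> d" "R b m" for b
      using attempt_down[OF g(1) u(1) that] attempt_down[OF g(2) u(2) that] by simp_all
    then have "opair b z \<epsilon> g \<longleftrightarrow> opair b z \<epsilon> g'" if "b \<epsilon> d" "R b m" for b z
      using min that by metis
    then have "s = s'" using s(1) s'(1) by (intro extensionality) blast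
    then show False using s(2) s'(2) u(3) by simp
  qed
  define Q where "Q c y \<longleftrightarrow> (\<exists>g. ?att g \<and> opair c y \<epsilon> g)" for c y
  have Q_fun: "Q c y \<Longrightarrow> Q c y' \<Longrightarrow> y = y'" for c y y'
    unfolding Q_def using agree by blast
  have dQ: "dfb False UNIV (\<lambda>e. Q (t e) (u e))" if "dft False UNIV t" "dft False UNIV u" for t u
    by (rule dfb_sub2[OF _ that]) (unfold Q_def, intro dfb_rules datt)
  \<comment> \<open>The default \<open>emp\<close> makes \<open>f\<close> total while its graph
    stays definable.\<close>
  define f where "f c = (if \<exists>y. Q c y then THE y. Q c y else emp)" for c
  have Qf: "Q c (f c)" if "Q c y" for c y
  proof -
    have "(THE y. Q c y) = y" using that Q_fun by blast
    then show ?thesis using that f_def by auto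
  qed
  have f_iff: "y = f c \<longleftrightarrow> Q c y \<or> \<not> (\<exists>y. Q c y) \<and> y = emp" for y c
  proof (cases "\<exists>y. Q c y")
    case True
    then have "Q c (f c)" using Qf by blast
    then show ?thesis using Q_fun[of c] True by blast
  qed (simp add: f_def)
  have df: "dfun f"
    unfolding f_iff by (intro dfb_rules dQ)
  have df2: "dfb False UNIV (\<lambda>e. t e = f (u e))" if "dft False UNIV t" "dft False UNIV u" for t u
    by (rule dfb_sub2[OF df that])
  have dft: "dft False UNIV (\<lambda>e. f (u e))" if "dft False UNIV u" for u
    by (rule dft_fun1[OF df that])
  have sm: "small (\<lambda>z. \<exists>b. b \<epsilon> d \<and> R b c \<and> z = f b)" for c
  proof -
    have "small (\<lambda>b. b \<epsilon> d \<and> R b c)"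
      by (rule small_bounded[of _ d]) (intro dfb_rules UNIV_I Rd, blast)
    from small_image[OF df this] show ?thesis by (simp add: conj_assoc)
  qed
  have rec: "f c = H (setof (\<lambda>z. \<exists>b. b \<epsilon> d \<and> R b c \<and> z = f b))" if c: "Q c y" for c y
  proof -
    obtain g where g: "?att g" "opair c (f c) \<epsilon> g" using Qf[OF c] Q_def by blast
    then obtain s where s: "\<And>z. z \<epsilon> s \<longleftrightarrow> (\<exists>b. b \<epsilon> d \<and> R b c \<and> opair b z \<epsilon> g)" "f c = H s"
      using attempt_step by blast
    have "opair b z \<epsilon> g \<longleftrightarrow> z = f b" if b: "b \<epsilon> d" "R b c" for b z
    proof -
      obtain v where v: "opair b v \<epsilon> g" using attempt_down[OF g b] by blast
      then have "Q b v" using g(1) Q_def by blast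
      then have "f b = v" using Qf Q_fun by blast
      moreover have "opair b z \<epsilon> g \<longleftrightarrow> z = v" using v attempt_fun[OF g(1)] by blast
      ultimately show ?thesis by simp
    qed
    then have "s = setof (\<lambda>z. \<exists>b. b \<epsilon> d \<and> R b c \<and> z = f b)"
      unfolding eq_setof_iff[OF sm] s(1) by blast
    then show ?thesis using s(2) by simp
  qed
  have down: "\<exists>y. Q b y" if "Q c y" "b \<epsilon> d" "R b c" for b c y
    using that attempt_down unfolding Q_def by blast
  have all: "\<exists>y. Q c y" if cd: "c \<epsilon> d" for c
  proof (rule ccontr)
    assume "\<nexists>y. Q c y"
    moreover have "dprd (\<lambda>c. \<nexists>y. Q c y)" by (intro dfb_rules dQ)
    ultimately obtain m where m: "m \<epsilon> d" "\<nexists>y. Q m y" and min: "\<And>x. x \<epsilon> d \<Longrightarrow> R x m \<Longrightarrow> \<exists>y. Q x y"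
      using wfD[of "\<lambda>c. \<nexists>y. Q c y" c] cd by blast
    define w where "w = H (setof (\<lambda>z. \<exists>b. b \<epsilon> d \<and> R b m \<and> z = f b))"
    \<comment> \<open>The new attempt extends the solution on its entire domain and not only below
      \<open>m\<close>. This avoids the transitive closure of \<open>R\<close>.\<close>
    have "small (\<lambda>c. c \<epsilon> d \<and> (\<exists>y. Q c y))"
      by (rule small_bounded[of _ d]) (intro dfb_rules UNIV_I dQ, blast)
    moreover have "dfun (\<lambda>c. opair c (f c))"
      by (intro dfb_rules dft)
    ultimately have "small (\<lambda>z. \<exists>c. (c \<epsilon> d \<and> (\<exists>y. Q c y)) \<and> z = opair c (f c))"
      using small_image[of "\<lambda>c. opair c (f c)"] by blast
    then obtain G0 where G0: "\<And>z. z \<epsilon> G0 \<longleftrightarrow> (\<exists>c. (c \<epsilon> d \<and> (\<exists>y. Q c y)) \<and> z = opair c (f c))"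
      unfolding small_def by blast
    let ?G = "cup G0 (upair (opair m w) (opair m w))"
    have G: "opair c y \<epsilon> ?G \<longleftrightarrow> (c \<epsilon> d \<and> (\<exists>y. Q c y) \<and> y = f c) \<or> (c = m \<and> y = w)" for c y
      by (auto simp: G0)
    have "?att ?G"
      unfolding attempt_def
    proof (intro conjI allI impI)
      fix c y y' assume "opair c y \<epsilon> ?G \<and> opair c y' \<epsilon> ?G"
      then show "y = y'" using m(2) unfolding G by blast
    next
      fix c y assume "opair c y \<epsilon> ?G"
      then show "c \<epsilon> d" using m(1) unfolding G by blast
    next
      fix c y b assume "opair c y \<epsilon> ?G" "b \<epsilon> d \<and> R b c"
      then have "\<exists>y. Q b y" using down min unfolding G by blast
      then show "\<exists>v. opair b v \<epsilon> ?G" using \<open>b \<epsilon> d \<and> R b c\<close> unfolding G by blast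
    next
      fix c y assume cy: "opair c y \<epsilon> ?G"
      have below: "\<exists>y. Q b y" if "b \<epsilon> d" "R b c" for b
        using cy that down min unfolding G by blast
      have "y = H (setof (\<lambda>z. \<exists>b. b \<epsilon> d \<and> R b c \<and> z = f b))"
        using cy rec w_def unfolding G by blast
      moreover have "z \<epsilon> setof (\<lambda>z. \<exists>b. b \<epsilon> d \<and> R b c \<and> z = f b) \<longleftrightarrow>
          (\<exists>b. b \<epsilon> d \<and> R b c \<and> opair b z \<epsilon> ?G)" for z
        unfolding mem_setof[OF sm] G using below m(2) by blast
      ultimately show "\<exists>s. (\<forall>z. z \<epsilon> s \<longleftrightarrow> (\<exists>b. b \<epsilon> d \<and> R b c \<and> opair b z \<epsilon> ?G)) \<and> y = H s"
        by blast
    qed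
    then have "Q m w" unfolding Q_def using G by blast
    then show False using m(2) by blast
  qed
  show ?thesis using that[OF df] rec all sm by blast
qed

subsection \<open>Levels of the cumulative hierarchy\<close>

text \<open>Button's level theory: \<open>lev s\<close> says that \<open>s\<close> is some \<open>V\<^sub>\<alpha>\<close>. Its elementary theory needs neither ordinals nor
  recursion.\<close>

definition hist :: "'a \<Rightarrow> bool" where
  "hist h \<longleftrightarrow> (\<forall>x. x \<epsilon> h \<longrightarrow> (\<forall>z. z \<epsilon> x \<longleftrightarrow> (\<exists>c. c \<epsilon> x \<and> c \<epsilon> h \<and> sub z c)))"

definition lev :: "'a \<Rightarrow> bool" where
  "lev s \<longleftrightarrow> (\<exists>h. hist h \<and> (\<forall>z. z \<epsilon> s \<longleftrightarrow> (\<exists>c. c \<epsilon> h \<and> sub z c)))"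

lemma dfb_hist [dfb_rules]: "dft x A t \<Longrightarrow> dfb x A (\<lambda>e. hist (t e))"
  by (rule dfb_sub1) (unfold hist_def, intro dfb_rules)

lemma dfb_lev [dfb_rules]: "dft x A t \<Longrightarrow> dfb x A (\<lambda>e. lev (t e))"
  by (rule dfb_sub1) (unfold lev_def, intro dfb_rules)

lemma sub_trans: "sub x y \<Longrightarrow> sub y z \<Longrightarrow> sub x z"
  by (simp add: sub_def)

lemma subD: "sub x y \<Longrightarrow> z \<epsilon> x \<Longrightarrow> z \<epsilon> y"
  by (simp add: sub_def)

lemma hist_mem: "hist h \<Longrightarrow> x \<epsilon> h \<Longrightarrow> z \<epsilon> x \<longleftrightarrow> (\<exists>c. c \<epsilon> x \<and> c \<epsilon> h \<and> sub z c)"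
  unfolding hist_def by blast

text \<open>Let \<open>m\<close> be an \<open>E\<close>-minimal member of \<open>h\<close> that is
  not transitive, with \<open>u\<close> in \<open>m\<close> and \<open>v\<close> in
  \<open>u\<close>. Then \<open>u\<close> is included in some \<open>b\<close> from \<open>m\<close>
  and \<open>h\<close>, which is transitive, so \<open>v\<close> is included in \<open>b\<close> and
  hence lies in \<open>m\<close>.\<close>

lemma hist_trans:
  assumes h: "hist h" "c \<epsilon> h" "y \<epsilon> c" "z \<epsilon> y"
  shows "z \<epsilon> c"
proof (rule ccontr)
  assume nz: "\<not> z \<epsilon> c"
  have "dprd (\<lambda>c. \<exists>y z. y \<epsilon> c \<and> z \<epsilon> y \<and> \<not> z \<epsilon> c)" by (intro dfb_rules)
  from separation[OF this, of h]
  obtain B where B: "\<And>c. c \<epsilon> B \<longleftrightarrow> c \<epsilon> h \<and> (\<exists>y z. y \<epsilon> c \<and> z \<epsilon> y \<and> \<not> z \<epsilon> c)" by blast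
  have "c \<epsilon> B" using B h(2-4) nz by blast
  from foundation[OF this] obtain m where m: "m \<epsilon> B" and min: "\<And>z. z \<epsilon> m \<Longrightarrow> \<not> z \<epsilon> B" by blast
  obtain u v where uv: "u \<epsilon> m" "v \<epsilon> u" "\<not> v \<epsilon> m" and mh: "m \<epsilon> h" using m B by blast
  obtain b where b: "b \<epsilon> m" "b \<epsilon> h" "sub u b" using hist_mem[OF h(1) mh, of u] uv(1) by blast
  have "sub v b"
  proof -
    have "\<not> b \<epsilon> B" using min[OF b(1)] .
    then have "\<And>y z. y \<epsilon> b \<Longrightarrow> z \<epsilon> y \<Longrightarrow> z \<epsilon> b" using B b(2) by blast
    moreover have "v \<epsilon> b" using subD[OF b(3) uv(2)] .
    ultimately show ?thesis unfolding sub_def by blast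
  qed
  then have "v \<epsilon> m" using hist_mem[OF h(1) mh, of v] b by blast
  then show False using uv(3) by simp
qed

lemma lev_pot:
  assumes "lev s" "y \<epsilon> s" "sub x y"
  shows "x \<epsilon> s"
proof -
  obtain h where h: "\<And>z. z \<epsilon> s \<longleftrightarrow> (\<exists>c. c \<epsilon> h \<and> sub z c)" using assms(1) unfolding lev_def by blast
  then obtain c where "c \<epsilon> h" "sub y c" using assms(2) by blast
  then show ?thesis using h sub_trans[OF assms(3)] by blast
qed

lemma lev_trans:
  assumes "lev s" "y \<epsilon> s" "z \<epsilon> y"
  shows "z \<epsilon> s"
proof -
  obtain h where h: "hist h" "\<And>z. z \<epsilon> s \<longleftrightarrow> (\<exists>c. c \<epsilon> h \<and> sub z c)" using assms(1) unfolding lev_def by blast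
  then obtain c where c: "c \<epsilon> h" "sub y c" using assms(2) by blast
  then have "z \<epsilon> c" using subD assms(3) by blast
  then obtain b where "b \<epsilon> h" "sub z b" using hist_mem[OF h(1) c(1)] by blast
  then show ?thesis using h(2) by blast
qed

lemma lev_mem_sub: "lev s \<Longrightarrow> y \<epsilon> s \<Longrightarrow> sub y s"
  unfolding sub_def using lev_trans by blast

text \<open>The intersection of \<open>c\<close> with \<open>h\<close> is a history for
  \<open>c\<close>. Transitivity of \<open>c\<close> ensures that its members see the same part of
  \<open>h\<close>.\<close>

lemma hist_mem_lev:
  assumes h: "hist h" and c: "c \<epsilon> h"
  shows "lev c"
proof -
  have "dprd (\<lambda>x. x \<epsilon> h)" by (intro dfb_rules UNIV_I)
  from separation[OF this, of c] obtain k where k: "\<And>x. x \<epsilon> k \<longleftrightarrow> x \<epsilon> c \<and> x \<epsilon> h" by blast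
  have "hist k"
    unfolding hist_def
  proof (intro allI impI)
    fix x z assume x: "x \<epsilon> k"
    then have "b \<epsilon> k \<longleftrightarrow> b \<epsilon> h" if "b \<epsilon> x" for b
      using k hist_trans[OF h c] that by blast
    then show "z \<epsilon> x \<longleftrightarrow> (\<exists>b. b \<epsilon> x \<and> b \<epsilon> k \<and> sub z b)"
      using hist_mem[OF h, of x z] x k by blast
  qed
  moreover have "z \<epsilon> c \<longleftrightarrow> (\<exists>b. b \<epsilon> k \<and> sub z b)" for z
    using hist_mem[OF h c, of z] k by blast
  ultimately show ?thesis unfolding lev_def by blast
qed

lemma lev_mem_iff:
  assumes "lev s"
  shows "z \<epsilon> s \<longleftrightarrow> (\<exists>r. lev r \<and> r \<epsilon> s \<and> sub z r)"
proof
  obtain h where h: "hist h" "\<And>z. z \<epsilon> s \<longleftrightarrow> (\<exists>c. c \<epsilon> h \<and> sub z c)" using assms(1) unfolding lev_def by blast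
  assume "z \<epsilon> s"
  then obtain c where c: "c \<epsilon> h" "sub z c" using h(2) by blast
  moreover have "c \<epsilon> s" using h(2) c(1) sub_refl by blast
  ultimately show "\<exists>r. lev r \<and> r \<epsilon> s \<and> sub z r" using hist_mem_lev[OF h(1)] by blast
qed (use lev_pot[OF assms] in blast)

text \<open>Foundation speaks about sets, while \<open>C\<close> is a class. Since \<open>s\<close>
  is transitive, it is enough to minimize among the members of \<open>s\<close>.\<close>

lemma lev_min:
  assumes C: "dprd C" and s: "lev s" "C s"
  obtains t where "lev t" "C t" "\<And>r. lev r \<Longrightarrow> r \<epsilon> t \<Longrightarrow> \<not> C r"
proof (cases "\<exists>r. lev r \<and> r \<epsilon> s \<and> C r")
  case True
  then obtain r where r: "lev r" "r \<epsilon> s" "C r" by blast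
  have "dprd (\<lambda>r. lev r \<and> C r)" by (intro dfb_rules C)
  from separation[OF this, of s] obtain B where B: "\<And>r. r \<epsilon> B \<longleftrightarrow> r \<epsilon> s \<and> lev r \<and> C r" by blast
  have "r \<epsilon> B" using B r by blast
  from foundation[OF this] obtain m where m: "m \<epsilon> B" "\<And>z. z \<epsilon> m \<Longrightarrow> \<not> z \<epsilon> B" by blast
  have "\<not> C q" if "lev q" "q \<epsilon> m" for q
    using m that B lev_trans[OF s(1)] by blast
  then show ?thesis using that[of m] m(1) B by blast
next
  case False
  then show ?thesis using that[of s] s by blast
qed

text \<open>Take a minimal \<open>s'\<close> that is incomparable with some level, then a minimal
  \<open>t'\<close> incomparable with \<open>s'\<close>. Their member levels are comparable with the
  other side, which forces \<open>s'\<close> and \<open>t'\<close> to have the same members.\<close>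

lemma lev_linear:
  assumes "lev s" "lev t"
  shows "s \<epsilon> t \<or> s = t \<or> t \<epsilon> s"
proof (rule ccontr)
  let ?inc = "\<lambda>s t. \<not> (s \<epsilon> t \<or> s = t \<or> t \<epsilon> s)"
  assume "?inc s t"
  moreover have "dprd (\<lambda>s. \<exists>t. lev t \<and> ?inc s t)" by (intro dfb_rules)
  ultimately obtain s' where s': "lev s'" "\<exists>t. lev t \<and> ?inc s' t"
    and mins: "\<And>r. lev r \<Longrightarrow> r \<epsilon> s' \<Longrightarrow> \<not> (\<exists>t. lev t \<and> ?inc r t)"
    using lev_min[of "\<lambda>s. \<exists>t. lev t \<and> ?inc s t" s] assms by blast
  have "dprd (\<lambda>t. ?inc s' t)" by (intro dfb_rules UNIV_I)
  moreover obtain t0 where "lev t0" "?inc s' t0" using s'(2) by blast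
  ultimately obtain t' where t': "lev t'" "?inc s' t'"
    and mint: "\<And>r. lev r \<Longrightarrow> r \<epsilon> t' \<Longrightarrow> \<not> ?inc s' r"
    using lev_min[of "\<lambda>t. ?inc s' t" t0] by blast
  have "s' = t'"
  proof (rule extensionality)
    fix x
    show "x \<epsilon> s' \<longleftrightarrow> x \<epsilon> t'"
    proof
      assume "x \<epsilon> s'"
      then obtain r where r: "lev r" "r \<epsilon> s'" "sub x r" using lev_mem_iff[OF s'(1)] by blast
      then have "r \<epsilon> t' \<or> r = t' \<or> t' \<epsilon> r" using mins t'(1) by blast
      then have "r \<epsilon> t'" using r(2) t'(2) lev_trans[OF s'(1) r(2)] by blast
      then show "x \<epsilon> t'" using lev_pot[OF t'(1)] r(3) by blast
    next
      assume "x \<epsilon> t'"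
      then obtain r where r: "lev r" "r \<epsilon> t'" "sub x r" using lev_mem_iff[OF t'(1)] by blast
      then have "s' \<epsilon> r \<or> s' = r \<or> r \<epsilon> s'" using mint by blast
      then have "r \<epsilon> s'" using r(2) t'(2) lev_trans[OF t'(1) r(2)] by blast
      then show "x \<epsilon> s'" using lev_pot[OF s'(1)] r(3) by blast
    qed
  qed
  then show False using t'(2) by blast
qed

lemma lev_max:
  assumes "lev s" "lev t"
  obtains u where "lev u" "u = s \<or> u = t" "sub s u" "sub t u"
  using lev_linear[OF assms] lev_mem_sub sub_refl assms by metis

text \<open>The levels that belong to \<open>L\<close> or to a member of \<open>L\<close> form a
  history, because a level consists of the subsets of its member levels.\<close>

lemma lev_sup:
  assumes "\<And>l. l \<epsilon> L \<Longrightarrow> lev l"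
  obtains s where "lev s" "\<And>l. l \<epsilon> L \<Longrightarrow> l \<epsilon> s"
proof -
  have "dprd (\<lambda>r. lev r \<and> (r \<epsilon> L \<or> r \<epsilon> un L))" by (intro dfb_rules UNIV_I)
  from separation[OF this, of "cup L (un L)"]
  obtain h where h: "\<And>r. r \<epsilon> h \<longleftrightarrow> lev r \<and> (r \<epsilon> L \<or> r \<epsilon> un L)" by auto
  have "hist h"
    unfolding hist_def
  proof (intro allI impI)
    fix r z assume r: "r \<epsilon> h"
    have "q \<epsilon> h" if q: "lev q" "q \<epsilon> r" for q
    proof (cases "r \<epsilon> L")
      case True
      then have "q \<epsilon> un L" using q(2) by auto
      then show ?thesis using h q(1) by blast
    next
      case False
      then obtain l where "l \<epsilon> L" "r \<epsilon> l" using r h by auto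
      then have "q \<epsilon> un L" using lev_trans[OF assms, of l r q] q(2) by auto
      then show ?thesis using h q(1) by blast
    qed
    then show "z \<epsilon> r \<longleftrightarrow> (\<exists>c. c \<epsilon> r \<and> c \<epsilon> h \<and> sub z c)"
      using lev_mem_iff[of r z] r h by blast
  qed
  have "dprd (\<lambda>z. \<exists>c. c \<epsilon> h \<and> sub z c)" by (intro dfb_rules UNIV_I)
  from separation[OF this, of "pow (un h)"]
  obtain s where s: "\<And>z. z \<epsilon> s \<longleftrightarrow> z \<epsilon> pow (un h) \<and> (\<exists>c. c \<epsilon> h \<and> sub z c)" by blast
  have s_iff: "z \<epsilon> s \<longleftrightarrow> (\<exists>c. c \<epsilon> h \<and> sub z c)" for z
    unfolding s by (auto simp: sub_def)
  show ?thesis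
  proof (rule that)
    show "lev s" unfolding lev_def using \<open>hist h\<close> s_iff by blast
    show "l \<epsilon> s" if "l \<epsilon> L" for l
      unfolding s_iff using h assms[OF that] that sub_refl by blast
  qed
qed

lemma lev_next:
  assumes "lev s"
  obtains t where "lev t" "s \<epsilon> t"
  using lev_sup[of "upair s s"] assms by auto

text \<open>Scott's trick: choosing the least suitable level makes the relation functional, so
  Replacement yields Collection, and a single level bounds the result.\<close>

lemma lev_collection:
  assumes Q: "drel Q" and ex: "\<And>x. x \<epsilon> A \<Longrightarrow> \<exists>s. lev s \<and> Q x s"
  obtains s where "lev s" "\<And>x. x \<epsilon> A \<Longrightarrow> \<exists>t. lev t \<and> t \<epsilon> s \<and> Q x t"
proof -
  let ?least = "\<lambda>x s. lev s \<and> Q x s \<and> (\<forall>t. lev t \<and> Q x t \<longrightarrow> s = t \<or> s \<epsilon> t)"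
  have "drel ?least" by (intro dfb_rules dfb_sub2[OF Q])
  moreover have "\<exists>!s. ?least x s" if x: "x \<epsilon> A" for x
  proof -
    obtain s0 where "lev s0" "Q x s0" using ex[OF x] by blast
    moreover have "dprd (\<lambda>s. Q x s)" by (rule dfb_sub2[OF Q]) (intro dfb_rules UNIV_I)+
    ultimately obtain s where s: "lev s" "Q x s" "\<And>r. lev r \<Longrightarrow> r \<epsilon> s \<Longrightarrow> \<not> Q x r"
      using lev_min[of "\<lambda>s. Q x s" s0] by blast
    have "?least x s" using s lev_linear by blast
    moreover have "s' = s" if "?least x s'" for s'
      using that \<open>?least x s\<close> not_mem_cycle by blast
    ultimately show ?thesis by (rule ex1I[of _ s])
  qed
  ultimately obtain B where B: "\<And>x. x \<epsilon> A \<Longrightarrow> \<exists>s. s \<epsilon> B \<and> ?least x s"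
    using replacement[of ?least A] by blast
  have "dprd lev" by (intro dfb_rules)
  from separation[OF this, of B] obtain L where L: "\<And>l. l \<epsilon> L \<longleftrightarrow> l \<epsilon> B \<and> lev l" by blast
  obtain s where s: "lev s" "\<And>l. l \<epsilon> L \<Longrightarrow> l \<epsilon> s"
    using lev_sup[of L] L by blast
  have "\<exists>t. lev t \<and> t \<epsilon> s \<and> Q x t" if "x \<epsilon> A" for x
    using B[OF that] L s(2) by blast
  then show ?thesis using that s(1) by blast
qed

lemma lev_of_members:
  assumes "\<And>y. y \<epsilon> x \<Longrightarrow> \<exists>s. lev s \<and> y \<epsilon> s"
  shows "\<exists>s. lev s \<and> x \<epsilon> s"
proof -
  have "drel (\<lambda>y s. y \<epsilon> s)" by (intro dfb_rules)
  then obtain s where s: "lev s" "\<And>y. y \<epsilon> x \<Longrightarrow> \<exists>t. lev t \<and> t \<epsilon> s \<and> y \<epsilon> t"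
    using lev_collection[of "\<lambda>y s. y \<epsilon> s" x] assms by blast
  then have "sub x s" using lev_trans[OF s(1)] unfolding sub_def by blast
  moreover obtain t where "lev t" "s \<epsilon> t" using lev_next[OF s(1)] by blast
  ultimately show ?thesis using lev_pot by blast
qed

lemma mem_wf_on: "\<forall>B. (\<exists>x. x \<epsilon> B) \<and> sub B d \<longrightarrow> (\<exists>m. m \<epsilon> B \<and> (\<forall>x. x \<epsilon> B \<longrightarrow> \<not> x \<epsilon> m))"
  using foundation by blast

lemma ex_transitive_superset:
  obtains T where "x \<epsilon> T" "\<And>y z. y \<epsilon> T \<Longrightarrow> z \<epsilon> y \<Longrightarrow> z \<epsilon> T"
proof -
  \<comment> \<open>\<open>Y\<close> is the set of earlier stages, so \<open>un Y\<close> is their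
    union and \<open>un (un Y)\<close> collects the members of its members. Drawing on all earlier
    stages spares a case distinction between zero and successors.\<close>
  let ?H = "\<lambda>Y. cup (upair x x) (un (un Y))"
  have H: "dfun ?H" by (intro dfb_rules UNIV_I)
  have R: "drel (\<lambda>b c. b \<epsilon> c)" by (intro dfb_rules)
  obtain f where f: "dfun f" "\<forall>c. c \<epsilon> om \<longrightarrow> f c = ?H (setof (\<lambda>z. \<exists>b. b \<epsilon> om \<and> b \<epsilon> c \<and> z = f b))"
    "\<forall>c. small (\<lambda>z. \<exists>b. b \<epsilon> om \<and> b \<epsilon> c \<and> z = f b)"
    by (rule wf_recursion[OF H R mem_wf_on])
  have mem_f: "z \<epsilon> f c \<longleftrightarrow> z = x \<or> (\<exists>b y. b \<epsilon> om \<and> b \<epsilon> c \<and> y \<epsilon> f b \<and> z \<epsilon> y)" if "c \<epsilon> om" for c z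
    unfolding f(2)[rule_format, OF that] mem_cup mem_upair mem_un mem_setof[OF f(3)[rule_format]] by blast
  obtain F where F: "\<And>z. z \<epsilon> F \<longleftrightarrow> (\<exists>n. n \<epsilon> om \<and> z = f n)"
    using small_image[OF f(1) small_mem[of om]] unfolding small_def by blast
  show ?thesis
  proof (rule that[of "un F"])
    show "x \<epsilon> un F" using F emp_om mem_f by auto
    fix y z assume "y \<epsilon> un F" "z \<epsilon> y"
    then obtain n where n: "n \<epsilon> om" "y \<epsilon> f n" using F by auto
    then have "z \<epsilon> f (suc n)" using mem_f[OF suc_om[OF n(1)], of z] \<open>z \<epsilon> y\<close> by auto
    then show "z \<epsilon> un F" using F suc_om[OF n(1)] by auto
  qed
qed

text \<open>Among the sets without a level inside a transitive set around \<open>x\<close>, a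
  minimal one would have all its members in levels, and then \<open>lev_of_members\<close> gives it
  a level too.\<close>

lemma ex_lev: "\<exists>s. lev s \<and> x \<epsilon> s"
proof (rule ccontr)
  assume x: "\<not> ?thesis"
  obtain T where T: "x \<epsilon> T" "\<And>y z. y \<epsilon> T \<Longrightarrow> z \<epsilon> y \<Longrightarrow> z \<epsilon> T"
    using ex_transitive_superset by blast
  have "dprd (\<lambda>z. \<not> (\<exists>s. lev s \<and> z \<epsilon> s))" by (intro dfb_rules)
  from separation[OF this, of T] obtain B where B: "\<And>z. z \<epsilon> B \<longleftrightarrow> z \<epsilon> T \<and> \<not> (\<exists>s. lev s \<and> z \<epsilon> s)" by blast
  have "x \<epsilon> B" using B x T(1) by blast
  from foundation[OF this] obtain m where m: "m \<epsilon> B" "\<And>z. z \<epsilon> m \<Longrightarrow> \<not> z \<epsilon> B" by blast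
  have "\<exists>s. lev s \<and> m \<epsilon> s"
    by (rule lev_of_members) (use m B T(2) in blast)
  then show False using m(1) B by blast
qed

subsection \<open>Reflection\<close>

lemma dft_shift: "dft x A t \<Longrightarrow> dft x A (\<lambda>e. t (\<lambda>k. e (Suc k)))"
  unfolding dft_def
  by (drule dfb_ren[where f = "0 ## (\<lambda>k. k + 2)"]) (simp add: scons_def)

text \<open>Satisfaction relativized to a set is definable again, internally for internal formulas.
  This is what makes the schemes of the ambient model applicable to formulas interpreted in
  \<open>W\<close>.\<close>

lemma dfb_sat_dom:
  assumes "x \<or> internal p" "dft x A w" "\<And>k. dft x A (\<tau> k)"
  shows "dfb x A (\<lambda>e. sat {z. z \<epsilon> w e} E st (\<lambda>k. \<tau> k e) p)"
  using assms
proof (induction p arbitrary: w \<tau>)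
  case (St a)
  then have x by simp
  then show ?case using dfb_st St.prems by simp
next
  case (All v p)
  let ?\<tau> = "\<lambda>k. if k = v then (\<lambda>e. e 0) else (\<lambda>e. \<tau> k (\<lambda>k. e (Suc k)))"
  have "dft x A (?\<tau> k)" for k
    using All.prems(3) dft_shift dft_proj by auto
  then have "dfb x A (\<lambda>e. sat {z. z \<epsilon> w (\<lambda>k. e (Suc k))} E st (\<lambda>k. ?\<tau> k e) p)"
    using All.prems by (intro All.IH dft_shift) auto
  moreover have "(\<lambda>k. ?\<tau> k e) = (\<lambda>k. \<tau> k (\<lambda>k. e (Suc k)))(v := e 0)" for e
    by auto
  ultimately have "dfb x A (\<lambda>e. sat {z. z \<epsilon> w (\<lambda>k. e (Suc k))} E st ((\<lambda>k. \<tau> k (\<lambda>k. e (Suc k)))(v := e 0)) p)"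
    by simp
  then have "dfb x A (\<lambda>e. \<forall>a. a \<epsilon> w e \<longrightarrow> sat {z. z \<epsilon> w e} E st ((\<lambda>k. \<tau> k e)(v := a)) p)"
    by (intro dfb_rules dft_shift All.prems)
  then show ?case by simp
qed (auto intro!: dfb_rules)

lemma dfb_sat:
  assumes "x \<or> internal p" "\<And>k. dft x A (\<tau> k)"
  shows "dfb x A (\<lambda>e. sat UNIV E st (\<lambda>k. \<tau> k e) p)"
  using assms
proof (induction p arbitrary: \<tau>)
  case (St a)
  then have x by simp
  then show ?case using dfb_st St.prems by simp
next
  case (All v p)
  let ?\<tau> = "\<lambda>k. if k = v then (\<lambda>e. e 0) else (\<lambda>e. \<tau> k (\<lambda>k. e (Suc k)))"
  have "dft x A (?\<tau> k)" for k
    using All.prems(2) dft_shift dft_proj by auto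
  then have "dfb x A (\<lambda>e. sat UNIV E st (\<lambda>k. ?\<tau> k e) p)"
    using All.prems by (intro All.IH) auto
  moreover have "(\<lambda>k. ?\<tau> k e) = (\<lambda>k. \<tau> k (\<lambda>k. e (Suc k)))(v := e 0)" for e
    by auto
  ultimately have "dfb x A (\<lambda>e. sat UNIV E st ((\<lambda>k. \<tau> k (\<lambda>k. e (Suc k)))(v := e 0)) p)"
    by simp
  then have "dfb x A (\<lambda>e. \<forall>a. sat UNIV E st ((\<lambda>k. \<tau> k e)(v := a)) p)"
    by (intro dfb_rules)
  then show ?case by simp
qed (auto intro!: dfb_rules)

text \<open>Quantification over all assignments in \<open>X\<close> is not first order, but quantification over the values of the
  first \<open>n\<close> variables is.\<close>

fun allin :: "'a \<Rightarrow> nat \<Rightarrow> ((nat \<Rightarrow> 'a) \<Rightarrow> bool) \<Rightarrow> (nat \<Rightarrow> 'a) \<Rightarrow> bool" where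
  "allin X 0 P e = P e"
| "allin X (Suc n) P e = (\<forall>a. a \<epsilon> X \<longrightarrow> allin X n P (e(n := a)))"

lemma allin_iff:
  "allin X n P e0 \<longleftrightarrow> (\<forall>e. (\<forall>k<n. e k \<epsilon> X) \<and> (\<forall>k\<ge>n. e k = e0 k) \<longrightarrow> P e)"
proof (induction n arbitrary: e0)
  case 0
  have "(\<forall>k. e k = e0 k) \<longleftrightarrow> e = e0" for e by auto
  then show ?case by simp
next
  case (Suc n)
  show ?case
  proof
    assume *: "allin X (Suc n) P e0"
    show "\<forall>e. (\<forall>k<Suc n. e k \<epsilon> X) \<and> (\<forall>k\<ge>Suc n. e k = e0 k) \<longrightarrow> P e"
    proof (intro allI impI)
      fix e assume e: "(\<forall>k<Suc n. e k \<epsilon> X) \<and> (\<forall>k\<ge>Suc n. e k = e0 k)"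
      then have "allin X n P (e0(n := e n))" using * by simp
      then have "(\<forall>k<n. e k \<epsilon> X) \<and> (\<forall>k\<ge>n. e k = (e0(n := e n)) k) \<longrightarrow> P e"
        unfolding Suc by (rule spec)
      moreover have "\<forall>k\<ge>n. e k = (e0(n := e n)) k" using e by (simp add: Suc_le_eq)
      moreover have "\<forall>k<n. e k \<epsilon> X" using e by (simp add: less_Suc_eq)
      ultimately show "P e" by blast
    qed
  next
    assume *: "\<forall>e. (\<forall>k<Suc n. e k \<epsilon> X) \<and> (\<forall>k\<ge>Suc n. e k = e0 k) \<longrightarrow> P e"
    have "allin X n P (e0(n := a))" if "a \<epsilon> X" for a
      unfolding Suc
    proof (intro allI impI)
      fix e assume e: "(\<forall>k<n. e k \<epsilon> X) \<and> (\<forall>k\<ge>n. e k = (e0(n := a)) k)"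
      then have "e n = a" by simp
      then have "\<forall>k<Suc n. e k \<epsilon> X" using e that by (auto simp: less_Suc_eq)
      moreover have "\<forall>k\<ge>Suc n. e k = e0 k" using e by auto
      ultimately show "P e" using * by blast
    qed
    then show "allin X (Suc n) P e0" by simp
  qed
qed

text \<open>The induction replaces an entry of the assignment by a bound variable, so the hypothesis
  on \<open>P\<close> must cover all families of definable terms.\<close>

lemma dfb_allin:
  assumes P: "\<And>\<tau> \<sigma>. (\<And>k. dft x A (\<tau> k)) \<Longrightarrow> dft x A \<sigma> \<Longrightarrow> dfb x A (\<lambda>e. P (\<lambda>k. \<tau> k e) (\<sigma> e))"
    and "dft x A \<xi>" "dft x A \<sigma>" "\<And>k. dft x A (\<tau> k)"
  shows "dfb x A (\<lambda>e. allin (\<xi> e) n (\<lambda>f. P f (\<sigma> e)) (\<lambda>k. \<tau> k e))"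
  using assms(2-)
proof (induction n arbitrary: \<xi> \<sigma> \<tau>)
  case (Suc n)
  let ?\<tau> = "\<lambda>k. if k = n then (\<lambda>e. e 0) else (\<lambda>e. \<tau> k (\<lambda>k. e (Suc k)))"
  have "dft x A (?\<tau> k)" for k
    using Suc.prems(3) dft_shift dft_proj by auto
  then have "dfb x A (\<lambda>e. allin (\<xi> (\<lambda>k. e (Suc k))) n (\<lambda>f. P f (\<sigma> (\<lambda>k. e (Suc k)))) (\<lambda>k. ?\<tau> k e))"
    using Suc.prems by (intro Suc.IH dft_shift) auto
  moreover have "(\<lambda>k. ?\<tau> k e) = (\<lambda>k. \<tau> k (\<lambda>k. e (Suc k)))(n := e 0)" for e
    by auto
  ultimately have "dfb x A (\<lambda>e. allin (\<xi> (\<lambda>k. e (Suc k))) n (\<lambda>f. P f (\<sigma> (\<lambda>k. e (Suc k))))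
      ((\<lambda>k. \<tau> k (\<lambda>k. e (Suc k)))(n := e 0)))"
    by simp
  then have "dfb x A (\<lambda>e. \<forall>a. a \<epsilon> \<xi> e \<longrightarrow> allin (\<xi> e) n (\<lambda>f. P f (\<sigma> e)) ((\<lambda>k. \<tau> k e)(n := a)))"
    by (intro dfb_rules dft_shift Suc.prems)
  then show ?case by simp
qed (simp add: P)

definition wit :: "nat \<Rightarrow> fm \<Rightarrow> (nat \<Rightarrow> 'a) \<Rightarrow> 'a \<Rightarrow> bool" where
  "wit x p e s \<longleftrightarrow> ((\<exists>y. \<not> sat UNIV E st (e(x := y)) p) \<longrightarrow> (\<exists>y. y \<epsilon> s \<and> \<not> sat UNIV E st (e(x := y)) p))"

text \<open>Tarski-Vaught closure in two-set form: for each universal subformula and assignment from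
  \<open>X\<close>, the set \<open>s\<close> has a counterexample if there is any. With two sets the
  condition can be met step by step along a chain; \<open>s = X\<close> gives reflection. Variables
  from \<open>n\<close> on receive the dummy value \<open>X\<close>.\<close>

fun wcl :: "nat \<Rightarrow> 'a \<Rightarrow> 'a \<Rightarrow> fm \<Rightarrow> bool" where
  "wcl n X s (Imp p q) = (wcl n X s p \<and> wcl n X s q)"
| "wcl n X s (All x p) = (wcl n X s p \<and> allin X n (\<lambda>e. wit x p e s) (\<lambda>_. X))"
| "wcl n X s _ = True"

lemma dfb_wit:
  assumes "internal p" "\<And>k. dft x A (\<tau> k)" "dft x A \<sigma>"
  shows "dfb x A (\<lambda>e. wit v p (\<lambda>k. \<tau> k e) (\<sigma> e))"
proof -
  let ?\<tau> = "\<lambda>k. if k = v then (\<lambda>e. e 0) else (\<lambda>e. \<tau> k (\<lambda>k. e (Suc k)))"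
  have "dft x A (?\<tau> k)" for k
    using assms(2) dft_shift dft_proj by auto
  then have "dfb x A (\<lambda>e. sat UNIV E st (\<lambda>k. ?\<tau> k e) p)"
    using assms by (intro dfb_sat) auto
  moreover have "(\<lambda>k. ?\<tau> k e) = (\<lambda>k. \<tau> k (\<lambda>k. e (Suc k)))(v := e 0)" for e
    by auto
  ultimately have "dfb x A (\<lambda>e. sat UNIV E st ((\<lambda>k. \<tau> k (\<lambda>k. e (Suc k)))(v := e 0)) p)"
    by simp
  then show ?thesis
    unfolding wit_def by (intro dfb_rules dft_shift assms)
qed

lemma dfb_wcl:
  assumes "internal p" "dft x A \<xi>" "dft x A \<sigma>"
  shows "dfb x A (\<lambda>e. wcl n (\<xi> e) (\<sigma> e) p)"
  using assms
proof (induction p)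
  case (Imp p q)
  then show ?case using dfb_and[OF Imp.IH(1) Imp.IH(2)] by simp
next
  case (All v p)
  have "dfb x A (\<lambda>e. allin (\<xi> e) n (\<lambda>f. wit v p f (\<sigma> e)) (\<lambda>k. \<xi> e))"
    using All.prems by (intro dfb_allin dfb_wit) auto
  then show ?case using dfb_and[OF All.IH] All.prems by simp
qed (simp_all add: dfb_const)

lemma wit_mono: "sub s t \<Longrightarrow> wit x p e s \<Longrightarrow> wit x p e t"
  unfolding wit_def sub_def by blast

lemma allin_mono: "(\<And>e. P e \<Longrightarrow> Q e) \<Longrightarrow> allin X n P e \<Longrightarrow> allin X n Q e"
  unfolding allin_iff by blast

lemma wcl_mono: "sub s t \<Longrightarrow> wcl n X s p \<Longrightarrow> wcl n X t p"
proof (induction p)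
  case (All x p)
  have "allin X n (\<lambda>e. wit x p e t) (\<lambda>_. X)"
    by (rule allin_mono[of "\<lambda>e. wit x p e s"]) (use All.prems wit_mono in auto)
  then show ?case using All by simp
qed simp_all

text \<open>The values of the variables are collected one at a time, each by one application of
  Collection for levels.\<close>

lemma ex_allin_wit:
  assumes "internal p"
  shows "\<exists>s. lev s \<and> allin X n (\<lambda>e. wit x p e s) e0"
proof (induction n arbitrary: e0)
  case 0
  show ?case
  proof (cases "\<exists>y. \<not> sat UNIV E st (e0(x := y)) p")
    case True
    then obtain y where "\<not> sat UNIV E st (e0(x := y)) p" by blast
    moreover obtain s where "lev s" "y \<epsilon> s" using ex_lev by blast
    ultimately show ?thesis unfolding wit_def allin.simps by blast
  next
    case False
    then show ?thesis unfolding wit_def allin.simps using ex_lev by blast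
  qed
next
  case (Suc n)
  have "dfb False UNIV (\<lambda>e. allin X n (\<lambda>f. wit x p f (e 1)) (\<lambda>k. (if k = n then (\<lambda>e. e 0) else (\<lambda>_. e0 k)) e))"
    by (intro dfb_allin dfb_wit assms dft_proj dft_const UNIV_I) (auto intro: dft_proj dft_const)
  moreover have "(\<lambda>k. (if k = n then (\<lambda>e. e 0) else (\<lambda>_. e0 k)) e) = e0(n := e 0)" for e :: "nat \<Rightarrow> 'a"
    by auto
  ultimately have "drel (\<lambda>a s. allin X n (\<lambda>f. wit x p f s) (e0(n := a)))"
    by simp
  from lev_collection[OF this, of X] Suc
  obtain s where s: "lev s" "\<And>a. a \<epsilon> X \<Longrightarrow> \<exists>t. lev t \<and> t \<epsilon> s \<and> allin X n (\<lambda>f. wit x p f t) (e0(n := a))"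
    by blast
  have "allin X n (\<lambda>f. wit x p f s) (e0(n := a))" if a: "a \<epsilon> X" for a
  proof -
    obtain t where t: "t \<epsilon> s" "allin X n (\<lambda>f. wit x p f t) (e0(n := a))" using s(2)[OF a] by blast
    show ?thesis
      by (rule allin_mono[OF wit_mono[OF lev_mem_sub[OF s(1) t(1)]] t(2)])
  qed
  then show ?case using s(1) by auto
qed

lemma ex_wcl: "internal p \<Longrightarrow> \<exists>s. lev s \<and> wcl n X s p"
proof (induction p)
  case (Imp p q)
  then obtain s t where st: "lev s" "wcl n X s p" "lev t" "wcl n X t q" by auto
  obtain u where "lev u" "sub s u" "sub t u" using lev_max[OF st(1,3)] by blast
  then show ?case using st wcl_mono by auto
next
  case (All x p)
  then obtain s where s: "lev s" "wcl n X s p" by auto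
  obtain t where t: "lev t" "allin X n (\<lambda>e. wit x p e t) (\<lambda>_. X)"
    using ex_allin_wit[of p X n x "\<lambda>_. X"] All.prems by auto
  obtain u where u: "lev u" "sub s u" "sub t u" using lev_max[OF s(1) t(1)] by blast
  have "allin X n (\<lambda>e. wit x p e u) (\<lambda>_. X)"
    by (rule allin_mono[OF _ t(2)]) (rule wit_mono[OF u(3)])
  then show ?case using u s wcl_mono by auto
qed (use ex_lev in auto)

text \<open>The Tarski-Vaught test. In the quantifier case the assignment is altered beyond
  \<open>n\<close> to fit the dummy value used by \<open>wcl\<close>; these variables do not occur
  in \<open>p\<close>.\<close>

lemma wcl_reflects:
  assumes "wcl n W W p" "vars p \<subseteq> {..<n}" "\<And>k. k < n \<Longrightarrow> e k \<epsilon> W"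
  shows "sat {z. z \<epsilon> W} E st e p \<longleftrightarrow> sat UNIV E st e p"
  using assms
proof (induction p arbitrary: e)
  case (Imp p q)
  have "sat {z. z \<epsilon> W} E st e p \<longleftrightarrow> sat UNIV E st e p" "sat {z. z \<epsilon> W} E st e q \<longleftrightarrow> sat UNIV E st e q"
    by (rule Imp.IH; use Imp.prems in auto)+
  then show ?case by simp
next
  case (All x p)
  have IH: "sat {z. z \<epsilon> W} E st (e(x := a)) p \<longleftrightarrow> sat UNIV E st (e(x := a)) p" if "a \<epsilon> W" for a
    by (rule All.IH) (use All.prems that in auto)
  let ?e = "\<lambda>k. if k < n then e k else W"
  have "wit x p ?e W"
    using All.prems(1,3) by (simp add: allin_iff)
  moreover have "sat UNIV E st (?e(x := a)) p \<longleftrightarrow> sat UNIV E st (e(x := a)) p" for a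
    by (rule sat_cong) (use All.prems(2) fv_subset_vars[of p] in auto)
  ultimately have "wit x p e W"
    unfolding wit_def by simp
  then show ?case using IH unfolding wit_def by auto
qed simp_all

text \<open>The least level is taken because it is unique: the next element of a chain is then a
  definable function of the set of earlier ones, and the recursion runs without choice.\<close>

definition isK :: "nat \<Rightarrow> fm \<Rightarrow> 'a \<Rightarrow> 'a \<Rightarrow> bool" where
  "isK n p Y s \<longleftrightarrow> lev s \<and> om \<epsilon> s \<and> (\<forall>X. X \<epsilon> Y \<longrightarrow> X \<epsilon> s \<and> wcl n X s p) \<and>
     (\<forall>t. lev t \<and> om \<epsilon> t \<and> (\<forall>X. X \<epsilon> Y \<longrightarrow> X \<epsilon> t \<and> wcl n X t p) \<longrightarrow> s = t \<or> s \<epsilon> t)"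

lemma dfb_isK:
  assumes "internal p" "dft x A t" "dft x A u"
  shows "dfb x A (\<lambda>e. isK n p (t e) (u e))"
  by (rule dfb_sub2[OF _ assms(2,3)]) (unfold isK_def, intro dfb_rules dfb_wcl assms(1))

lemma ex1_isK:
  assumes p: "internal p"
  shows "\<exists>!s. isK n p Y s"
proof -
  let ?P = "\<lambda>s. om \<epsilon> s \<and> (\<forall>X. X \<epsilon> Y \<longrightarrow> X \<epsilon> s \<and> wcl n X s p)"
  have "drel (\<lambda>X s. X \<epsilon> s \<and> wcl n X s p)"
    by (intro dfb_rules dfb_wcl p)
  moreover have "\<exists>s. lev s \<and> X \<epsilon> s \<and> wcl n X s p" for X
  proof -
    obtain s t where st: "lev s" "X \<epsilon> s" "lev t" "wcl n X t p" using ex_lev ex_wcl[OF p] by blast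
    obtain u where "lev u" "sub s u" "sub t u" using lev_max[OF st(1,3)] by blast
    then show ?thesis using st wcl_mono subD by blast
  qed
  ultimately obtain s where s: "lev s" "\<And>X. X \<epsilon> Y \<Longrightarrow> \<exists>t. lev t \<and> t \<epsilon> s \<and> X \<epsilon> t \<and> wcl n X t p"
    using lev_collection[of "\<lambda>X s. X \<epsilon> s \<and> wcl n X s p" Y] by blast
  obtain t where t: "lev t" "om \<epsilon> t" using ex_lev by blast
  obtain u where u: "lev u" "sub s u" "sub t u" using lev_max[OF s(1) t(1)] by blast
  have "X \<epsilon> u \<and> wcl n X u p" if X: "X \<epsilon> Y" for X
  proof -
    obtain v where v: "v \<epsilon> s" "X \<epsilon> v" "wcl n X v p" using s(2)[OF X] by blast
    then have "sub v u" using sub_trans[OF lev_mem_sub[OF s(1)] u(2)] by blast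
    then show ?thesis using v wcl_mono subD by blast
  qed
  then have "?P u" using subD[OF u(3) t(2)] by blast
  moreover have "dprd ?P" by (intro dfb_rules dfb_wcl p UNIV_I)
  ultimately obtain w where w: "lev w" "?P w" "\<And>r. lev r \<Longrightarrow> r \<epsilon> w \<Longrightarrow> \<not> ?P r"
    using lev_min[of ?P u] u(1) by blast
  have "isK n p Y w"
    unfolding isK_def using w lev_linear[OF w(1)] by blast
  moreover have "s' = w" if "isK n p Y s'" for s'
    using that \<open>isK n p Y w\<close> not_mem_cycle unfolding isK_def by blast
  ultimately show ?thesis by (rule ex1I)
qed

definition K :: "nat \<Rightarrow> fm \<Rightarrow> 'a \<Rightarrow> 'a" where
  "K n p Y = (THE s. isK n p Y s)"

lemma isK_K: "internal p \<Longrightarrow> isK n p Y (K n p Y)"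
  unfolding K_def by (rule theI', rule ex1_isK)

lemma dfun_K:
  assumes "internal p"
  shows "dfun (K n p)"
proof -
  have "y = K n p Y \<longleftrightarrow> isK n p Y y" for y Y
    using isK_K[OF assms, of n Y] ex1_isK[OF assms, of n Y] by blast
  then show ?thesis
    using dfb_isK[OF assms dft_proj dft_proj, of False UNIV n 1 0] by simp
qed

lemma K_props:
  assumes "internal p"
  shows "lev (K n p Y)" "om \<epsilon> K n p Y" "X \<epsilon> Y \<Longrightarrow> X \<epsilon> K n p Y" "X \<epsilon> Y \<Longrightarrow> wcl n X (K n p Y) p"
  using isK_K[OF assms, of n Y] unfolding isK_def by blast+

subsection \<open>Reflecting sets of countable and uncountable cofinality\<close>

text \<open>The chain that produces \<open>W\<close> is not mentioned, so this is an internal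
  property of \<open>W\<close> alone and Transfer can supply a standard \<open>W\<close>. The
  directedness clause bounds finite sets; the clause on pairs bounds functions with bounded domain
  and values.\<close>

definition good :: "nat \<Rightarrow> fm \<Rightarrow> 'a \<Rightarrow> bool" where
  "good n p W \<longleftrightarrow> (\<forall>y z. y \<epsilon> W \<and> z \<epsilon> y \<longrightarrow> z \<epsilon> W) \<and> (\<forall>x y. y \<epsilon> W \<and> sub x y \<longrightarrow> x \<epsilon> W) \<and> om \<epsilon> W \<and>
     (\<forall>x y. x \<epsilon> W \<and> y \<epsilon> W \<longrightarrow> (\<exists>z. z \<epsilon> W \<and> sub x z \<and> sub y z \<and> y \<epsilon> z)) \<and>
     (\<forall>x. x \<epsilon> W \<longrightarrow> (\<exists>z. z \<epsilon> W \<and> (\<forall>a b. a \<epsilon> x \<and> b \<epsilon> x \<longrightarrow> opair a b \<epsilon> z))) \<and> wcl n W W p"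

lemma good_trans: "good n p W \<Longrightarrow> y \<epsilon> W \<Longrightarrow> z \<epsilon> y \<Longrightarrow> z \<epsilon> W"
  and good_pot: "good n p W \<Longrightarrow> y \<epsilon> W \<Longrightarrow> sub x y \<Longrightarrow> x \<epsilon> W"
  and good_om: "good n p W \<Longrightarrow> om \<epsilon> W"
  and good_adjoin: "good n p W \<Longrightarrow> x \<epsilon> W \<Longrightarrow> y \<epsilon> W \<Longrightarrow> \<exists>z. z \<epsilon> W \<and> sub x z \<and> sub y z \<and> y \<epsilon> z"
  and good_square: "good n p W \<Longrightarrow> x \<epsilon> W \<Longrightarrow> \<exists>z. z \<epsilon> W \<and> (\<forall>a b. a \<epsilon> x \<and> b \<epsilon> x \<longrightarrow> opair a b \<epsilon> z)"
  and good_wcl: "good n p W \<Longrightarrow> wcl n W W p"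
  unfolding good_def by blast+

lemma good_opair:
  assumes W: "good n p W" and "a \<epsilon> W" "b \<epsilon> W"
  shows "opair a b \<epsilon> W"
proof -
  obtain y where y: "y \<epsilon> W" "a \<epsilon> y" using good_adjoin[OF W good_om[OF W] assms(2)] by blast
  obtain z where z: "z \<epsilon> W" "sub y z" "b \<epsilon> z" using good_adjoin[OF W y(1) assms(3)] by blast
  have "a \<epsilon> z" using subD[OF z(2) y(2)] .
  then obtain v where "v \<epsilon> W" "opair a b \<epsilon> v" using good_square[OF W z(1)] z(3) by blast
  then show ?thesis using good_trans[OF W] by blast
qed

lemma good_opair_parts:
  assumes W: "good n p W" and ab: "opair a b \<epsilon> W"
  shows "a \<epsilon> W" "b \<epsilon> W"
proof -
  have "upair a b \<epsilon> W" using good_trans[OF W ab] by (simp add: opair_def)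
  then show "a \<epsilon> W" "b \<epsilon> W" using good_trans[OF W] by simp_all
qed

lemma dfb_good: "internal p \<Longrightarrow> dft x A t \<Longrightarrow> dfb x A (\<lambda>e. good n p (t e))"
  by (rule dfb_sub1) (unfold good_def, intro dfb_rules dfb_wcl)

lemma chain_finite:
  fixes m :: nat
  assumes "\<And>s. F s \<Longrightarrow> lev s" "F s0"
    and "\<And>k. k < m \<Longrightarrow> \<exists>s. F s \<and> e k \<epsilon> s"
  shows "\<exists>s. F s \<and> (\<forall>k<m. e k \<epsilon> s)"
  using assms(3)
proof (induction m)
  case 0
  then show ?case using assms(2) by blast
next
  case (Suc m)
  then obtain s t where st: "F s" "\<forall>k<m. e k \<epsilon> s" "F t" "e m \<epsilon> t"
    by (metis less_Suc_eq)
  obtain u where u: "u = s \<or> u = t" "sub s u" "sub t u"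
    using lev_max[OF assms(1)[OF st(1)] assms(1)[OF st(3)]] by blast
  then have "F u" "\<forall>k<Suc m. e k \<epsilon> u"
    using st subD by (auto simp: less_Suc_eq)
  then show ?case by blast
qed

text \<open>The finitely many relevant values of an assignment into the union lie in one level
  \<open>s\<close> of the chain, and a later level has the counterexamples for assignments from
  \<open>s\<close>.\<close>

lemma chain_wcl:
  assumes F: "\<And>s. F s \<Longrightarrow> lev s" "F s0" and W: "\<And>z. z \<epsilon> W \<longleftrightarrow> (\<exists>s. F s \<and> z \<epsilon> s)"
    and "vars p \<subseteq> {..<n}" and "\<And>s. F s \<Longrightarrow> \<exists>t. F t \<and> s \<epsilon> t \<and> wcl n s t p"
  shows "wcl n W W p"
  using assms(4,5)
proof (induction p)
  case (Imp p q)
  have "wcl n W W p" by (rule Imp.IH(1)) (use Imp.prems(1) in simp, use Imp.prems(2) in fastforce)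
  moreover have "wcl n W W q" by (rule Imp.IH(2)) (use Imp.prems(1) in simp, use Imp.prems(2) in fastforce)
  ultimately show ?case by simp
next
  case (All x p)
  have "wcl n W W p" by (rule All.IH) (use All.prems(1) in simp, use All.prems(2) in fastforce)
  moreover have "wit x p e W" if e: "\<forall>k<n. e k \<epsilon> W" for e
  proof -
    have "\<exists>s. F s \<and> e k \<epsilon> s" if "k < n" for k
      using e W that by blast
    then obtain s where s: "F s" "\<forall>k<n. e k \<epsilon> s"
      using chain_finite[of F s0 n e] F by blast
    obtain t where t: "F t" "wcl n s t (All x p)" using All.prems(2)[OF s(1)] by blast
    \<comment> \<open>\<open>wcl n s t\<close> gives the variables from \<open>n\<close> on the
      value \<open>s\<close>; none of them occurs in \<open>p\<close>.\<close>
    let ?e = "\<lambda>k. if k < n then e k else s"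
    have "wit x p ?e t"
      using t(2) s(2) by (simp add: allin_iff)
    moreover have "sat UNIV E st (?e(x := a)) p \<longleftrightarrow> sat UNIV E st (e(x := a)) p" for a
      by (rule sat_cong) (use All.prems(1) fv_subset_vars[of p] in auto)
    ultimately have "wit x p e t" unfolding wit_def by simp
    moreover have "sub t W" unfolding sub_def W using t(1) by blast
    ultimately show ?thesis by (rule wit_mono[rotated])
  qed
  then have "allin W n (\<lambda>e. wit x p e W) (\<lambda>_. W)"
    unfolding allin_iff by blast
  ultimately show ?case by simp
qed simp_all

lemma chain_good:
  assumes F: "\<And>s. F s \<Longrightarrow> lev s" "F s0" "om \<epsilon> s0" and W: "\<And>z. z \<epsilon> W \<longleftrightarrow> (\<exists>s. F s \<and> z \<epsilon> s)"
    and "vars p \<subseteq> {..<n}" and nxt: "\<And>s. F s \<Longrightarrow> \<exists>t. F t \<and> s \<epsilon> t \<and> wcl n s t p"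
  shows "good n p W"
  unfolding good_def
proof (intro conjI allI impI)
  fix y z assume "y \<epsilon> W \<and> z \<epsilon> y"
  then show "z \<epsilon> W" unfolding W using lev_trans F(1) by blast
next
  fix x y assume "y \<epsilon> W \<and> sub x y"
  then show "x \<epsilon> W" unfolding W using lev_pot F(1) by blast
next
  show "om \<epsilon> W" unfolding W using F by blast
next
  fix x y assume "x \<epsilon> W \<and> y \<epsilon> W"
  then obtain s t where st: "F s" "x \<epsilon> s" "F t" "y \<epsilon> t" unfolding W by blast
  obtain u where u: "u = s \<or> u = t" "sub s u" "sub t u"
    using lev_max[OF F(1)[OF st(1)] F(1)[OF st(3)]] by blast
  then have "F u" "x \<epsilon> u" "y \<epsilon> u" using st subD by blast+
  then show "\<exists>z. z \<epsilon> W \<and> sub x z \<and> sub y z \<and> y \<epsilon> z"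
    unfolding W using nxt lev_mem_sub F(1) by blast
next
  fix x assume "x \<epsilon> W"
  then obtain s where s: "F s" "x \<epsilon> s" unfolding W by blast
  \<comment> \<open>Unordered pairs from \<open>s\<close> appear in the next level
    \<open>s1\<close>, ordered pairs in \<open>s2\<close>; the third step makes \<open>s2\<close>
    itself a member of \<open>W\<close>.\<close>
  obtain s1 where s1: "F s1" "s \<epsilon> s1" using nxt[OF s(1)] by blast
  obtain s2 where s2: "F s2" "s1 \<epsilon> s2" using nxt[OF s1(1)] by blast
  obtain s3 where s3: "F s3" "s2 \<epsilon> s3" using nxt[OF s2(1)] by blast
  have "opair a b \<epsilon> s2" if ab: "a \<epsilon> x" "b \<epsilon> x" for a b
  proof -
    have "a \<epsilon> s" "b \<epsilon> s" using ab lev_trans[OF F(1)[OF s(1)] s(2)] by blast+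
    then have "sub (upair a a) s" "sub (upair a b) s" by (auto simp: sub_def)
    then have "upair a a \<epsilon> s1" "upair a b \<epsilon> s1" using lev_pot[OF F(1)[OF s1(1)] s1(2)] by blast+
    then have "sub (opair a b) s1" by (auto simp: sub_def opair_def)
    then show ?thesis using lev_pot[OF F(1)[OF s2(1)] s2(2)] by blast
  qed
  then show "\<exists>z. z \<epsilon> W \<and> (\<forall>a b. a \<epsilon> x \<and> b \<epsilon> x \<longrightarrow> opair a b \<epsilon> z)"
    unfolding W using s3 by blast
next
  show "wcl n W W p" by (rule chain_wcl[OF F(1,2) W assms(5) nxt])
qed

definition isfun :: "'a \<Rightarrow> 'a \<Rightarrow> bool" where
  "isfun g W \<longleftrightarrow> (\<forall>q. q \<epsilon> g \<longrightarrow> (\<exists>n y. n \<epsilon> om \<and> y \<epsilon> W \<and> q = opair n y)) \<and>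
     (\<forall>n. n \<epsilon> om \<longrightarrow> (\<exists>y. opair n y \<epsilon> g \<and> (\<forall>y'. opair n y' \<epsilon> g \<longrightarrow> y' = y)))"

lemma dfb_isfun [dfb_rules]: "dft x A t \<Longrightarrow> dft x A u \<Longrightarrow> dfb x A (\<lambda>e. isfun (t e) (u e))"
  by (rule dfb_sub2) (unfold isfun_def, intro dfb_rules)

text \<open>The chain \<open>f\<close> of length omega is itself the function that is missing: if it
  belonged to \<open>f c\<close>, transitivity would put \<open>f c\<close> into
  \<open>f c\<close>.\<close>

lemma ex_good_omega_cofinal:
  assumes p: "internal p" "vars p \<subseteq> {..<n}"
  shows "\<exists>W. good n p W \<and> (\<exists>g. isfun g W \<and> \<not> g \<epsilon> W)"
proof -
  have R: "drel (\<lambda>b c. b \<epsilon> c)" by (intro dfb_rules)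
  obtain f where f: "dfun f" "\<forall>c. c \<epsilon> om \<longrightarrow> f c = K n p (setof (\<lambda>z. \<exists>b. b \<epsilon> om \<and> b \<epsilon> c \<and> z = f b))"
    "\<forall>c. small (\<lambda>z. \<exists>b. b \<epsilon> om \<and> b \<epsilon> c \<and> z = f b)"
    by (rule wf_recursion[OF dfun_K[OF p(1)] R mem_wf_on])
  have lev: "lev (f c)" "om \<epsilon> f c" if "c \<epsilon> om" for c
    using f(2) that K_props[OF p(1)] by auto
  have step: "f c \<epsilon> f (suc c)" "wcl n (f c) (f (suc c)) p" if c: "c \<epsilon> om" for c
  proof -
    have "f c \<epsilon> setof (\<lambda>z. \<exists>b. b \<epsilon> om \<and> b \<epsilon> suc c \<and> z = f b)"
      unfolding mem_setof[OF f(3)[rule_format]] using c by auto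
    then show "f c \<epsilon> f (suc c)" "wcl n (f c) (f (suc c)) p"
      using f(2)[rule_format, OF suc_om[OF c]] K_props(3,4)[OF p(1)] by auto
  qed
  obtain Z where Z: "\<And>z. z \<epsilon> Z \<longleftrightarrow> (\<exists>c. c \<epsilon> om \<and> z = f c)"
    using small_image[OF f(1) small_mem[of om]] unfolding small_def by blast
  let ?F = "\<lambda>s. \<exists>c. c \<epsilon> om \<and> s = f c"
  have W: "z \<epsilon> un Z \<longleftrightarrow> (\<exists>s. ?F s \<and> z \<epsilon> s)" for z
    using Z by auto
  have good: "good n p (un Z)"
  proof (rule chain_good[of ?F "f emp"])
    show "\<And>s. ?F s \<Longrightarrow> \<exists>t. ?F t \<and> s \<epsilon> t \<and> wcl n s t p"
      using step suc_om by blast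
  qed (use lev emp_om W p(2) in blast)+
  have dg: "dfun (\<lambda>c. opair c (f c))"
    by (intro dfb_rules dft_fun1[OF f(1)])
  obtain g where g: "\<And>z. z \<epsilon> g \<longleftrightarrow> (\<exists>c. c \<epsilon> om \<and> z = opair c (f c))"
    using small_image[OF dg small_mem[of om]] unfolding small_def by blast
  have "f c \<epsilon> un Z" if "c \<epsilon> om" for c
    unfolding W using step(1)[OF that] suc_om[OF that] by blast
  then have "isfun g (un Z)"
    unfolding isfun_def g by auto
  moreover have "\<not> g \<epsilon> un Z"
  proof
    assume "g \<epsilon> un Z"
    then obtain c where c: "c \<epsilon> om" "g \<epsilon> f c" unfolding W by blast
    have "opair c (f c) \<epsilon> g" using g c(1) by blast
    then have "opair c (f c) \<epsilon> f c" using lev_trans[OF lev(1)[OF c(1)] c(2)] by blast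
    then have "upair c (f c) \<epsilon> f c" using lev_trans[OF lev(1)[OF c(1)], of "opair c (f c)"] by (simp add: opair_def)
    then have "f c \<epsilon> f c" using lev_trans[OF lev(1)[OF c(1)], of "upair c (f c)"] by simp
    then show False using not_mem_self by blast
  qed
  ultimately show ?thesis using good by blast
qed

text \<open>The axiom of choice is stated for disjoint families. Pairing each candidate with its
  index \<open>a\<close> makes the sets disjoint, and the choice set becomes a parameter of the
  definable \<open>G\<close>.\<close>

lemma definable_choice:
  assumes Q: "drel Q" and ex: "\<And>a. a \<epsilon> A \<Longrightarrow> \<exists>d. d \<epsilon> D \<and> Q a d"
  obtains G where "dfun G" "\<forall>a. a \<epsilon> A \<longrightarrow> G a \<epsilon> D \<and> Q a (G a)"
proof -
  let ?P = "\<lambda>a z. \<exists>d. d \<epsilon> D \<and> Q a d \<and> z = opair a d"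
  have sm: "small (?P a)" for a
  proof (rule small_bounded)
    show "dprd (?P a)" by (intro dfb_rules dfb_sub2[OF Q] UNIV_I)
    show "z \<epsilon> setof (\<lambda>z. \<exists>x y. x \<epsilon> upair a a \<and> y \<epsilon> D \<and> z = opair x y)" if "?P a z" for z
      unfolding mem_setof[OF small_Times] using that by auto
  qed
  have dF: "dfun (\<lambda>a. setof (?P a))"
    unfolding eq_setof_iff[OF sm] by (intro dfb_rules dfb_sub2[OF Q] UNIV_I)
  obtain B where B: "\<And>z. z \<epsilon> B \<longleftrightarrow> (\<exists>a. a \<epsilon> A \<and> z = setof (?P a))"
    using small_image[OF dF small_mem[of A]] unfolding small_def by blast
  have "\<exists>c. \<forall>x. x \<epsilon> B \<longrightarrow> (\<exists>y. y \<epsilon> x \<and> y \<epsilon> c \<and> (\<forall>z. z \<epsilon> x \<and> z \<epsilon> c \<longrightarrow> z = y))"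
  proof (rule choice)
    fix x assume "x \<epsilon> B"
    then obtain a where a: "a \<epsilon> A" "x = setof (?P a)" using B by blast
    then show "\<exists>z. z \<epsilon> x" using ex[OF a(1)] unfolding a(2) mem_setof[OF sm] by blast
  next
    fix x y z assume "x \<epsilon> B" "y \<epsilon> B" and z: "z \<epsilon> x" "z \<epsilon> y"
    then obtain a b where ab: "x = setof (?P a)" "y = setof (?P b)" using B by blast
    then have "a = b" using z by (auto simp: mem_setof[OF sm])
    then show "x = y" using ab by simp
  qed
  then obtain c where c: "\<And>x. x \<epsilon> B \<Longrightarrow> \<exists>y. y \<epsilon> x \<and> y \<epsilon> c \<and> (\<forall>z. z \<epsilon> x \<and> z \<epsilon> c \<longrightarrow> z = y)"
    by blast
  let ?G = "\<lambda>a d. d \<epsilon> D \<and> Q a d \<and> opair a d \<epsilon> c"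
  have ex1: "\<exists>!d. ?G a d" if "a \<epsilon> A" for a
  proof -
    have "setof (?P a) \<epsilon> B" using B that by blast
    from c[OF this, unfolded mem_setof[OF sm]]
    obtain y where y: "?P a y \<and> y \<epsilon> c \<and> (\<forall>z. ?P a z \<and> z \<epsilon> c \<longrightarrow> z = y)" ..
    then obtain d where d: "?G a d" "y = opair a d" by blast
    have "d' = d" if "?G a d'" for d'
    proof -
      have "opair a d' = y" using y that by blast
      then show ?thesis using d(2) by simp
    qed
    then show ?thesis using d(1) by (intro ex1I[of _ d])
  qed
  define G where "G a = (if a \<epsilon> A then THE d. ?G a d else emp)" for a
  have G: "?G a (G a)" if "a \<epsilon> A" for a
    using theI'[OF ex1[OF that]] that by (simp add: G_def)
  have "y = G a \<longleftrightarrow> (a \<epsilon> A \<and> ?G a y) \<or> (\<not> a \<epsilon> A \<and> y = emp)" for y a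
  proof (cases "a \<epsilon> A")
    case True
    then show ?thesis using G[OF True] ex1[OF True] by blast
  qed (simp add: G_def)
  then have "dfun G"
    by (simp only:) (intro dfb_rules dfb_sub2[OF Q] UNIV_I)
  then show ?thesis using that G by blast
qed

definition wfr :: "'a \<Rightarrow> 'a \<Rightarrow> bool" where
  "wfr T r \<longleftrightarrow> (\<forall>B. (\<exists>x. x \<epsilon> B) \<and> sub B T \<longrightarrow> (\<exists>m. m \<epsilon> B \<and> (\<forall>x. x \<epsilon> B \<longrightarrow> \<not> opair x m \<epsilon> r)))"

lemma dfb_wfr [dfb_rules]: "dft x A t \<Longrightarrow> dft x A u \<Longrightarrow> dfb x A (\<lambda>e. wfr (t e) (u e))"
  by (rule dfb_sub2) (unfold wfr_def, intro dfb_rules)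

lemma wfrD:
  assumes "wfr T r" "dprd P" "x \<epsilon> T" "P x"
  obtains m where "m \<epsilon> T" "P m" "\<forall>x. x \<epsilon> T \<and> P x \<longrightarrow> \<not> opair x m \<epsilon> r"
proof -
  obtain B where B: "\<And>x. x \<epsilon> B \<longleftrightarrow> x \<epsilon> T \<and> P x" using separation[OF assms(2), of T] by blast
  then have "(\<exists>x. x \<epsilon> B) \<and> sub B T" using assms(3,4) by (auto simp: sub_def)
  then obtain m where "m \<epsilon> B" "\<forall>x. x \<epsilon> B \<longrightarrow> \<not> opair x m \<epsilon> r" using assms(1) unfolding wfr_def by blast
  then show ?thesis using that[of m] B by blast
qed

text \<open>The disjoint sum of countably many pointed well-founded relations, with \<^term>\<open>emp\<close> (which is not an
  ordered pair) placed above the distinguished points.\<close>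

lemma ex_wf_sum:
  assumes T: "good n p T" and dG: "dfun G"
    and G: "\<And>k. k \<epsilon> om \<Longrightarrow> \<exists>r t. sub r T \<and> wfr T r \<and> t \<epsilon> T \<and> G k = opair r t"
  obtains S where "sub S T" "wfr T S"
    "\<forall>k r t u x. k \<epsilon> om \<and> G k = opair r t \<longrightarrow>
       (opair u (opair k x) \<epsilon> S \<longleftrightarrow> (\<exists>x'. u = opair k x' \<and> opair x' x \<epsilon> r))"
    "\<forall>k r t. k \<epsilon> om \<and> G k = opair r t \<longrightarrow> opair (opair k t) emp \<epsilon> S"
proof -
  let ?P = "\<lambda>q. (\<exists>k x y r t. k \<epsilon> om \<and> G k = opair r t \<and> opair x y \<epsilon> r \<and> q = opair (opair k x) (opair k y)) \<or>
      (\<exists>k r t. k \<epsilon> om \<and> G k = opair r t \<and> q = opair (opair k t) emp)"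
  have "dprd ?P" by (intro dfb_rules dft_fun1[OF dG])
  from separation[OF this, of T] obtain S where S: "\<And>q. q \<epsilon> S \<longleftrightarrow> q \<epsilon> T \<and> ?P q" by blast
  have om: "k \<epsilon> T" if "k \<epsilon> om" for k using good_trans[OF T good_om[OF T] that] .
  have emp: "emp \<epsilon> T" using om emp_om by blast
  have S1: "opair u (opair k x) \<epsilon> S \<longleftrightarrow> (\<exists>x'. u = opair k x' \<and> opair x' x \<epsilon> r)"
    if k: "k \<epsilon> om" "G k = opair r t" for k r t u x
  proof
    assume "opair u (opair k x) \<epsilon> S"
    then show "\<exists>x'. u = opair k x' \<and> opair x' x \<epsilon> r"
      using S[of "opair u (opair k x)"] k by auto
  next
    assume "\<exists>x'. u = opair k x' \<and> opair x' x \<epsilon> r"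
    then obtain x' where x': "u = opair k x'" "opair x' x \<epsilon> r" by blast
    have "sub r T" using G[OF k(1)] k(2) by auto
    then have "opair x' x \<epsilon> T" using x'(2) subD by blast
    then have "x' \<epsilon> T" "x \<epsilon> T" using good_opair_parts[OF T] by blast+
    then have "opair u (opair k x) \<epsilon> T" using x'(1) good_opair[OF T] om[OF k(1)] by blast
    moreover have "?P (opair u (opair k x))" using k x' by blast
    ultimately show "opair u (opair k x) \<epsilon> S" using S by blast
  qed
  have S2: "opair (opair k t) emp \<epsilon> S" if k: "k \<epsilon> om" "G k = opair r t" for k r t
  proof -
    have "t \<epsilon> T" using G[OF k(1)] k(2) by auto
    then have "opair (opair k t) emp \<epsilon> T" using good_opair[OF T] om[OF k(1)] emp by blast
    moreover have "?P (opair (opair k t) emp)" using k by blast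
    ultimately show ?thesis using S by blast
  qed
  have S3: "\<exists>k x. k \<epsilon> om \<and> u = opair k x" if "opair u v \<epsilon> S" for u v
    using S[of "opair u v"] that by auto
  have "wfr T S"
    unfolding wfr_def
  proof (intro allI impI)
    fix B assume B: "(\<exists>x. x \<epsilon> B) \<and> sub B T"
    show "\<exists>m. m \<epsilon> B \<and> (\<forall>x. x \<epsilon> B \<longrightarrow> \<not> opair x m \<epsilon> S)"
    \<comment> \<open>Predecessors of a point tagged by \<open>k\<close> are again tagged by
      \<open>k\<close>, so a minimal point inside one summand is minimal in \<open>B\<close>.
      Without tagged points \<open>B\<close> contains no predecessor of anything.\<close>
    proof (cases "\<exists>k x. k \<epsilon> om \<and> opair k x \<epsilon> B")
      case True
      then obtain k x where k: "k \<epsilon> om" "opair k x \<epsilon> B" by blast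
      then obtain r t where r: "wfr T r" "G k = opair r t" using G by blast
      have inT: "y \<epsilon> T" if "opair k y \<epsilon> B" for y
        using subD[of B T "opair k y"] B that good_opair_parts[OF T] by blast
      have "dprd (\<lambda>x. opair k x \<epsilon> B)" by (intro dfb_rules UNIV_I)
      from wfrD[OF r(1) this inT[OF k(2)] k(2)]
      obtain m where m: "opair k m \<epsilon> B" "\<forall>x. x \<epsilon> T \<and> opair k x \<epsilon> B \<longrightarrow> \<not> opair x m \<epsilon> r" by blast
      have "\<not> opair z (opair k m) \<epsilon> S" if z: "z \<epsilon> B" for z
      proof
        assume "opair z (opair k m) \<epsilon> S"
        then obtain x' where "z = opair k x'" "opair x' m \<epsilon> r" using S1[OF k(1) r(2)] by blast
        then show False using m(2) z inT by blast
      qed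
      then show ?thesis using m(1) by blast
    next
      case False
      then show ?thesis using B S3 by blast
    qed
  qed
  moreover have "sub S T" using S unfolding sub_def by blast
  ultimately show ?thesis using that S1 S2 by blast
qed

text \<open>The recursion runs over pairs of a well-founded relation on \<open>T\<close> and a point. Sums of countably many such pairs
  bound countable subfamilies, so the union has uncountable cofinality although no well-ordering is used.\<close>

lemma ex_good_omega_closed:
  assumes p: "internal p" "vars p \<subseteq> {..<n}"
  shows "\<exists>W. good n p W \<and> (\<forall>g. isfun g W \<longrightarrow> g \<epsilon> W)"
proof -
  \<comment> \<open>\<open>T\<close> is a reservoir of points: it contains \<open>om\<close> and is
    closed under ordered pairs, so a countable disjoint sum of relations on \<open>T\<close> is
    again a relation on \<open>T\<close>.\<close>
  obtain T where T: "good n p T" using ex_good_omega_cofinal[OF p] by blast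
  have emp: "emp \<epsilon> T" using good_trans[OF T good_om[OF T] emp_om] .
  let ?D = "\<lambda>q. \<exists>r t. sub r T \<and> wfr T r \<and> t \<epsilon> T \<and> q = opair r t"
  have "small ?D"
  proof (rule small_bounded)
    show "dprd ?D" by (intro dfb_rules UNIV_I)
    show "q \<epsilon> setof (\<lambda>z. \<exists>r t. r \<epsilon> pow T \<and> t \<epsilon> T \<and> z = opair r t)" if "?D q" for q
      unfolding mem_setof[OF small_Times] using that mem_pow by blast
  qed
  then obtain D where D: "\<And>q. q \<epsilon> D \<longleftrightarrow> ?D q" unfolding small_def by blast
  have D_opair: "opair r t \<epsilon> D \<longleftrightarrow> sub r T \<and> wfr T r \<and> t \<epsilon> T" for r t
    unfolding D by auto
  define R where "R q q' \<longleftrightarrow> (\<exists>r u u'. q = opair r u \<and> q' = opair r u' \<and> opair u u' \<epsilon> r)" for q q'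
  have R: "drel R" unfolding R_def by (intro dfb_rules)
  have wf: "\<forall>B. (\<exists>x. x \<epsilon> B) \<and> sub B D \<longrightarrow> (\<exists>m. m \<epsilon> B \<and> (\<forall>x. x \<epsilon> B \<longrightarrow> \<not> R x m))"
  proof (intro allI impI)
    fix B assume B: "(\<exists>x. x \<epsilon> B) \<and> sub B D"
    then obtain q where "q \<epsilon> B" "q \<epsilon> D" using subD by blast
    then obtain r t where q: "opair r t \<epsilon> B" "wfr T r" "t \<epsilon> T" unfolding D by blast
    have "dprd (\<lambda>x. opair r x \<epsilon> B)" by (intro dfb_rules UNIV_I)
    from wfrD[OF q(2) this q(3,1)]
    obtain m where m: "opair r m \<epsilon> B" "\<forall>x. x \<epsilon> T \<and> opair r x \<epsilon> B \<longrightarrow> \<not> opair x m \<epsilon> r" by blast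
    have "\<not> R z (opair r m)" if z: "z \<epsilon> B" for z
    proof
      assume "R z (opair r m)"
      then obtain u where u: "z = opair r u" "opair u m \<epsilon> r" unfolding R_def by auto
      then have "opair r u \<epsilon> D" using z B subD by blast
      then show False using m(2) u z D_opair by blast
    qed
    then show "\<exists>m. m \<epsilon> B \<and> (\<forall>x. x \<epsilon> B \<longrightarrow> \<not> R x m)" using m(1) by blast
  qed
  obtain f where f: "dfun f" "\<forall>c. c \<epsilon> D \<longrightarrow> f c = K n p (setof (\<lambda>z. \<exists>b. b \<epsilon> D \<and> R b c \<and> z = f b))"
    "\<forall>c. small (\<lambda>z. \<exists>b. b \<epsilon> D \<and> R b c \<and> z = f b)"
    by (rule wf_recursion[OF dfun_K[OF p(1)] R wf])
  have lev: "lev (f c)" "om \<epsilon> f c" if "c \<epsilon> D" for c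
    using f(2) that K_props[OF p(1)] by auto
  have step: "f b \<epsilon> f c" "wcl n (f b) (f c) p" if c: "b \<epsilon> D" "c \<epsilon> D" "R b c" for b c
  proof -
    have "f b \<epsilon> setof (\<lambda>z. \<exists>b. b \<epsilon> D \<and> R b c \<and> z = f b)"
      unfolding mem_setof[OF f(3)[rule_format]] using c by blast
    then show "f b \<epsilon> f c" "wcl n (f b) (f c) p"
      using f(2)[rule_format, OF c(2)] K_props(3,4)[OF p(1)] by auto
  qed
  have bound: "\<exists>c. c \<epsilon> D \<and> (\<forall>k. k \<epsilon> om \<longrightarrow> f (G k) \<epsilon> f c \<and> wcl n (f (G k)) (f c) p)"
    if dG: "dfun G" and GD: "\<And>k. k \<epsilon> om \<Longrightarrow> G k \<epsilon> D" for G
  proof -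
    have G: "\<exists>r t. sub r T \<and> wfr T r \<and> t \<epsilon> T \<and> G k = opair r t" if "k \<epsilon> om" for k
      using GD[OF that] unfolding D .
    obtain S where S: "sub S T" "wfr T S"
      "\<forall>k r t u x. k \<epsilon> om \<and> G k = opair r t \<longrightarrow>
         (opair u (opair k x) \<epsilon> S \<longleftrightarrow> (\<exists>x'. u = opair k x' \<and> opair x' x \<epsilon> r))"
      "\<forall>k r t. k \<epsilon> om \<and> G k = opair r t \<longrightarrow> opair (opair k t) emp \<epsilon> S"
      by (rule ex_wf_sum[OF T dG G])
    have omT: "k \<epsilon> T" if "k \<epsilon> om" for k using good_trans[OF T good_om[OF T] that] .
    have SD: "opair S t \<epsilon> D" if "t \<epsilon> T" for t using S D_opair that by blast
    \<comment> \<open>The predecessors of \<open>opair k x\<close> under \<open>S\<close> are the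
      tagged copies of those of \<open>x\<close> under \<open>r\<close>, so the recursion assigns
      the same level to both. Each \<open>f (G k)\<close> therefore occurs below the top point
      \<open>emp\<close> of the sum.\<close>
    have embed: "f (opair S (opair k x)) = f (opair r x)"
      if k: "k \<epsilon> om" "G k = opair r t" and x: "x \<epsilon> T" for k r t x
    proof (rule ccontr)
      have r: "sub r T" "wfr T r" using G[OF k(1)] k(2) by auto
      have "dprd (\<lambda>x. f (opair S (opair k x)) \<noteq> f (opair r x))"
        by (intro dfb_rules UNIV_I dft_fun1[OF f(1)])
      moreover assume "f (opair S (opair k x)) \<noteq> f (opair r x)"
      ultimately obtain m where m: "m \<epsilon> T" "f (opair S (opair k m)) \<noteq> f (opair r m)"
        and min: "\<forall>x. x \<epsilon> T \<and> f (opair S (opair k x)) \<noteq> f (opair r x) \<longrightarrow> \<not> opair x m \<epsilon> r"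
        using wfrD[OF r(2), of "\<lambda>x. f (opair S (opair k x)) \<noteq> f (opair r x)" x] x by blast
      have low: "x \<epsilon> T \<and> f (opair S (opair k x)) = f (opair r x)" if "opair x m \<epsilon> r" for x
        using min that good_opair_parts[OF T subD[OF r(1) that]] by blast
      have "(\<exists>b. b \<epsilon> D \<and> R b (opair S (opair k m)) \<and> z = f b) \<longleftrightarrow> (\<exists>b. b \<epsilon> D \<and> R b (opair r m) \<and> z = f b)" for z
      proof
        assume "\<exists>b. b \<epsilon> D \<and> R b (opair S (opair k m)) \<and> z = f b"
        then obtain u where u: "opair u (opair k m) \<epsilon> S" "z = f (opair S u)" unfolding R_def by auto
        then obtain x' where x': "u = opair k x'" "opair x' m \<epsilon> r" using S(3) k by blast
        then have "z = f (opair r x')" "opair r x' \<epsilon> D" "R (opair r x') (opair r m)"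
          using u(2) low r D_opair unfolding R_def by auto
        then show "\<exists>b. b \<epsilon> D \<and> R b (opair r m) \<and> z = f b" by blast
      next
        assume "\<exists>b. b \<epsilon> D \<and> R b (opair r m) \<and> z = f b"
        then obtain x' where x': "opair x' m \<epsilon> r" "z = f (opair r x')" unfolding R_def by auto
        then have "opair (opair k x') (opair k m) \<epsilon> S" using S(3) k by blast
        moreover have "z = f (opair S (opair k x'))" "x' \<epsilon> T" using low x' by auto
        moreover have "opair S (opair k x') \<epsilon> D" using SD good_opair[OF T omT[OF k(1)] \<open>x' \<epsilon> T\<close>] by blast
        ultimately show "\<exists>b. b \<epsilon> D \<and> R b (opair S (opair k m)) \<and> z = f b" unfolding R_def by blast
      qed
      moreover have "opair S (opair k m) \<epsilon> D" "opair r m \<epsilon> D"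
        using SD good_opair[OF T omT[OF k(1)] m(1)] D_opair r m(1) by blast+
      ultimately have "f (opair S (opair k m)) = f (opair r m)"
        using f(2) by simp
      then show False using m(2) by blast
    qed
    have "f (G k) \<epsilon> f (opair S emp) \<and> wcl n (f (G k)) (f (opair S emp)) p" if k: "k \<epsilon> om" for k
    proof -
      obtain r t where rt: "t \<epsilon> T" "G k = opair r t" using G[OF k] by blast
      have "R (opair S (opair k t)) (opair S emp)" unfolding R_def using S(4) k rt(2) by blast
      moreover have "opair S (opair k t) \<epsilon> D" "opair S emp \<epsilon> D"
        using SD good_opair[OF T omT[OF k] rt(1)] emp by blast+
      ultimately show ?thesis using step embed[OF k rt(2,1)] rt(2) by metis
    qed
    then show ?thesis using SD[OF emp] by blast
  qed
  obtain Z where Z: "\<And>z. z \<epsilon> Z \<longleftrightarrow> (\<exists>c. c \<epsilon> D \<and> z = f c)"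
    using small_image[OF f(1) small_mem[of D]] unfolding small_def by blast
  let ?F = "\<lambda>s. \<exists>c. c \<epsilon> D \<and> s = f c"
  have W: "z \<epsilon> un Z \<longleftrightarrow> (\<exists>s. ?F s \<and> z \<epsilon> s)" for z
    using Z by auto
  have nxt: "\<exists>t. ?F t \<and> s \<epsilon> t \<and> wcl n s t p" if s: "?F s" for s
  proof -
    obtain c where c: "c \<epsilon> D" "s = f c" using s by blast
    \<comment> \<open>The bound for a constant family provides a next level in the chain.\<close>
    have "dfun (\<lambda>_. c)" by (intro dfb_rules UNIV_I)
    then show ?thesis using bound[of "\<lambda>_. c"] c emp_om by blast
  qed
  have "wfr T emp" "sub emp T" unfolding wfr_def by (auto simp: sub_def)
  then have ne: "opair emp emp \<epsilon> D" using D_opair emp by blast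
  have good: "good n p (un Z)"
    by (rule chain_good[of ?F "f (opair emp emp)"]) (use lev ne W p(2) nxt in blast)+
  moreover have "g \<epsilon> un Z" if g: "isfun g (un Z)" for g
  proof -
    \<comment> \<open>Choose for each \<open>k\<close> an index whose level contains the value of
      \<open>g\<close> at \<open>k\<close>. One index bounds all the chosen ones, so
      \<open>g\<close> is a set of pairs from a single level and hence a subset of a member of the
      union.\<close>
    let ?Q = "\<lambda>k d. \<forall>y. opair k y \<epsilon> g \<longrightarrow> y \<epsilon> f d"
    have "drel ?Q" by (intro dfb_rules UNIV_I dft_fun1[OF f(1)])
    moreover have "\<exists>d. d \<epsilon> D \<and> ?Q k d" if k: "k \<epsilon> om" for k
    proof -
      obtain y where y: "opair k y \<epsilon> g" "\<forall>y'. opair k y' \<epsilon> g \<longrightarrow> y' = y"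
        using g k unfolding isfun_def by blast
      then obtain k' y' where "y' \<epsilon> un Z" "opair k y = opair k' y'" using g unfolding isfun_def by blast
      then have "y \<epsilon> un Z" by simp
      then show ?thesis using y(2) unfolding W by blast
    qed
    ultimately obtain G where G: "dfun G" "\<forall>k. k \<epsilon> om \<longrightarrow> G k \<epsilon> D \<and> ?Q k (G k)"
      using definable_choice[of ?Q om D] by blast
    then obtain c where c: "c \<epsilon> D" "\<forall>k. k \<epsilon> om \<longrightarrow> f (G k) \<epsilon> f c" using bound[of G] by blast
    have "f c \<epsilon> un Z" unfolding W using nxt c(1) by blast
    then obtain z where z: "z \<epsilon> un Z" "\<forall>a b. a \<epsilon> f c \<and> b \<epsilon> f c \<longrightarrow> opair a b \<epsilon> z"
      using good_square[OF good] by blast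
    have "q \<epsilon> z" if q: "q \<epsilon> g" for q
    proof -
      obtain k y where ky: "k \<epsilon> om" "q = opair k y" using g q unfolding isfun_def by blast
      then have "y \<epsilon> f (G k)" using G(2) q by blast
      then have "y \<epsilon> f c" using lev_trans[OF lev(1)[OF c(1)]] c(2) ky(1) by blast
      moreover have "k \<epsilon> f c" using lev_trans[OF lev(1)[OF c(1)] lev(2)[OF c(1)] ky(1)] .
      ultimately show ?thesis using z(2) ky(2) by blast
    qed
    then have "sub g z" unfolding sub_def by blast
    then show ?thesis by (rule good_pot[OF good z(1)])
  qed
  ultimately show ?thesis by blast
qed

subsection \<open>Reflecting standard sets as models of IST\<close>

lemma transfer_all:
  assumes "dfb False {c. st c} (\<lambda>e. Q (e 0))" and "\<And>x. st x \<Longrightarrow> Q x"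
  shows "Q y"
proof (rule ccontr)
  assume "\<not> Q y"
  then have "\<exists>x. st x \<and> \<not> Q x" by (rule transfer[OF dfb_not[OF assms(1)]])
  then show False using assms(2) by blast
qed

lemma st_opair:
  assumes "st a" "st b"
  shows "st (opair a b)"
proof -
  have "dfb False {c. st c} (\<lambda>e. e 0 = opair a b)" by (intro dfb_rules) (use assms in auto)
  then show ?thesis using transfer[of "\<lambda>x. x = opair a b"] by blast
qed

lemma dfb_fin [dfb_rules]: "dft x A t \<Longrightarrow> dfb x A (\<lambda>e. fin (t e))"
  by (rule dfb_sub1) (unfold fin_def, intro dfb_rules)

lemma fin_subset: "fin A \<Longrightarrow> sub B A \<Longrightarrow> fin B"
  unfolding fin_def sub_def by blast

text \<open>Tarski finiteness is applied to the complements in \<open>A\<close> of the subsets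
  satisfying \<open>P\<close>: a minimal complement must be empty, since otherwise one of its points
  could be moved to the subset.\<close>

lemma fin_induct:
  assumes A: "fin A" and P: "dprd P" and P0: "P emp"
    and P1: "\<And>u a. P u \<Longrightarrow> a \<epsilon> A \<Longrightarrow> P (cup u (upair a a))"
  shows "P A"
proof -
  let ?X = "\<lambda>v. \<exists>u. sub u A \<and> P u \<and> (\<forall>w. w \<epsilon> v \<longleftrightarrow> w \<epsilon> A \<and> \<not> w \<epsilon> u)"
  have "dprd ?X" by (intro dfb_rules dfb_sub1[OF P] UNIV_I)
  from separation[OF this, of "pow A"] obtain X where "\<And>v. v \<epsilon> X \<longleftrightarrow> v \<epsilon> pow A \<and> ?X v" by blast
  then have X: "v \<epsilon> X \<longleftrightarrow> ?X v" for v by (auto simp: sub_def)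
  have "A \<epsilon> X" unfolding X using P0 by (intro exI[of _ emp]) (auto simp: sub_def)
  moreover have "\<forall>u. u \<epsilon> X \<longrightarrow> (\<forall>w. w \<epsilon> u \<longrightarrow> w \<epsilon> A)" unfolding X by blast
  ultimately have "\<exists>m. m \<epsilon> X \<and> (\<forall>v. v \<epsilon> X \<and> (\<forall>w. w \<epsilon> v \<longrightarrow> w \<epsilon> m) \<longrightarrow> (\<forall>w. w \<epsilon> m \<longrightarrow> w \<epsilon> v))"
    using A[unfolded fin_def, THEN spec, of X] by blast
  then obtain m where m: "m \<epsilon> X"
    and min: "\<And>v. v \<epsilon> X \<Longrightarrow> \<forall>w. w \<epsilon> v \<longrightarrow> w \<epsilon> m \<Longrightarrow> \<forall>w. w \<epsilon> m \<longrightarrow> w \<epsilon> v"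
    by blast
  obtain u where u: "sub u A" "P u" "\<And>w. w \<epsilon> m \<longleftrightarrow> w \<epsilon> A \<and> \<not> w \<epsilon> u" using m unfolding X by blast
  have "\<not> a \<epsilon> m" for a
  proof
    assume a: "a \<epsilon> m"
    let ?u = "cup u (upair a a)"
    have "dprd (\<lambda>w. \<not> w \<epsilon> ?u)" by (intro dfb_rules UNIV_I)
    from separation[OF this, of A] obtain v where v: "\<And>w. w \<epsilon> v \<longleftrightarrow> w \<epsilon> A \<and> \<not> w \<epsilon> ?u" by blast
    have "sub ?u A" using u(1,3) a by (auto simp: sub_def)
    moreover have "P ?u" using P1 u(2,3) a by blast
    ultimately have "v \<epsilon> X" unfolding X using v by blast
    moreover have "\<forall>w. w \<epsilon> v \<longrightarrow> w \<epsilon> m" using u(3) v by auto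
    ultimately have "a \<epsilon> v" using min a by blast
    then show False using v by simp
  qed
  then have "A = u" using u(1,3) by (intro extensionality) (auto simp: sub_def)
  then show ?thesis using u(2) by simp
qed

text \<open>By induction on finite sets the directedness of \<open>W\<close> yields a member of
  \<open>W\<close> that includes \<open>A\<close>; closure under subsets does the rest.\<close>

lemma good_fin_subset:
  assumes W: "good n p W" and A: "fin A" "sub A W"
  shows "A \<epsilon> W"
proof -
  let ?P = "\<lambda>u. \<exists>s. s \<epsilon> W \<and> sub u s"
  have "?P A"
  proof (rule fin_induct[OF A(1)])
    show "dprd ?P" by (intro dfb_rules UNIV_I)
    show "?P emp" using good_om[OF W] by (auto simp: sub_def)
    fix u a assume "?P u" and a: "a \<epsilon> A"
    then obtain s where s: "s \<epsilon> W" "sub u s" by blast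
    obtain z where "z \<epsilon> W" "sub s z" "a \<epsilon> z" using good_adjoin[OF W s(1) subD[OF A(2) a]] by blast
    then show "?P (cup u (upair a a))" using s(2) by (intro exI[of _ z]) (auto simp: sub_def)
  qed
  then show ?thesis using good_pot[OF W] by blast
qed

lemma range_upd: "range e \<subseteq> {z. z \<epsilon> W} \<Longrightarrow> a \<epsilon> W \<Longrightarrow> range (e(k := a)) \<subseteq> {z. z \<epsilon> W}"
  by auto

lemma idealization_good:
  assumes W: "good n p W" and stW: "st W" and e: "range e \<subseteq> {z. z \<epsilon> W}"
    and ax: "internal \<Phi>" "A \<notin> fv \<Phi>" "distinct [x, a, A]"
    and fin: "\<And>e. range e \<subseteq> {z. z \<epsilon> W} \<Longrightarrow> sat {z. z \<epsilon> W} E st e (fin_fm A) \<longleftrightarrow> sat UNIV E st e (fin_fm A)"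
  shows "sat {z. z \<epsilon> W} E st e (Iff (All A (Imp (And (St A) (fin_fm A)) (Ex x (All a (Imp (Mem a A) \<Phi>)))))
    (Ex x (All a (Imp (St a) \<Phi>))))"
proof -
  let ?U = "{z. z \<epsilon> W}"
  define S where "S x' a' = sat ?U E st (e(x := x', a := a')) \<Phi>" for x' a'
  have S: "sat ?U E st (e(A := A', x := x', a := a')) \<Phi> \<longleftrightarrow> S x' a'" for A' x' a'
    unfolding S_def by (rule sat_cong) (use ax(2) in auto)
  have fin': "sat ?U E st (e(A := A')) (fin_fm A) \<longleftrightarrow> fin A'" if "A' \<epsilon> W" for A'
    using fin[OF range_upd[OF e that]] sat_fin_fm by simp
  \<comment> \<open>The first conjunct places the ideal element in \<open>W\<close>; the implication
    is vacuous outside \<open>W\<close>, so that Idealization over all standard \<open>a'\<close> of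
    the ambient model applies.\<close>
  let ?Q = "\<lambda>x' a'. x' \<epsilon> W \<and> (a' \<epsilon> W \<longrightarrow> S x' a')"
  have "dfb False UNIV (\<lambda>f. sat ?U E st (\<lambda>k. (if k = a then (\<lambda>f. f 1) else if k = x then (\<lambda>f. f 0) else (\<lambda>_. e k)) f) \<Phi>)"
    by (rule dfb_sat_dom) (use ax(1) in \<open>auto intro: dft_proj dft_const\<close>)
  moreover have "(\<lambda>k. (if k = a then (\<lambda>f. f 1) else if k = x then (\<lambda>f. f 0) else (\<lambda>_. e k)) f) = e(x := f 0, a := f 1)"
    for f :: "nat \<Rightarrow> 'a" by auto
  ultimately have "drel S" unfolding S_def by simp
  then have dQ: "drel ?Q" by (intro dfb_rules UNIV_I)
  have "(\<forall>A'. A' \<epsilon> W \<longrightarrow> st A' \<and> fin A' \<longrightarrow> (\<exists>x'. x' \<epsilon> W \<and> (\<forall>a'. a' \<epsilon> W \<longrightarrow> a' \<epsilon> A' \<longrightarrow> S x' a'))) \<longleftrightarrow>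
      (\<exists>x'. x' \<epsilon> W \<and> (\<forall>a'. a' \<epsilon> W \<longrightarrow> st a' \<longrightarrow> S x' a'))" (is "?L \<longleftrightarrow> ?R")
  proof
    assume L: ?L
    have "\<exists>x'. \<forall>a'. a' \<epsilon> A' \<longrightarrow> ?Q x' a'" if A': "st A'" "fin A'" for A'
    proof -
      \<comment> \<open>A standard finite set of the ambient model need not be included in
        \<open>W\<close>. Its intersection with \<open>W\<close> is standard by Transfer, finite,
        and a member of \<open>W\<close>.\<close>
      have "dfb False {c. st c} (\<lambda>f. \<forall>z. z \<epsilon> f 0 \<longleftrightarrow> z \<epsilon> A' \<and> z \<epsilon> W)"
        by (intro dfb_rules) (use A'(1) stW in auto)
      moreover have "\<exists>B. \<forall>z. z \<epsilon> B \<longleftrightarrow> z \<epsilon> A' \<and> z \<epsilon> W"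
        by (rule separation) (intro dfb_rules UNIV_I)
      ultimately obtain B where B: "st B" "\<And>z. z \<epsilon> B \<longleftrightarrow> z \<epsilon> A' \<and> z \<epsilon> W"
        using transfer[of "\<lambda>B. \<forall>z. z \<epsilon> B \<longleftrightarrow> z \<epsilon> A' \<and> z \<epsilon> W"] by blast
      then have BW: "sub B W" and BA: "sub B A'" by (auto simp: sub_def)
      have "fin B" by (rule fin_subset[OF A'(2) BA])
      then have "B \<epsilon> W" using good_fin_subset[OF W] BW by blast
      then obtain x' where "x' \<epsilon> W" "\<forall>a'. a' \<epsilon> W \<longrightarrow> a' \<epsilon> B \<longrightarrow> S x' a'" using L B(1) \<open>fin B\<close> by blast
      then show ?thesis using B(2) by blast
    qed
    then obtain x' where x': "\<forall>a'. st a' \<longrightarrow> ?Q x' a'" using idealization[OF dQ] by blast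
    then have "x' \<epsilon> W" using ex_standard by blast
    then show ?R using x' by blast
  next
    assume ?R
    then have "\<exists>x'. \<forall>a'. st a' \<longrightarrow> ?Q x' a'" by blast
    then have L: "\<forall>A'. st A' \<and> fin A' \<longrightarrow> (\<exists>x'. \<forall>a'. a' \<epsilon> A' \<longrightarrow> ?Q x' a')"
      unfolding idealization[OF dQ] .
    show ?L
    proof (intro allI impI)
      fix A' assume "A' \<epsilon> W" and A': "st A' \<and> fin A'"
      then obtain x' where x': "\<forall>a'. a' \<epsilon> A' \<longrightarrow> ?Q x' a'" using L by blast
      show "\<exists>x'. x' \<epsilon> W \<and> (\<forall>a'. a' \<epsilon> W \<longrightarrow> a' \<epsilon> A' \<longrightarrow> S x' a')"
      proof (cases "\<exists>a'. a' \<epsilon> A'")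
        case True
        then show ?thesis using x' by blast
      next
        case False
        \<comment> \<open>For empty \<open>A'\<close> the element \<open>x'\<close> is not forced
          into \<open>W\<close>, so \<open>om\<close> is taken as the witness.\<close>
        then show ?thesis using good_om[OF W] by blast
      qed
    qed
  qed
  then show ?thesis
    using ax(3) by (simp add: S S_def[symmetric] fin')
qed

lemma standardization_good:
  assumes W: "good n p W" and stW: "st W" and e: "range e \<subseteq> {z. z \<epsilon> W}"
    and ax: "Y \<notin> fv \<Phi>" "distinct [X, Y, x]"
  shows "sat {z. z \<epsilon> W} E st e (All X (Imp (St X) (Ex Y (And (St Y)
        (All x (Imp (St x) (Iff (Mem x Y) (And (Mem x X) \<Phi>))))))))"
proof -
  let ?U = "{z. z \<epsilon> W}"
  have "\<exists>Y'. Y' \<epsilon> W \<and> st Y' \<and> (\<forall>x'. x' \<epsilon> W \<longrightarrow> st x' \<longrightarrow>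
      (x' \<epsilon> Y' \<longleftrightarrow> x' \<epsilon> X' \<and> sat ?U E st (e(X := X', Y := Y', x := x')) \<Phi>))"
    if X': "X' \<epsilon> W" "st X'" for X'
  proof -
    define S where "S x' = sat ?U E st (e(X := X', x := x')) \<Phi>" for x'
    have S: "sat ?U E st (e(X := X', Y := Y', x := x')) \<Phi> \<longleftrightarrow> S x'" for Y' x'
      unfolding S_def by (rule sat_cong) (use ax(1) in auto)
    have "dfb True UNIV (\<lambda>f. sat ?U E st (\<lambda>k. (if k = x then (\<lambda>f. f 0) else (\<lambda>_. (e(X := X')) k)) f) \<Phi>)"
      by (rule dfb_sat_dom) (auto intro: dft_proj dft_const)
    moreover have "(\<lambda>k. (if k = x then (\<lambda>f. f 0) else (\<lambda>_. (e(X := X')) k)) f) = e(X := X', x := f 0)"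
      for f :: "nat \<Rightarrow> 'a" by auto
    ultimately have "dfb True UNIV (\<lambda>f. S (f 0))" unfolding S_def by simp
    from standardization[OF this X'(2)]
    obtain Y' where Y': "st Y'" "\<And>z. st z \<Longrightarrow> z \<epsilon> Y' \<longleftrightarrow> z \<epsilon> X' \<and> S z" by blast
    \<comment> \<open>Standardization controls only the standard members of \<open>Y'\<close>.
      Transfer gives the inclusion in \<open>X'\<close> for all members, and then \<open>Y'\<close>
      belongs to \<open>W\<close> as a subset of \<open>X'\<close>.\<close>
    have "dfb False {c. st c} (\<lambda>f. f 0 \<epsilon> Y' \<longrightarrow> f 0 \<epsilon> X')"
      by (intro dfb_rules) (use Y'(1) X'(2) in auto)
    then have "z \<epsilon> Y' \<longrightarrow> z \<epsilon> X'" for z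
      using transfer_all[of "\<lambda>z. z \<epsilon> Y' \<longrightarrow> z \<epsilon> X'"] Y'(2) by blast
    then have "Y' \<epsilon> W" using good_pot[OF W X'(1)] by (simp add: sub_def)
    then show ?thesis using Y' by (auto simp: S)
  qed
  then show ?thesis using ax(2) by simp
qed

lemma transfer_good:
  assumes stW: "st W" and e: "range e \<subseteq> {z. z \<epsilon> W}"
    and ax: "internal \<Phi>" "fv \<Phi> \<subseteq> insert x (set ts)"
  shows "sat {z. z \<epsilon> W} E st e (Imp (st_all ts) (Imp (Ex x \<Phi>) (Ex x (And (St x) \<Phi>))))"
proof -
  let ?U = "{z. z \<epsilon> W}"
  have "\<exists>y. st y \<and> y \<epsilon> W \<and> sat ?U E st (e(x := y)) \<Phi>"
    if ts: "\<forall>t\<in>set ts. st (e t)" and y: "y \<epsilon> W" "sat ?U E st (e(x := y)) \<Phi>" for y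
  proof -
    \<comment> \<open>Only the variables in \<open>ts\<close> are known to be standard. The others
      are reset to the standard value \<open>W\<close>; of them, only \<open>x\<close> can be free
      in the formula, and it is overridden.\<close>
    let ?e = "\<lambda>k. if k \<in> set ts then e k else W"
    have eq: "sat ?U E st (e(x := y)) \<Phi> \<longleftrightarrow> sat ?U E st (?e(x := y)) \<Phi>" for y
      by (rule sat_cong) (use ax(2) in auto)
    have "dfb False {c. st c} (\<lambda>f. sat ?U E st (\<lambda>k. (if k = x then (\<lambda>f. f 0) else (\<lambda>_. ?e k)) f) \<Phi>)"
      by (rule dfb_sat_dom) (use ax(1) ts stW in \<open>auto intro: dft_proj dft_const\<close>)
    moreover have "(\<lambda>k. (if k = x then (\<lambda>f. f 0) else (\<lambda>_. ?e k)) f) = ?e(x := f 0)"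
      for f :: "nat \<Rightarrow> 'a" by auto
    ultimately have "dfb False {c. st c} (\<lambda>f. sat ?U E st (?e(x := f 0)) \<Phi>)" by simp
    then have "dfb False {c. st c} (\<lambda>f. f 0 \<epsilon> W \<and> sat ?U E st (e(x := f 0)) \<Phi>)"
      unfolding eq by (intro dfb_rules) (use stW in auto)
    then show ?thesis
      using transfer[of "\<lambda>y. y \<epsilon> W \<and> sat ?U E st (e(x := y)) \<Phi>"] y by blast
  qed
  then show ?thesis by (auto simp: sat_st_all)
qed

definition funon :: "'a \<Rightarrow> 'a \<Rightarrow> bool" where
  "funon F w \<longleftrightarrow> (\<forall>q. q \<epsilon> F \<longrightarrow> (\<exists>n. n \<epsilon> w \<and> (\<exists>y. q = opair n y))) \<and>
     (\<forall>n. n \<epsilon> w \<longrightarrow> (\<exists>y. opair n y \<epsilon> F \<and> (\<forall>y'. opair n y' \<epsilon> F \<longrightarrow> y' = y)))"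

text \<open>This is the shape of \<open>pair_fm\<close>, which lets the simplifier recognize
  Kuratowski pairs in evaluated formulas.\<close>

lemma eq_opair_iff:
  "q = opair a b \<longleftrightarrow> (\<forall>z. z \<epsilon> q \<longleftrightarrow> (\<forall>v. v \<epsilon> z \<longleftrightarrow> v = a) \<or> (\<forall>v. v \<epsilon> z \<longleftrightarrow> v = a \<or> v = b))"
proof -
  have "z = upair a a \<longleftrightarrow> (\<forall>v. v \<epsilon> z \<longleftrightarrow> v = a)" "z = upair a b \<longleftrightarrow> (\<forall>v. v \<epsilon> z \<longleftrightarrow> v = a \<or> v = b)" for z
    by (simp_all add: eq_iff_mem[of z])
  moreover have "q = opair a b \<longleftrightarrow> (\<forall>z. z \<epsilon> q \<longleftrightarrow> z = upair a a \<or> z = upair a b)"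
    by (simp add: eq_iff_mem[of q] opair_def)
  ultimately show ?thesis by simp
qed

lemma sat_omega_fm: "sat UNIV E st e (omega_fm 0 5 3 6 7 8 9) \<longleftrightarrow> e 0 = om"
  unfolding is_omega_iff[symmetric]
  by (simp add: omega_fm_def inductive_fm_def empty_fm_def succ_fm_def is_omega_def ind_def)

lemma sat_app_fm:
  "sat UNIV E st e (app_fm 1 3 4 10 11 12) \<longleftrightarrow> opair (e 3) (e 4) \<epsilon> e 1"
  "sat UNIV E st e (app_fm 2 3 4 10 11 12) \<longleftrightarrow> opair (e 3) (e 4) \<epsilon> e 2"
  by (simp_all add: app_fm_def pair_fm_def eq_opair_iff[symmetric])

lemma sat_funon_fm:
  "sat UNIV E st e (funon_fm 1 0 10 3 7 13 11 12) \<longleftrightarrow> funon (e 1) (e 0)"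
  "sat UNIV E st e (funon_fm 2 0 10 3 7 13 11 12) \<longleftrightarrow> funon (e 2) (e 0)"
  by (simp_all add: funon_fm_def app_fm_def pair_fm_def eq_opair_iff[symmetric] funon_def)

text \<open>The sentence \<open>star\<close> mentions standardness and so cannot be reflected as a
  whole; these are its internal building blocks.\<close>

definition star_fms :: "fm list" where
  "star_fms = [omega_fm 0 5 3 6 7 8 9, funon_fm 1 0 10 3 7 13 11 12, funon_fm 2 0 10 3 7 13 11 12,
     app_fm 1 3 4 10 11 12, app_fm 2 3 4 10 11 12]"

text \<open>The reading of \<open>star\<close> in the members of \<open>W\<close>: quantifiers range
  over \<open>W\<close>, while the internal parts keep their ambient meaning because they are
  reflected.\<close>

definition star_in :: "'a \<Rightarrow> bool" where
  "star_in W \<longleftrightarrow> (\<forall>F. F \<epsilon> W \<longrightarrow> funon F om \<longrightarrow>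
     (\<forall>n. n \<epsilon> W \<longrightarrow> st n \<and> n \<epsilon> om \<longrightarrow> (\<exists>v. v \<epsilon> W \<and> st v \<and> opair n v \<epsilon> F)) \<longrightarrow>
     (\<exists>G. G \<epsilon> W \<and> st G \<and> funon G om \<and>
       (\<forall>n. n \<epsilon> W \<longrightarrow> st n \<and> n \<epsilon> om \<longrightarrow> (\<exists>v. v \<epsilon> W \<and> opair n v \<epsilon> F \<and> opair n v \<epsilon> G))))"

lemma sat_star:
  assumes W: "good n p W" and e: "range e \<subseteq> {z. z \<epsilon> W}"
    and refl: "\<And>e q. q \<in> set star_fms \<Longrightarrow> range e \<subseteq> {z. z \<epsilon> W} \<Longrightarrow>
      sat {z. z \<epsilon> W} E st e q \<longleftrightarrow> sat UNIV E st e q"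
  shows "sat {z. z \<epsilon> W} E st e star \<longleftrightarrow> star_in W"
proof -
  let ?U = "{z. z \<epsilon> W}"
  have o: "sat ?U E st f (omega_fm 0 5 3 6 7 8 9) \<longleftrightarrow> f 0 = om"
    and f1: "sat ?U E st f (funon_fm 1 0 10 3 7 13 11 12) \<longleftrightarrow> funon (f 1) (f 0)"
    and f2: "sat ?U E st f (funon_fm 2 0 10 3 7 13 11 12) \<longleftrightarrow> funon (f 2) (f 0)"
    and a1: "sat ?U E st f (app_fm 1 3 4 10 11 12) \<longleftrightarrow> opair (f 3) (f 4) \<epsilon> f 1"
    and a2: "sat ?U E st f (app_fm 2 3 4 10 11 12) \<longleftrightarrow> opair (f 3) (f 4) \<epsilon> f 2"
    if "range f \<subseteq> ?U" for f
    using refl[OF _ that] by (simp_all add: star_fms_def sat_omega_fm sat_funon_fm sat_app_fm del: One_nat_def)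
  have "sat ?U E st e star \<longleftrightarrow> (\<forall>w\<in>?U. w = om \<longrightarrow> star_in W)"
    unfolding star_def sat.simps sat_connectives star_in_def
    by (simp add: o f1 f2 a1 a2 range_upd[OF range_upd] range_upd e Ball_def Bex_def cong: imp_cong conj_cong del: fun_upd_apply One_nat_def)
      (simp add: fun_upd_def)
  then show ?thesis using good_om[OF W] by simp
qed

lemma star_in_of_closed:
  assumes W: "good n p W" and stW: "st W" and cl: "\<And>g. isfun g W \<Longrightarrow> g \<epsilon> W"
  shows "star_in W"
  unfolding star_in_def
proof (intro allI impI)
  fix F assume F: "F \<epsilon> W" "funon F om"
    and stF: "\<forall>n. n \<epsilon> W \<longrightarrow> st n \<and> n \<epsilon> om \<longrightarrow> (\<exists>v. v \<epsilon> W \<and> st v \<and> opair n v \<epsilon> F)"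
  have F_fun: "y = y'" if "k \<epsilon> om" "opair k y \<epsilon> F" "opair k y' \<epsilon> F" for k y y'
    using F(2) that unfolding funon_def by metis
  have val: "\<exists>v. v \<epsilon> W \<and> st v \<and> opair k v \<epsilon> F" if "st k" "k \<epsilon> om" for k
    using stF that good_trans[OF W good_om[OF W] that(2)] by blast
  let ?Z = "\<lambda>Z. \<forall>q. q \<epsilon> Z \<longleftrightarrow> (\<exists>a b. a \<epsilon> om \<and> b \<epsilon> W \<and> q = opair a b)"
  have "dfb False {c. st c} (\<lambda>f. ?Z (f 0))" by (intro dfb_rules) (use stW in auto)
  moreover have "\<exists>Z. ?Z Z" using small_Times[of om W] unfolding small_def .
  ultimately obtain Z where Z: "st Z" "\<And>q. q \<epsilon> Z \<longleftrightarrow> (\<exists>a b. a \<epsilon> om \<and> b \<epsilon> W \<and> q = opair a b)"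
    using transfer[of ?Z] by blast
  have "dfb True UNIV (\<lambda>f. f 0 \<epsilon> F)" by (intro dfb_rules UNIV_I)
  from standardization[OF this Z(1)]
  obtain G where G: "st G" "\<And>q. st q \<Longrightarrow> q \<epsilon> G \<longleftrightarrow> q \<epsilon> Z \<and> q \<epsilon> F" by blast
  have GF: "opair k v \<epsilon> G" if "st k" "k \<epsilon> om" "v \<epsilon> W" "st v" "opair k v \<epsilon> F" for k v
    using G(2)[OF st_opair[OF that(1,4)]] Z(2) that by blast
  \<comment> \<open>Both clauses are verified at standard arguments and transferred;
    \<open>G\<close> and \<open>W\<close> are standard, and \<open>om\<close> is definable without
    parameters.\<close>
  have "isfun G W"
    unfolding isfun_def
  proof (intro conjI allI)
    fix q
    let ?Q = "\<lambda>q. q \<epsilon> G \<longrightarrow> (\<exists>k y. k \<epsilon> om \<and> y \<epsilon> W \<and> q = opair k y)"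
    have "dfb False {c. st c} (\<lambda>f. ?Q (f 0))" by (intro dfb_rules) (use stW G(1) in auto)
    then show "?Q q" by (rule transfer_all) (use G(2) Z(2) in blast)
  next
    fix k
    let ?Q = "\<lambda>k. k \<epsilon> om \<longrightarrow> (\<exists>y. opair k y \<epsilon> G \<and> (\<forall>y'. opair k y' \<epsilon> G \<longrightarrow> y' = y))"
    have "dfb False {c. st c} (\<lambda>f. ?Q (f 0))" by (intro dfb_rules) (use G(1) in auto)
    then show "?Q k"
    proof (rule transfer_all, intro impI)
      fix k assume k: "st k" "k \<epsilon> om"
      obtain v where v: "v \<epsilon> W" "st v" "opair k v \<epsilon> F" using val[OF k] by blast
      have "y' = v" if "opair k y' \<epsilon> G" for y'
      proof -
        \<comment> \<open>Membership in \<open>G\<close> is known only for standard pairs, whereas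
          \<open>y'\<close> is arbitrary. A second transfer, with \<open>k\<close> and
          \<open>v\<close> fixed, compares \<open>v\<close> with nonstandard values.\<close>
        let ?P = "\<lambda>y. opair k y \<epsilon> G \<longrightarrow> y = v"
        have "dfb False {c. st c} (\<lambda>f. ?P (f 0))" by (intro dfb_rules) (use G(1) k v in auto)
        moreover have "?P y" if "st y" for y
          using G(2)[OF st_opair[OF k(1) that]] F_fun[OF k(2) _ v(3)] by blast
        ultimately have "?P y'" by (rule transfer_all)
        then show ?thesis using that by blast
      qed
      then show "\<exists>y. opair k y \<epsilon> G \<and> (\<forall>y'. opair k y' \<epsilon> G \<longrightarrow> y' = y)"
        using GF[OF k v] by blast
    qed
  qed
  then have "G \<epsilon> W" "funon G om" using cl unfolding isfun_def funon_def by blast+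
  moreover have "\<exists>v. v \<epsilon> W \<and> opair k v \<epsilon> F \<and> opair k v \<epsilon> G" if k: "st k" "k \<epsilon> om" for k
    using val[OF k] GF[OF k] by blast
  ultimately show "\<exists>G. G \<epsilon> W \<and> st G \<and> funon G om \<and>
       (\<forall>n. n \<epsilon> W \<longrightarrow> st n \<and> n \<epsilon> om \<longrightarrow> (\<exists>v. v \<epsilon> W \<and> opair n v \<epsilon> F \<and> opair n v \<epsilon> G))"
    using G(1) by blast
qed

text \<open>In Idealization a standard finite set is its own witness. One standard instance then
  shows that the ideal element is finite.\<close>

lemma ex_fin_containing_standard: "\<exists>x. fin x \<and> (\<forall>a. st a \<longrightarrow> a \<epsilon> x)"
proof -
  have "drel (\<lambda>x a. fin x \<and> a \<epsilon> x)" by (intro dfb_rules)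
  from idealization[OF this] have "\<exists>x. \<forall>a. st a \<longrightarrow> fin x \<and> a \<epsilon> x" by blast
  then show ?thesis using ex_standard by blast
qed

lemma not_star_in_of_cofinal:
  assumes W: "good n p W" and stW: "st W" and "\<exists>g. isfun g W \<and> \<not> g \<epsilon> W"
  shows "\<not> star_in W"
proof
  assume star: "star_in W"
  have "dfb False {c. st c} (\<lambda>f. isfun (f 0) W \<and> \<not> f 0 \<epsilon> W)" by (intro dfb_rules) (use stW in auto)
  then obtain g where stg: "st g" and g: "isfun g W" and gW: "\<not> g \<epsilon> W"
    using transfer[of "\<lambda>g. isfun g W \<and> \<not> g \<epsilon> W"] assms(3) by blast
  have g_pair: "\<exists>k y. k \<epsilon> om \<and> y \<epsilon> W \<and> q = opair k y" if "q \<epsilon> g" for q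
    using g that unfolding isfun_def by blast
  have g_dom: "k \<epsilon> om \<and> y \<epsilon> W" if "opair k y \<epsilon> g" for k y
    using g_pair[OF that] by auto
  have g_val: "\<exists>y. opair k y \<epsilon> g \<and> y \<epsilon> W \<and> (\<forall>y'. opair k y' \<epsilon> g \<longrightarrow> y' = y)" if k: "k \<epsilon> om" for k
  proof -
    obtain y where "opair k y \<epsilon> g" "\<forall>y'. opair k y' \<epsilon> g \<longrightarrow> y' = y" using g k unfolding isfun_def by blast
    then show ?thesis using g_dom by blast
  qed
  obtain x where x: "fin x" "\<And>a. st a \<Longrightarrow> a \<epsilon> x" using ex_fin_containing_standard by blast
  \<comment> \<open>The values of \<open>g\<close> on a finite set are bounded by a member of
    \<open>W\<close>. The induction adds one argument at a time, and the finite set may contain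
    points outside \<open>om\<close>.\<close>
  let ?P = "\<lambda>u. \<exists>s. s \<epsilon> W \<and> (\<forall>k y. k \<epsilon> u \<and> opair k y \<epsilon> g \<longrightarrow> y \<epsilon> s)"
  have "?P x"
  proof (rule fin_induct[OF x(1)])
    show "dprd ?P" by (intro dfb_rules UNIV_I)
    show "?P emp" using good_om[OF W] by auto
    fix u a assume "?P u"
    then obtain s where s: "s \<epsilon> W" "\<And>k y. k \<epsilon> u \<Longrightarrow> opair k y \<epsilon> g \<Longrightarrow> y \<epsilon> s" by blast
    show "?P (cup u (upair a a))"
    proof (cases "a \<epsilon> om")
      case True
      then obtain b where b: "b \<epsilon> W" "\<And>y'. opair a y' \<epsilon> g \<Longrightarrow> y' = b" using g_val by blast
      obtain z where "z \<epsilon> W" "sub s z" "b \<epsilon> z" using good_adjoin[OF W s(1) b(1)] by blast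
      then show ?thesis using s(2) b(2) by (intro exI[of _ z]) (auto simp: sub_def)
    next
      case False
      then have "\<not> opair a y \<epsilon> g" for y using g_dom by blast
      then show ?thesis using s by (intro exI[of _ s]) auto
    qed
  qed
  then obtain s where s: "s \<epsilon> W" "\<And>k y. k \<epsilon> x \<Longrightarrow> opair k y \<epsilon> g \<Longrightarrow> y \<epsilon> s" by blast
  obtain z where z: "z \<epsilon> W" "sub s z" "sub om z" using good_adjoin[OF W s(1) good_om[OF W]] by blast
  obtain v where v: "v \<epsilon> W" "\<And>a b. a \<epsilon> z \<Longrightarrow> b \<epsilon> z \<Longrightarrow> opair a b \<epsilon> v" using good_square[OF W z(1)] by blast
  \<comment> \<open>All standard \<open>k\<close> lie in \<open>x\<close>, so \<open>F\<close> takes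
    the value of \<open>g\<close> there, which is standard because \<open>g\<close> and
    \<open>k\<close> are. The default \<open>emp\<close> makes \<open>F\<close> a function on all of
    \<open>om\<close>.\<close>
  let ?F = "\<lambda>q. \<exists>k y. k \<epsilon> om \<and> q = opair k y \<and> (k \<epsilon> x \<and> opair k y \<epsilon> g \<or> \<not> k \<epsilon> x \<and> y = emp)"
  have F_v: "q \<epsilon> v" if q: "?F q" for q
  proof -
    obtain k y where ky: "k \<epsilon> om" "q = opair k y" "k \<epsilon> x \<and> opair k y \<epsilon> g \<or> \<not> k \<epsilon> x \<and> y = emp" using q by blast
    have "k \<epsilon> z" using subD[OF z(3) ky(1)] .
    moreover have "y \<epsilon> z" using ky(3) s(2) subD[OF z(2)] subD[OF z(3) emp_om] by blast
    ultimately show ?thesis using v(2) ky(2) by blast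
  qed
  have "small ?F" by (rule small_bounded[OF _ F_v]) (intro dfb_rules UNIV_I)
  then obtain F where F: "\<And>q. q \<epsilon> F \<longleftrightarrow> ?F q" unfolding small_def by blast
  have F_opair: "opair k y \<epsilon> F \<longleftrightarrow> k \<epsilon> om \<and> (k \<epsilon> x \<and> opair k y \<epsilon> g \<or> \<not> k \<epsilon> x \<and> y = emp)" for k y
    unfolding F by auto
  have "sub F v" unfolding sub_def F using F_v by blast
  then have FW: "F \<epsilon> W" by (rule good_pot[OF W v(1)])
  have "funon F om"
    unfolding funon_def
  proof (intro conjI allI impI)
    fix q assume "q \<epsilon> F"
    then show "\<exists>n. n \<epsilon> om \<and> (\<exists>y. q = opair n y)" unfolding F by blast
  next
    fix k assume k: "k \<epsilon> om"
    show "\<exists>y. opair k y \<epsilon> F \<and> (\<forall>y'. opair k y' \<epsilon> F \<longrightarrow> y' = y)"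
      unfolding F_opair using g_val[OF k] k by (cases "k \<epsilon> x") auto
  qed
  moreover have "\<exists>y. y \<epsilon> W \<and> st y \<and> opair k y \<epsilon> F" if k: "st k" "k \<epsilon> om" for k
  proof -
    have "dfb False {c. st c} (\<lambda>f. opair k (f 0) \<epsilon> g \<and> f 0 \<epsilon> W)"
      by (intro dfb_rules) (use stg stW k in auto)
    then obtain y where "st y" "opair k y \<epsilon> g" "y \<epsilon> W"
      using transfer[of "\<lambda>y. opair k y \<epsilon> g \<and> y \<epsilon> W"] g_val[OF k(2)] by blast
    then show ?thesis unfolding F_opair using k x(2) by blast
  qed
  ultimately have "\<exists>G. G \<epsilon> W \<and> st G \<and> funon G om \<and>
       (\<forall>n. n \<epsilon> W \<longrightarrow> st n \<and> n \<epsilon> om \<longrightarrow> (\<exists>v. v \<epsilon> W \<and> opair n v \<epsilon> F \<and> opair n v \<epsilon> G))"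
    using star FW unfolding star_in_def by blast
  then obtain G where G: "G \<epsilon> W" "st G" "funon G om"
    "\<And>n. n \<epsilon> W \<Longrightarrow> st n \<Longrightarrow> n \<epsilon> om \<Longrightarrow> \<exists>v. opair n v \<epsilon> F \<and> opair n v \<epsilon> G" by blast
  \<comment> \<open>\<open>F\<close> is not standard and must disappear before Transfer is used: at
    standard \<open>k\<close> it agrees with \<open>g\<close>, which leaves a statement about the
    standard sets \<open>g\<close> and \<open>G\<close>.\<close>
  let ?Q = "\<lambda>k. k \<epsilon> om \<longrightarrow> (\<exists>v. opair k v \<epsilon> g \<and> opair k v \<epsilon> G)"
  have "dfb False {c. st c} (\<lambda>f. ?Q (f 0))" by (intro dfb_rules) (use stg G(2) in auto)
  moreover have "?Q k" if k: "st k" for k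
    using G(4)[OF _ k] good_trans[OF W good_om[OF W]] x(2)[OF k] unfolding F_opair by blast
  ultimately have agree: "?Q k" for k by (rule transfer_all)
  have G_fun: "y = y'" if "k \<epsilon> om" "opair k y \<epsilon> G" "opair k y' \<epsilon> G" for k y y'
    using G(3) that unfolding funon_def by metis
  have g_fun: "y = y'" if "k \<epsilon> om" "opair k y \<epsilon> g" "opair k y' \<epsilon> g" for k y y'
    using g_val that by metis
  have "g = G"
  proof (rule extensionality)
    fix q
    show "q \<epsilon> g \<longleftrightarrow> q \<epsilon> G"
    proof
      assume q: "q \<epsilon> g"
      then obtain k y where ky: "k \<epsilon> om" "q = opair k y" using g_pair by blast
      then show "q \<epsilon> G" using agree g_fun q by blast
    next
      assume q: "q \<epsilon> G"
      then obtain k y where ky: "k \<epsilon> om" "q = opair k y" using G(3) unfolding funon_def by blast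
      then show "q \<epsilon> g" using agree G_fun q by blast
    qed
  qed
  then show False using gW G(1) by simp
qed

section \<open>The contradiction inside a model of IST\<close>

lemma internal_star_fms: "q \<in> set star_fms \<Longrightarrow> internal q"
  by (auto simp: star_fms_def omega_fm_def inductive_fm_def empty_fm_def succ_fm_def funon_fm_def app_fm_def pair_fm_def)

lemma wcl_foldr_Imp: "wcl n X s (foldr Imp ps Bot) \<longleftrightarrow> (\<forall>p\<in>set ps. wcl n X s p)"
  by (induction ps) auto

lemma no_internal_equivalent_finite:
  assumes F: "finite F" "F \<subseteq> IST_ax" "prov F (Iff \<Phi> star)" and \<Phi>: "internal \<Phi>" "sentence \<Phi>"
  shows False
proof -
  obtain zs where zs: "set zs = F \<inter> ZFC_ax" using finite_list F(1) by (metis finite_Int)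
  obtain vs where vs: "set vs = (\<Union>q\<in>F. vars q)" using finite_list F(1) finite_vars by (metis finite_UN)
  \<comment> \<open>An instance of Idealization contains \<open>fin_fm A\<close> for its own
    variable \<open>A\<close>, so finiteness is reflected for every variable that occurs in
    \<open>F\<close>.\<close>
  define ps where "ps = \<Phi> # zs @ map fin_fm vs @ star_fms"
  \<comment> \<open>One formula has to carry the entire list. \<open>wcl\<close> descends through
    implications irrespective of truth, so a chain of implications works, whatever its truth
    value.\<close>
  define \<chi> where "\<chi> = foldr Imp ps Bot"
  have "internal (foldr Imp qs Bot)" if "\<forall>q\<in>set qs. internal q" for qs
    using that by (induction qs) auto
  moreover have "\<forall>q\<in>set ps. internal q"
    unfolding ps_def using \<Phi> zs internal_ZFC internal_fin_fm internal_star_fms by auto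
  ultimately have int: "internal \<chi>" unfolding \<chi>_def by blast
  obtain n where n: "vars \<chi> \<subseteq> {..<n}"
    using finite_nat_bounded[OF finite_vars] by blast
  have vars_ps: "vars q \<subseteq> {..<n}" if "q \<in> set ps" for q
  proof -
    have "vars q \<subseteq> vars (foldr Imp qs Bot)" if "q \<in> set qs" for qs
      using that by (induction qs) auto
    then show ?thesis using n that unfolding \<chi>_def by blast
  qed
  have main: "star_in W \<longleftrightarrow> sat UNIV E st (\<lambda>_. W) \<Phi>" if W: "good n \<chi> W" and stW: "st W" for W
  proof -
    let ?U = "{z. z \<epsilon> W}"
    have refl: "sat ?U E st e q \<longleftrightarrow> sat UNIV E st e q" if q: "q \<in> set ps" and e: "range e \<subseteq> ?U" for e q
    proof (rule wcl_reflects[OF _ vars_ps[OF q]])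
      show "wcl n W W q" using good_wcl[OF W] q unfolding \<chi>_def wcl_foldr_Imp by blast
      show "\<And>k. k < n \<Longrightarrow> e k \<epsilon> W" using e by auto
    qed
    have model: "sat ?U E st e q" if q: "q \<in> F" and e: "range e \<subseteq> ?U" for e q
    proof -
      consider "q \<in> ZFC_ax" | "q \<in> idealization_ax" | "q \<in> standardization_ax" | "q \<in> transfer_ax"
        using q F(2) unfolding IST_ax_def by blast
      then show ?thesis
      proof cases
        case 1
        then have "q \<in> set ps" using q zs unfolding ps_def by simp
        then show ?thesis using refl[OF _ e] ist q F(2) by blast
      next
        case 2
        then obtain \<Psi> x a A where ax: "internal \<Psi>" "A \<notin> fv \<Psi>" "distinct [x, a, A]"
          and q': "q = Iff (All A (Imp (And (St A) (fin_fm A)) (Ex x (All a (Imp (Mem a A) \<Psi>)))))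
            (Ex x (All a (Imp (St a) \<Psi>)))"
          unfolding idealization_ax_def by blast
        have "A \<in> vars q" unfolding q' by (simp add: Iff_def And_def Neg_def)
        then have "fin_fm A \<in> set ps" using vs q unfolding ps_def by auto
        then show ?thesis unfolding q' by (intro idealization_good[OF W stW e ax] refl)
      next
        case 3
        then obtain \<Psi> X Y x where "Y \<notin> fv \<Psi>" "distinct [X, Y, x]"
          and q': "q = All X (Imp (St X) (Ex Y (And (St Y)
            (All x (Imp (St x) (Iff (Mem x Y) (And (Mem x X) \<Psi>)))))))"
          unfolding standardization_ax_def by blast
        then show ?thesis unfolding q' by (intro standardization_good[OF W stW e])
      next
        case 4
        then obtain \<Psi> x ts where "internal \<Psi>" "fv \<Psi> \<subseteq> insert x (set ts)"
          and q': "q = Imp (st_all ts) (Imp (Ex x \<Psi>) (Ex x (And (St x) \<Psi>)))"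
          unfolding transfer_ax_def by blast
        then show ?thesis unfolding q' by (intro transfer_good[OF stW e])
      qed
    qed
    let ?e = "\<lambda>_. om"
    have e: "range ?e \<subseteq> ?U" using good_om[OF W] by auto
    have "sat ?U E st ?e (Iff \<Phi> star)" by (rule soundness[OF F(3) model e])
    moreover have "sat ?U E st ?e star \<longleftrightarrow> star_in W"
      by (rule sat_star[OF W e refl]) (simp add: ps_def)
    moreover have "sat ?U E st ?e \<Phi> \<longleftrightarrow> sat UNIV E st ?e \<Phi>"
      by (rule refl[OF _ e]) (simp add: ps_def)
    moreover have "sat UNIV E st ?e \<Phi> \<longleftrightarrow> sat UNIV E st (\<lambda>_. W) \<Phi>"
      by (rule sat_cong) (use \<Phi>(2) in \<open>simp add: sentence_def\<close>)
    ultimately show ?thesis by simp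
  qed
  have "dfb False {c. st c} (\<lambda>f. good n \<chi> (f 0) \<and> (\<exists>g. isfun g (f 0) \<and> \<not> g \<epsilon> f 0))"
    by (intro dfb_rules dfb_good int)
  then obtain W1 where W1: "st W1" "good n \<chi> W1" "\<exists>g. isfun g W1 \<and> \<not> g \<epsilon> W1"
    using transfer[of "\<lambda>W. good n \<chi> W \<and> (\<exists>g. isfun g W \<and> \<not> g \<epsilon> W)"] ex_good_omega_cofinal[OF int n] by blast
  have "dfb False {c. st c} (\<lambda>f. good n \<chi> (f 0) \<and> (\<forall>g. isfun g (f 0) \<longrightarrow> g \<epsilon> f 0))"
    by (intro dfb_rules dfb_good int)
  then obtain W2 where W2: "st W2" "good n \<chi> W2" "\<And>g. isfun g W2 \<Longrightarrow> g \<epsilon> W2"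
    using transfer[of "\<lambda>W. good n \<chi> W \<and> (\<forall>g. isfun g W \<longrightarrow> g \<epsilon> W)"] ex_good_omega_closed[OF int n] by blast
  have "\<not> star_in W1" by (rule not_star_in_of_cofinal[OF W1(2,1,3)])
  moreover have "star_in W2" by (rule star_in_of_closed[OF W2(2,1,3)])
  moreover have "sat UNIV E st (\<lambda>_. W1) \<Phi> \<longleftrightarrow> sat UNIV E st (\<lambda>_. W2) \<Phi>"
    by (rule sat_cong) (use \<Phi>(2) in \<open>simp add: sentence_def\<close>)
  ultimately show False using main[OF W1(2,1)] main[OF W2(2,1)] by simp
qed

end

text \<open>The locale lets quantifiers range over a whole type; this moves a model on a set of
  naturals to that form.\<close>

lemma sat_transport:
  assumes "bij_betw h UNIV U"
  shows "sat UNIV (\<lambda>a b. E (h a) (h b)) (\<lambda>a. S (h a)) e p \<longleftrightarrow> sat U E S (\<lambda>k. h (e k)) p"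
proof (induction p arbitrary: e)
  case (Eq a b)
  then show ?case using assms by (auto simp: bij_betw_def inj_eq)
next
  case (All x p)
  have U: "U = range h" using assms by (simp add: bij_betw_def)
  have "(\<lambda>k. h ((e(x := a)) k)) = (\<lambda>k. h (e k))(x := h a)" for a by auto
  then show ?case by (simp add: All.IH U)
qed simp_all

text \<open>Infinity of the carrier is what provides a bijection with the natural numbers. In a
  finite carrier Pairing and Union would produce a set containing everything, and Separation would
  turn it into Russell's paradox.\<close>

lemma IST_model_infinite:
  assumes ne: "U \<noteq> {}" and m: "\<And>p e. p \<in> IST_ax \<Longrightarrow> range e \<subseteq> U \<Longrightarrow> sat U E S e p"
  shows "infinite U"
proof
  assume fin: "finite U"
  obtain u0 where u0: "u0 \<in> U" using ne by blast
  have e: "range (\<lambda>_::nat. u0) \<subseteq> U" using u0 by auto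
  have pair: "\<forall>a\<in>U. \<forall>b\<in>U. \<exists>c\<in>U. E a c \<and> E b c"
    using m[OF _ e, of ax_pairing] by (simp add: IST_ax_def ZFC_ax_def ax_pairing_def)
  have union: "\<forall>a\<in>U. \<exists>c\<in>U. \<forall>b\<in>U. \<forall>z\<in>U. E z b \<and> E b a \<longrightarrow> E z c"
    using m[OF _ e, of ax_union] by (simp add: IST_ax_def ZFC_ax_def ax_union_def)
  have "\<exists>y\<in>U. \<forall>x\<in>F. E x y" if "finite F" "F \<subseteq> U" for F
    using that
  proof (induction F rule: finite_induct)
    case empty
    then show ?case using u0 by blast
  next
    case (insert a F)
    then obtain y where y: "y \<in> U" "\<forall>x\<in>F. E x y" by auto
    obtain q where q: "q \<in> U" "E a q" using pair insert.prems by blast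
    obtain c where c: "c \<in> U" "E y c" "E q c" using pair y q by blast
    obtain d where "d \<in> U" "\<forall>b\<in>U. \<forall>z\<in>U. E z b \<and> E b c \<longrightarrow> E z d" using union c by blast
    then show ?case using y q c insert.prems by (intro bexI[of _ d]) auto
  qed
  then obtain y where y: "y \<in> U" "\<forall>x\<in>U. E x y" using fin by blast
  have "All 0 (Ex 1 (All 2 (Iff (Mem 2 1) (And (Mem 2 0) (Neg (Mem 2 2)))))) \<in> separation_ax"
    unfolding separation_ax_def
    by (rule CollectI, rule exI[of _ "Neg (Mem 2 2)"], rule exI[of _ 2], rule exI[of _ 0], rule exI[of _ 1])
      (simp add: Neg_def)
  then have "All 0 (Ex 1 (All 2 (Iff (Mem 2 1) (And (Mem 2 0) (Neg (Mem 2 2)))))) \<in> IST_ax"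
    by (simp add: IST_ax_def ZFC_ax_def)
  from m[OF this e] have "\<forall>a\<in>U. \<exists>s\<in>U. \<forall>x\<in>U. E x s \<longleftrightarrow> E x a \<and> \<not> E x x" by simp
  then obtain s where "s \<in> U" "\<forall>x\<in>U. E x s \<longleftrightarrow> E x y \<and> \<not> E x x" using y(1) by blast
  then show False using y(2) by blast
qed

theorem theorem1:
  assumes "consistent IST_ax"
  shows "\<not> (\<exists>\<Phi>. sentence \<Phi> \<and> internal \<Phi> \<and> prov IST_ax (Iff \<Phi> star))"
proof
  assume "\<exists>\<Phi>. sentence \<Phi> \<and> internal \<Phi> \<and> prov IST_ax (Iff \<Phi> star)"
  then obtain \<Phi> where \<Phi>: "sentence \<Phi>" "internal \<Phi>" "prov IST_ax (Iff \<Phi> star)" by blast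
  obtain F where F: "finite F" "F \<subseteq> IST_ax" "prov F (Iff \<Phi> star)"
    using prov_finite_support[OF \<Phi>(3)] by blast
  obtain U :: "nat set" and E S where U: "U \<noteq> {}"
    and m: "\<And>p e. p \<in> IST_ax \<Longrightarrow> range e \<subseteq> U \<Longrightarrow> sat U E S e p"
    using completeness[OF assms] by metis
  have "bij_betw (from_nat_into U) UNIV U"
    using IST_model_infinite[OF U m] by (intro bij_betw_from_nat_into) auto
  then interpret ist_model "\<lambda>a b. E (from_nat_into U a) (from_nat_into U b)" "\<lambda>a. S (from_nat_into U a)"
  proof (unfold_locales, goal_cases)
    case (1 p e)
    have "range (\<lambda>k. from_nat_into U (e k)) \<subseteq> U"
      using 1(1) by (auto simp: bij_betw_def)
    then show ?case using sat_transport[OF 1(1)] m[OF 1(2)] by blast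
  qed
  show False by (rule no_internal_equivalent_finite[OF F \<Phi>(2,1)])
qed

end
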